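(* Let $d \geq 1$ and $1 \leq p,q \leq \infty$ with $1/p + 1/q = 1$. For a fixed $s > d/p$, let $(X_N)$ with $N \to \infty$ be a QMC-design sequence for $\mathbb{W}_p^s(\mathbb{S}^d)$. Then there exists a constant $c > 0$, depending on $d$, $s$, $p$ and the sequence $(X_N)$ but not on $N$, such that for all $X_N$ $$\rho(X_N) \leq c \, N^{-\beta/d}, \qquad \beta := s/(s + d/q).$$ In particular, if $p = 1$ (and thus $\beta = 1$ and $s > d$), then the sequence $(X_N)$ has the optimal covering property.
   Context: $\mathbb{S}^d$ is the unit sphere in $\mathbb{R}^{d+1}$, $\sigma_d$ its normalized surface area measure, and $\mathbb{L}_p(\mathbb{S}^d)$ the real $L_p$ space with respect to $\sigma_d$, with norm $\|\cdot\|_p$. Convention: $1/\infty = 0$. Sobolev space: for $f \in \mathbb{L}_1(\mathbb{S}^d)$ let $Y_\ell[f]$ be the projection of $f$ onto the spherical harmonics of exact degree $\ell$ on $\mathbb{S}^d$ (defined by integrating $f$ against the zonal reproducing kernel of that space), and let $\lambda_\ell = \ell(\ell+d-1)$ be the corresponding eigenvalue of the negative Laplace–Beltrami operator $-\Delta_d^*$. For $s \geq 0$, $1 \leq p \leq \infty$, $\mathbb{W}_p^s(\mathbb{S}^d)$ is the set of $f \in \mathbb{L}_p(\mathbb{S}^d)$ for which $(1-\Delta_d^* )^{s/2} f = \sum_{\ell\ge 0} (1+\lambda_\ell)^{s/2} Y_\ell[f]$ is in $\mathbb{L}_p(\mathbb{S}^d)$ (i.e. there is $g\in \mathbb{L}_p(\mathbb{S}^d)$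 with $Y_\ell[g] = (1+\lambda_\ell)^{s/2} Y_\ell[f]$ for all $\ell$), with norm $\|f\|_{\mathbb{W}_p^s(\mathbb{S}^d)} = \|(1-\Delta_d^* )^{s/2} f\|_p$. For $s > d/p$ this space embeds continuously into $C(\mathbb{S}^d)$, and its elements are identified with their continuous representatives. Worst-case error: for $X_N = \{\mathbf{x}_1,\dots,\mathbf{x}_N\}\subset \mathbb{S}^d$, $Q[X_N](f) = \frac1N \sum_{k=1}^N f(\mathbf{x}_k)$, $I(f) = \int_{\mathbb{S}^d} f\, d\sigma_d$, and for $s>d/p$ $$\operatorname{wce}(Q[X_N]; \mathbb{W}_p^s(\mathbb{S}^d)) = \sup\{ |Q[X_N](f) - I(f)| : f \in \mathbb{W}_p^s(\mathbb{S}^d),\ \|f\|_{\mathbb{W}_p^s(\mathbb{S}^d)} \leq 1\}.$$ QMC-design sequence: given $s > d/p$, a sequence $(X_N)$ of $N$-point configurations on $\mathbb{S}^d$, with $N\to\infty$ ($N$ running through some infinite subset of the natural numbers), is a QMC-design sequence for $\mathbb{W}_p^s(\mathbb{S}^d)$ if there is a constant $c_{p,s,d}>0$, independent of $N$, such that $\operatorname{wce}(Q[X_N];\mathbb{W}_p^s(\mathbb{S}^d)) \leq c_{p,s,d}\, N^{-s/d}$ for all $X_N$ in the sequence. Covering radius: $\rho(X_N) = \max_{\mathbf{x} \in \mathbb{S}^d} \min_{1 \leq k \leq N} \arccos(\mathbf{x} \cdot \mathbf{x}_k)$. A sequence $(X_N)$ has the optimal covering property if $\rho(X_N) = \mathcal{O}(N^{-1/d})$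 as $N \to \infty$. *)

theory Defs
  imports
    "HOL-Probability.Essential_Supremum"
    "HOL-Library.Landau_Symbols"
begin

text \<open>The sphere \<open>S^d\<close> is \<open>sphere 0 1 :: (real^'n) set\<close> with \<open>CARD('n) = d + 1\<close>. A function on it is
  represented by a function on \<open>real^'n\<close> whose values off the sphere are irrelevant.\<close>

definition sphere_dim :: "'n::finite itself \<Rightarrow> nat" where
  "sphere_dim _ = CARD('n) - 1"

text \<open>Normalized surface area measure, as the cone measure: the measure of \<open>A\<close> is the proportion
  of the unit ball that radial projection \<open>x \<mapsto> x / \<parallel>x\<parallel>\<close> (which is \<open>sgn\<close>) sends into \<open>A\<close>.\<close>

definition sphere_measure :: "(real^'n::finite) measure" where
  "sphere_measure = restrict_space (distr (uniform_measure lborel (cball 0 1)) borel sgn) (sphere 0 1)"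

text \<open>Exponents are extended nonnegative reals; in this type \<open>1 / \<infinity> = 0\<close>. Functions that agree almost
  everywhere are not identified.\<close>

definition Lp_space :: "ennreal \<Rightarrow> (real^'n::finite \<Rightarrow> real) set" where
  "Lp_space p = {f \<in> borel_measurable sphere_measure.
     if p = \<infinity> then esssup sphere_measure (\<lambda>x. ennreal \<bar>f x\<bar>) < \<infinity>
     else integrable sphere_measure (\<lambda>x. \<bar>f x\<bar> powr enn2real p)}"

definition Lp_norm :: "ennreal \<Rightarrow> (real^'n::finite \<Rightarrow> real) \<Rightarrow> real" where
  "Lp_norm p f =
     (if p = \<infinity> then enn2real (esssup sphere_measure (\<lambda>x. ennreal \<bar>f x\<bar>))
      else (LINT x|sphere_measure. \<bar>f x\<bar> powr enn2real p) powr (1 / enn2real p))"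

definition laplacian :: "('a::euclidean_space \<Rightarrow> real) \<Rightarrow> 'a \<Rightarrow> real" where
  "laplacian f x = (\<Sum>b\<in>Basis. (deriv ^^ 2) (\<lambda>t. f (x + t *\<^sub>R b)) 0)"

text \<open>Homogeneous harmonic polynomials of degree \<open>l\<close>; their restrictions to the sphere are the
  spherical harmonics of exact degree \<open>l\<close>. By homogeneity each is determined by its restriction.\<close>

definition solid_harmonics :: "nat \<Rightarrow> (real^'n::finite \<Rightarrow> real) set" where
  "solid_harmonics l = {h. real_polynomial_function h \<and>
     (\<forall>c x. h (c *\<^sub>R x) = c ^ l * h x) \<and> (\<forall>x. laplacian h x = 0)}"

text \<open>Reproducing kernel of the spherical harmonics of degree \<open>l\<close> for the inner product of
  \<open>L_2\<close>. Since this space is finite dimensional, the kernel exists and is unique.\<close>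

definition harmonic_kernel :: "nat \<Rightarrow> real^'n::finite \<Rightarrow> real^'n \<Rightarrow> real" where
  "harmonic_kernel l x = (THE k. k \<in> solid_harmonics l \<and>
     (\<forall>h\<in>solid_harmonics l. (LINT y|sphere_measure. k y * h y) = h x))"

definition harmonic_proj :: "nat \<Rightarrow> (real^'n::finite \<Rightarrow> real) \<Rightarrow> real^'n \<Rightarrow> real" where
  "harmonic_proj l f x = (LINT y|sphere_measure. f y * harmonic_kernel l x y)"

definition lb_eigenvalue :: "nat \<Rightarrow> nat \<Rightarrow> real" where
  "lb_eigenvalue d l = real l * (real l + real d - 1)"

text \<open>\<open>g = (1 - \<Delta>*)^(s/2) f\<close>, read off the harmonic projections.\<close>

definition is_bessel_image :: "real \<Rightarrow> (real^'n::finite \<Rightarrow> real) \<Rightarrow> (real^'n \<Rightarrow> real) \<Rightarrow> bool" where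
  "is_bessel_image s f g \<longleftrightarrow> (\<forall>l. \<forall>x\<in>sphere 0 1.
     harmonic_proj l g x =
       (1 + lb_eigenvalue (sphere_dim TYPE('n)) l) powr (s / 2) * harmonic_proj l f x)"

definition sobolev_space :: "ennreal \<Rightarrow> real \<Rightarrow> (real^'n::finite \<Rightarrow> real) set" where
  "sobolev_space p s = {f \<in> Lp_space p. \<exists>g\<in>Lp_space p. is_bessel_image s f g}"

text \<open>The choice is harmless: an integrable function is determined almost everywhere by its
  harmonic projections.\<close>

definition bessel_image :: "ennreal \<Rightarrow> real \<Rightarrow> (real^'n::finite \<Rightarrow> real) \<Rightarrow> real^'n \<Rightarrow> real" where
  "bessel_image p s f = (SOME g. g \<in> Lp_space p \<and> is_bessel_image s f g)"

definition sobolev_norm :: "ennreal \<Rightarrow> real \<Rightarrow> (real^'n::finite \<Rightarrow> real) \<Rightarrow> real" where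
  "sobolev_norm p s f = Lp_norm p (bessel_image p s f)"

text \<open>An \<open>N\<close>-point configuration is a family \<open>x 1, \<dots>, x N\<close>; repetitions are allowed.\<close>

definition qmc_rule :: "nat \<Rightarrow> (nat \<Rightarrow> real^'n::finite) \<Rightarrow> (real^'n \<Rightarrow> real) \<Rightarrow> real" where
  "qmc_rule N x f = (\<Sum>k=1..N. f (x k)) / real N"

text \<open>Restricting to continuous \<open>f\<close> expresses the identification of the elements of the Sobolev space,
  for \<open>s > d/p\<close>, with their continuous representatives. The supremum is taken in \<open>[0, \<infinity>]\<close>.\<close>

definition wce :: "ennreal \<Rightarrow> real \<Rightarrow> nat \<Rightarrow> (nat \<Rightarrow> real^'n::finite) \<Rightarrow> ennreal" where
  "wce p s N x =
     (SUP f \<in> {f \<in> sobolev_space p s. continuous_on (sphere 0 1) f \<and> sobolev_norm p s f \<le> 1}.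
        ennreal \<bar>qmc_rule N x f - (LINT y|sphere_measure. f y)\<bar>)"

text \<open>A sequence of configurations \<open>X N\<close>, with \<open>N\<close> running through the infinite set \<open>S\<close>.\<close>

definition configuration_sequence :: "nat set \<Rightarrow> (nat \<Rightarrow> nat \<Rightarrow> real^'n::finite) \<Rightarrow> bool" where
  "configuration_sequence S X \<longleftrightarrow>
     infinite S \<and> 0 \<notin> S \<and> (\<forall>N\<in>S. \<forall>k\<in>{1..N}. X N k \<in> sphere 0 1)"

definition qmc_design_sequence ::
    "ennreal \<Rightarrow> real \<Rightarrow> nat set \<Rightarrow> (nat \<Rightarrow> nat \<Rightarrow> real^'n::finite) \<Rightarrow> bool" where
  "qmc_design_sequence p s S X \<longleftrightarrow> configuration_sequence S X \<and>
     (\<exists>c>0. \<forall>N\<in>S. wce p s N (X N) \<le> ennreal (c * real N powr (- s / real (sphere_dim TYPE('n)))))"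

definition covering_radius :: "nat \<Rightarrow> (nat \<Rightarrow> real^'n::finite) \<Rightarrow> real" where
  "covering_radius N x = (SUP y \<in> sphere 0 1. Min ((\<lambda>k. arccos (y \<bullet> x k)) ` {1..N}))"

definition optimal_covering :: "nat set \<Rightarrow> (nat \<Rightarrow> nat \<Rightarrow> real^'n::finite) \<Rightarrow> bool" where
  "optimal_covering S X \<longleftrightarrow>
     (\<lambda>N. covering_radius N (X N)) \<in>
       O[inf sequentially (principal S)](\<lambda>N. real N powr (- 1 / real (sphere_dim TYPE('n))))"

end

theory Submission
  imports Defs "HOL-Probability.Probability" "HOL-Library.Function_Algebras"
begin

text \<open>Let \<open>y\<close> be a point of the sphere at angular distance at least \<open>r\<close> from every node. A test function
  \<open>F\<close> that is nonpositive outside the cap of radius \<open>r\<close> around \<open>y\<close>, but has a positive integral, is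
  integrated badly: the quadrature value is \<open>\<le> 0\<close>, so the error is at least the integral of \<open>F\<close>. If
  \<open>F\<close> is a bump of width \<open>r\<close>, its integral is of order \<open>r^d\<close> and its norm in the Sobolev space is of
  order \<open>r^(d/p - s)\<close>. Hence the worst-case error is at least of order \<open>r^(s + d/q)\<close>, and comparing with
  \<open>N^(-s/d)\<close> gives \<open>r = O(N^(-\<beta>/d))\<close>.

  The bump is an explicit polynomial. With \<open>u = (1 + x \<bullet> y)/2\<close>, \<open>w = 1 - u\<close> and \<open>\<eta> = (1 - cos r)/2\<close> it is
  \<open>F = M (\<eta> - w) u^(M-1)\<close>, where \<open>M\<close> is of order \<open>1/\<eta>\<close>, that is \<open>r^(-2)\<close>. Its sign is evident, and its
  integral follows from a recursion for the moments of \<open>u\<close> (lemma \<open>peaked_test_function\<close>).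
  The point is the bound for \<open>A^\<sigma> F\<close>, where \<open>A = 1 - \<Delta>\<close> with the spherical Laplacian \<open>\<Delta>\<close> and \<open>\<sigma> = s/2\<close> may
  be fractional. Three facts give it.

  First, \<open>\<Delta>\<close> maps \<open>u^k w^i\<close> to a combination of its neighbours of the same degree
  (\<open>spherical_laplacian_zonal_monomial\<close>). So integer powers of \<open>A\<close> cost a factor \<open>M\<close> each:
  \<open>|F| \<le> H\<close> and \<open>|A^k F| \<le> M^k H\<close> with one nonnegative polynomial \<open>H\<close> that is bounded and has integral
  of order \<open>M^(-d/2)\<close>.

  Second, the resolvents \<open>1/(t + A)\<close> preserve positivity, by the maximum principle
  (\<open>resolvent_nonneg\<close>), so such majorants survive under resolvents.

  Third, for \<open>0 < \<sigma> < k\<close> the power \<open>A^\<sigma>\<close> is a multiple of the integral of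
  \<open>t^(\<sigma>-1) (A/(t + A))^k\<close> over \<open>t > 0\<close>; the two majorants are used for \<open>t \<le> M\<close> and \<open>t \<ge> M\<close> and give
  \<open>M^\<sigma>\<close> (\<open>fractional_power_bound\<close>, \<open>fractional_estimate\<close>). This yields the bound in the supremum norm and
  in \<open>L_1\<close>, and between these the norm in \<open>L_p\<close> is estimated by Hoelder's inequality.

  Because only polynomials occur, all powers and resolvents of \<open>A\<close> are finite sums over the harmonic
  components. What remains is the basic theory of spherical harmonics: rotation invariance of the
  surface measure, the decomposition of polynomials into harmonics, the reproducing kernel, and the
  fact that the projections determine an integrable function almost everywhere, so that the Sobolev
  norm of \<open>F\<close> can be computed from any function with the right projections.\<close>

section \<open>Surface measure and its rotation invariance\<close>

lemma space_sphere_measure [simp]: "space sphere_measure = sphere (0::real^'n) 1"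
  by (simp add: sphere_measure_def space_restrict_space)

lemma sets_sphere_measure: "sets sphere_measure = sets (restrict_space borel (sphere (0::real^'n) 1))"
  unfolding sphere_measure_def by (rule sets_restrict_space_cong) simp

lemma borel_measurable_sgn_euclidean: "(sgn :: real^'n \<Rightarrow> real^'n) \<in> borel_measurable borel"
proof -
  have "sgn = (\<lambda>x::real^'n. inverse (norm x) *\<^sub>R x)"
    by (simp add: sgn_vec_def fun_eq_iff divide_inverse sgn_div_norm)
  then show ?thesis by simp
qed

lemma emeasure_cball_unit: "emeasure lborel (cball (0::real^'n) 1) \<noteq> 0" "emeasure lborel (cball (0::real^'n) 1) \<noteq> \<infinity>"
proof -
  show "emeasure lborel (cball (0::real^'n) 1) \<noteq> \<infinity>"
    using emeasure_lborel_cball_finite by (metis infinity_ennreal_def less_irrefl)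
  have "0 < measure lborel (cball (0::real^'n) 1)" using content_cball_pos[of 1 "0::real^'n"] by simp
  then show "emeasure lborel (cball (0::real^'n) 1) \<noteq> 0"
    by (metis measure_def enn2real_0 less_irrefl)
qed

lemma emeasure_sphere_measure:
  assumes "A \<in> sets (sphere_measure :: (real^'n) measure)"
  shows "emeasure sphere_measure A = emeasure (uniform_measure lborel (cball (0::real^'n) 1)) (sgn -` A)"
    "A \<in> sets borel"
proof -
  have A: "A \<in> sets borel" "A \<subseteq> sphere 0 1"
    using assms unfolding sets_sphere_measure by (auto simp: sets_restrict_space)
  show "A \<in> sets borel" by fact
  have "emeasure sphere_measure A = emeasure (distr (uniform_measure lborel (cball 0 1)) borel sgn) A"
    unfolding sphere_measure_def using A by (intro emeasure_restrict_space) auto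
  also have "\<dots> = emeasure (uniform_measure lborel (cball (0::real^'n) 1)) (sgn -` A)"
    using A borel_measurable_sgn_euclidean by (subst emeasure_distr) auto
  finally show "emeasure sphere_measure A = emeasure (uniform_measure lborel (cball (0::real^'n) 1)) (sgn -` A)" .
qed

lemma prob_space_sphere_measure: "prob_space (sphere_measure :: (real^'n) measure)"
proof
  let ?U = "uniform_measure lborel (cball (0::real^'n) 1)"
  interpret U: prob_space ?U
    by (rule prob_space_uniform_measure) (use emeasure_cball_unit in auto)
  have "emeasure (sphere_measure :: (real^'n) measure) (space sphere_measure) = emeasure ?U (sgn -` sphere 0 1)"
    by (subst emeasure_sphere_measure) (auto simp: sets_sphere_measure sets_restrict_space)
  also have "sgn -` sphere (0::real^'n) 1 = UNIV - {0}"
    by (auto simp: norm_sgn)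
  also have "emeasure ?U (UNIV - {0}) = emeasure ?U UNIV - emeasure ?U {0}"
    using U.emeasure_space_1 by (intro emeasure_Diff) auto
  also have "emeasure ?U {0} = 0"
    by (simp add: emeasure_lborel_countable)
  also have "emeasure ?U UNIV = 1" using U.emeasure_space_1 by simp
  finally show "emeasure (sphere_measure :: (real^'n) measure) (space sphere_measure) = 1" by simp
qed

lemma orthogonal_sgn:
  assumes "orthogonal_transformation (T :: real^'n \<Rightarrow> real^'n)"
  shows "sgn (T x) = T (sgn x)"
proof -
  have "linear T" "norm (T x) = norm x"
    using assms by (auto simp: orthogonal_transformation)
  then show ?thesis by (simp add: sgn_div_norm linear_cmul)
qed

lemma orthogonal_measurable:
  fixes T :: "real^'n::finite \<Rightarrow> real^'n"
  assumes T: "orthogonal_transformation T"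
  shows "T \<in> borel_measurable borel" "T \<in> sphere_measure \<rightarrow>\<^sub>M sphere_measure"
proof -
  have lin: "linear T" and nT: "\<And>x. norm (T x) = norm x"
    using T by (auto simp: orthogonal_transformation)
  have cT: "continuous_on UNIV T" using lin by (simp add: linear_continuous_on linear_conv_bounded_linear)
  show Tb: "T \<in> borel_measurable borel" using cT by (rule borel_measurable_continuous_onI)
  have "T \<in> restrict_space borel (sphere 0 1) \<rightarrow>\<^sub>M restrict_space borel (sphere 0 1)"
    using Tb nT by (intro measurable_restrict_space3) auto
  then show "T \<in> sphere_measure \<rightarrow>\<^sub>M sphere_measure"
    using measurable_cong_sets[OF sets_sphere_measure sets_sphere_measure] by blast
qed

text \<open>By Vitali's covering theorem an open set is, up to a null set, a countable disjoint union of balls.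
  Orthogonal maps send balls to balls of the same radius and null sets to null sets, so they preserve
  the measure of open sets and hence of all Borel sets.\<close>

lemma distr_lborel_orthogonal:
  fixes T :: "'a::euclidean_space \<Rightarrow> 'a"
  assumes T: "orthogonal_transformation T"
  shows "distr lborel borel T = lborel"
proof -
  have lin: "linear T" and nT: "\<And>x. norm (T x) = norm x"
    using T by (auto simp: orthogonal_transformation)
  have bij: "bij T" using T by (simp add: orthogonal_transformation_bij)
  have T': "orthogonal_transformation (inv T)" using T by (rule orthogonal_transformation_inv)
  have Tb: "T \<in> borel_measurable borel"
    using lin by (intro borel_measurable_continuous_onI) (simp add: linear_continuous_on linear_conv_bounded_linear)
  have vim: "T -` B \<in> sets borel" if "B \<in> sets borel" for B
    using Tb that by (metis measurable_sets_borel)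
  have em: "emeasure (distr lborel borel T) B = emeasure lborel (T -` B)" if "B \<in> sets borel" for B
    using that Tb by (simp add: emeasure_distr)
  have balls: "emeasure (distr lborel borel T) (ball a r) = emeasure lborel (ball a r)" for a r
  proof -
    have "inv T ` ball a r = ball (inv T a) r" by (rule image_orthogonal_transformation_ball[OF T'])
    then have "T -` ball a r = ball (inv T a) r" using bij by (simp add: bij_vimage_eq_inv_image)
    then have "emeasure (distr lborel borel T) (ball a r) = emeasure lborel (ball (inv T a) r)" by (simp add: em)
    also have "\<dots> = emeasure lborel (ball a r)"
      by (cases "r \<ge> 0") (simp_all add: emeasure_ball ball_empty)
    finally show ?thesis .
  qed
  have null: "emeasure (distr lborel borel T) B = 0" if "negligible B" "B \<in> sets borel" for B
  proof -
    have lin': "linear (inv T)" using T' by (simp add: orthogonal_transformation)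
    have "negligible (inv T ` B)"
      using that(1) lin' by (intro negligible_differentiable_image_negligible) (auto simp: linear_imp_differentiable_on)
    then have "negligible (T -` B)" using bij by (simp add: bij_vimage_eq_inv_image)
    then show ?thesis using vim[OF that(2)] by (simp add: em that negligible_iff_emeasure0)
  qed
  have opens: "emeasure lborel U = emeasure (distr lborel borel T) U" if U: "open U" for U
  proof -
    define K where "K = {(a::'a, r::real). 0 < r \<and> ball a r \<subseteq> U}"
    have "\<exists>i. i \<in> K \<and> x \<in> ball (fst i) (snd i) \<and> snd i < e" if x: "x \<in> U" "0 < e" for x e
    proof -
      obtain r where r: "r > 0" "ball x r \<subseteq> U" using U x by (meson openE)
      define t where "t = min r (e/2)"
      have "(x, t) \<in> K" using r x unfolding K_def t_def by (auto simp: subset_eq)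
      moreover have "x \<in> ball x t" "t < e" using r x by (auto simp: t_def)
      ultimately show ?thesis by (intro exI[of _ "(x,t)"]) auto
    qed
    then obtain C where C: "countable C" "C \<subseteq> K"
      "pairwise (\<lambda>i j. disjnt (ball (fst i) (snd i)) (ball (fst j) (snd j))) C"
      "negligible (U - (\<Union>i \<in> C. ball (fst i) (snd i)))"
      by (rule Vitali_covering_theorem_balls)
    let ?V = "\<Union>i\<in>C. ball (fst i) (snd i)"
    have VU: "?V \<subseteq> U" using C(2) by (fastforce simp: K_def)
    have Vop: "open ?V" by auto
    have dec: "emeasure M U = (\<integral>\<^sup>+i. emeasure M (ball (fst i) (snd i)) \<partial>count_space C)"
      if M: "sets M = sets borel" "\<And>B. negligible B \<Longrightarrow> B \<in> sets borel \<Longrightarrow> emeasure M B = 0" for M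
    proof -
      have n0: "emeasure M (U - ?V) = 0" by (rule M(2)[OF C(4)]) (use U Vop in \<open>simp add: sets.Diff\<close>)
      have "emeasure M U = emeasure M (?V \<union> (U - ?V))" using VU by (intro arg_cong[where f="emeasure M"]) auto
      also have "\<dots> = emeasure M ?V"
      proof (rule emeasure_Un_null_set)
        show "?V \<in> sets M" using Vop M(1) by simp
        show "U - ?V \<in> null_sets M" using n0 U Vop M(1) by (intro null_setsI) (simp_all add: sets.Diff)
      qed
      also have "\<dots> = (\<integral>\<^sup>+i. emeasure M (ball (fst i) (snd i)) \<partial>count_space C)"
      proof (rule emeasure_UN_countable)
        show "disjoint_family_on (\<lambda>i. ball (fst i) (snd i)) C"
          using C(3) unfolding pairwise_def disjoint_family_on_def disjnt_def by blast
      qed (use C(1) M(1) in simp_all)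
      finally show ?thesis .
    qed
    have "emeasure lborel U = (\<integral>\<^sup>+i. emeasure lborel (ball (fst i) (snd i)) \<partial>count_space C)"
      by (rule dec) (auto simp: negligible_iff_emeasure0)
    also have "\<dots> = emeasure (distr lborel borel T) U"
      by (subst dec[of "distr lborel borel T"]) (auto simp: null balls)
    finally show ?thesis .
  qed
  show ?thesis
  proof (rule measure_eqI_generator_eq[where E="Collect open" and \<Omega>=UNIV and A="\<lambda>i. ball 0 (real i)"])
    show "(\<Union>i. ball (0::'a) (real i)) = UNIV" by (auto simp: reals_Archimedean2)
    show "sets lborel = sigma_sets UNIV (Collect open)" "sets (distr lborel borel T) = sigma_sets UNIV (Collect open)"
      by (simp_all add: borel_def)
    show "emeasure (distr lborel borel T) (ball (0::'a) (real i)) \<noteq> \<infinity>" for i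
      using emeasure_lborel_ball_finite[of "0::'a" "real i"] by (simp add: less_top balls)
    show "Int_stable (Collect open :: 'a set set)" by (auto simp: Int_stable_def)
  qed (use opens in auto)
qed

text \<open>The radial projection commutes with orthogonal maps, which reduces the claim to Lebesgue measure on
  the unit ball.\<close>

lemma distr_sphere_measure_orthogonal:
  assumes T: "orthogonal_transformation (T :: real^'n \<Rightarrow> real^'n)"
  shows "distr sphere_measure sphere_measure T = sphere_measure"
proof -
  have nT: "\<And>x. norm (T x) = norm x" using T by (auto simp: orthogonal_transformation)
  note Tb = orthogonal_measurable(1)[OF T] and TS = orthogonal_measurable(2)[OF T]
  have inv: "emeasure lborel (T -` B) = emeasure lborel B" if B: "B \<in> sets borel" for B
    using emeasure_distr[of T lborel borel B] Tb B by (simp add: distr_lborel_orthogonal[OF T])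
  show ?thesis
  proof (rule measure_eqI)
    fix A assume "A \<in> sets (distr sphere_measure sphere_measure T)"
    then have A: "A \<in> sets sphere_measure" by simp
    have Ab: "A \<in> sets borel" "A \<subseteq> sphere 0 1" using emeasure_sphere_measure(2)[OF A] sets.sets_into_space[OF A] by auto
    let ?A' = "T -` A \<inter> sphere 0 1"
    have A': "?A' \<in> sets sphere_measure" using measurable_sets[OF TS A] by simp
    have eqA: "?A' = T -` A" using Ab nT by auto
    have V: "emeasure (uniform_measure lborel (cball (0::real^'n) 1)) (sgn -` T -` A) = emeasure (uniform_measure lborel (cball (0::real^'n) 1)) (sgn -` A)"
    proof -
      have m1: "sgn -` A \<in> sets borel" using Ab borel_measurable_sgn_euclidean by (metis measurable_sets_borel)
      have e: "sgn -` T -` A = T -` sgn -` A" using orthogonal_sgn[OF T] by auto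
      have m2: "sgn -` T -` A \<in> sets borel" unfolding e using Tb m1 by (metis measurable_sets_borel)
      have "emeasure lborel (cball 0 1 \<inter> sgn -` T -` A) = emeasure lborel (T -` (cball 0 1 \<inter> sgn -` A))"
        unfolding e using nT by (intro arg_cong[where f="emeasure lborel"]) auto
      also have "\<dots> = emeasure lborel (cball 0 1 \<inter> sgn -` A)"
        using m1 by (intro inv) auto
      finally show ?thesis using m1 m2 by (simp add: emeasure_uniform_measure)
    qed
    have "emeasure (distr sphere_measure sphere_measure T) A = emeasure sphere_measure ?A'"
      using TS A by (subst emeasure_distr) auto
    also have "\<dots> = emeasure sphere_measure A"
      unfolding emeasure_sphere_measure(1)[OF A] emeasure_sphere_measure(1)[OF A'] unfolding eqA by (rule V)
    finally show "emeasure (distr sphere_measure sphere_measure T) A = emeasure sphere_measure A" .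
  qed simp
qed

lemma borel_measurable_continuous_sphere:
  assumes "continuous_on (sphere 0 1) (f :: real^'n \<Rightarrow> real)"
  shows "f \<in> borel_measurable sphere_measure"
  using borel_measurable_continuous_on_restrict[OF assms] measurable_cong_sets[OF sets_sphere_measure refl] by blast

lemma integrable_bounded_sphere:
  assumes "f \<in> borel_measurable (sphere_measure :: (real^'n) measure)" "\<And>x. x \<in> sphere 0 1 \<Longrightarrow> \<bar>f x\<bar> \<le> (B::real)"
  shows "integrable sphere_measure f"
proof -
  interpret prob_space "sphere_measure :: (real^'n) measure" by (rule prob_space_sphere_measure)
  show ?thesis using assms by (intro integrable_const_bound[where B=B] AE_I2) auto
qed

lemma bounded_continuous_sphere:
  assumes "continuous_on (sphere 0 1) (f :: real^'n \<Rightarrow> real)"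
  obtains B where "B > 0" "\<And>x. x \<in> sphere 0 1 \<Longrightarrow> \<bar>f x\<bar> \<le> B"
proof -
  have "bounded (f ` sphere 0 1)" using assms by (intro compact_imp_bounded compact_continuous_image) auto
  then obtain B where "B>0" "\<forall>y\<in>f ` sphere 0 1. norm y \<le> B" by (auto simp: bounded_pos)
  then show thesis by (intro that[of B]) auto
qed

lemma integrable_continuous_sphere:
  assumes "continuous_on (sphere 0 1) (f :: real^'n \<Rightarrow> real)"
  shows "integrable sphere_measure f"
  using bounded_continuous_sphere[OF assms] borel_measurable_continuous_sphere[OF assms] integrable_bounded_sphere by metis

lemma integral_sphere_orthogonal:
  assumes T: "orthogonal_transformation (T :: real^'n \<Rightarrow> real^'n)" and f: "continuous_on (sphere 0 1) f"
  shows "(LINT x|sphere_measure. f (T x)) = (LINT x|sphere_measure. (f x::real))"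
proof -
  have "(LINT x|distr sphere_measure sphere_measure T. f x) = (LINT x|sphere_measure. f (T x))"
    using orthogonal_measurable(2)[OF T] borel_measurable_continuous_sphere[OF f] by (rule integral_distr)
  then show ?thesis by (simp add: distr_sphere_measure_orthogonal[OF T])
qed

text \<open>The cone over a nonempty relatively open part of the sphere contains a nonempty open set, so it is
  not a null set.\<close>

lemma continuous_AE_zero_sphere:
  assumes f: "continuous_on (sphere 0 1) (f :: real^'n \<Rightarrow> real)" and ae: "AE x in sphere_measure. f x = 0"
    and x: "x \<in> sphere 0 1"
  shows "f x = 0"
proof (rule ccontr)
  assume nz: "f x \<noteq> 0"
  define A where "A = {z\<in>sphere 0 1. f z \<noteq> 0}"
  have fm: "f \<in> borel_measurable sphere_measure" by (rule borel_measurable_continuous_sphere[OF f])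
  have "{z\<in>space sphere_measure. f z \<noteq> 0} \<in> sets sphere_measure" using fm by measurable
  then have A: "A \<in> sets sphere_measure" by (simp add: A_def)
  have "emeasure sphere_measure A = 0"
    using ae AE_iff_measurable[OF A, of "\<lambda>z. f z = 0"] by (simp add: A_def)
  then have "emeasure (uniform_measure lborel (cball (0::real^'n) 1)) (sgn -` A) = 0"
    using emeasure_sphere_measure[OF A] by simp
  moreover have mA: "sgn -` A \<in> sets borel" using emeasure_sphere_measure(2)[OF A] borel_measurable_sgn_euclidean
    by (metis measurable_sets_borel)
  ultimately have z: "emeasure lborel (cball (0::real^'n) 1 \<inter> sgn -` A) = 0"
    using emeasure_cball_unit[where 'n='n] by (auto simp: emeasure_uniform_measure ennreal_divide_eq_0_iff)
  define O' where "O' = {z. z \<in> ball (0::real^'n) 1 - {0} \<and> f (sgn z) \<noteq> 0}"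
  have "continuous_on (ball (0::real^'n) 1 - {0}) (\<lambda>z. f (sgn z))"
  proof (rule continuous_on_compose2[OF f])
    show "continuous_on (ball (0::real^'n) 1 - {0}) sgn"
      by (intro continuous_intros continuous_on_sgn[OF continuous_on_id]) auto
    show "sgn ` (ball (0::real^'n) 1 - {0}) \<subseteq> sphere 0 1" by (auto simp: norm_sgn split: if_split_asm)
  qed
  then have op: "open O'"
    using continuous_open_preimage[of "ball (0::real^'n) 1 - {0}" "\<lambda>z. f (sgn z)" "- {0}"]
      open_Compl[OF closed_singleton[of "0::real"]]
    unfolding O'_def by (simp add: open_delete vimage_def Int_def conj_assoc)
  have "O' \<subseteq> cball (0::real^'n) 1 \<inter> sgn -` A" unfolding O'_def A_def by (auto simp: norm_sgn split: if_splits)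
  then have "emeasure lborel O' = 0"
    using z mA by (metis emeasure_mono le_zero_eq sets.Int sets_lborel borel_closed closed_cball)
  then have "O' \<in> null_sets lborel" using op by auto
  then have "negligible O'" by (simp add: negligible_iff_null_sets null_sets_completionI)
  then have "O' = {}" using op open_not_negligible by blast
  moreover have "(1/2) *\<^sub>R x \<in> O'"
  proof -
    have "sgn ((1/2) *\<^sub>R x) = x" using x by (simp add: sgn_scaleR sgn_div_norm)
    then show ?thesis using x nz unfolding O'_def by auto
  qed
  ultimately show False by blast
qed

lemma integral_square_zero_sphere:
  assumes f: "continuous_on (sphere 0 1) (f :: real^'n \<Rightarrow> real)" and z: "(LINT x|sphere_measure. f x * f x) = 0"
    and x: "x \<in> sphere 0 1"
  shows "f x = 0"
proof -
  have c: "continuous_on (sphere 0 1) (\<lambda>x. f x * f x)" using f by (intro continuous_intros)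
  have "AE x in sphere_measure. f x * f x = 0"
    using z integral_nonneg_eq_0_iff_AE[OF integrable_continuous_sphere[OF c]] by simp
  then have "f x * f x = 0" by (rule continuous_AE_zero_sphere[OF c _ x])
  then show ?thesis by simp
qed

section \<open>Derivatives of polynomials and the spherical Laplacian\<close>

definition partial_deriv :: "'n \<Rightarrow> (real^'n::finite \<Rightarrow> real) \<Rightarrow> real^'n \<Rightarrow> real" where
  "partial_deriv i f x = frechet_derivative f (at x) (axis i 1)"

lemmas polynomial_linear = real_polynomial_function.intros(1)
  and polynomial_const = real_polynomial_function.intros(2)
  and polynomial_add = real_polynomial_function.intros(3)
  and polynomial_mult = real_polynomial_function.intros(4)

lemma has_derivative_polynomial:
  assumes "real_polynomial_function (f :: real^'n \<Rightarrow> real)"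
  shows "(f has_derivative frechet_derivative f (at x)) (at x)"
proof -
  have "f differentiable at x"
    using assms differentiable_at_polynomial_function real_polynomial_function_eq by blast
  then show ?thesis by (simp add: frechet_derivative_works)
qed

lemma partial_deriv_eqI: "(f has_derivative f') (at x) \<Longrightarrow> partial_deriv i f x = f' (axis i 1)"
  unfolding partial_deriv_def using frechet_derivative_at by metis

lemma partial_deriv_const [simp]: "partial_deriv i (\<lambda>x. c) = (\<lambda>x. 0)"
  by (rule ext) (rule partial_deriv_eqI[OF has_derivative_const])

lemma partial_deriv_linear: "bounded_linear f \<Longrightarrow> partial_deriv i f = (\<lambda>x. f (axis i 1))"
  by (intro ext partial_deriv_eqI bounded_linear_imp_has_derivative)

lemma partial_deriv_component: "partial_deriv i (\<lambda>x. x $ j) = (\<lambda>x. if i = j then 1 else 0)"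
  by (subst partial_deriv_linear) (auto simp: bounded_linear_vec_nth axis_def fun_eq_iff)

lemma partial_deriv_add:
  "real_polynomial_function f \<Longrightarrow> real_polynomial_function g \<Longrightarrow>
    partial_deriv i (\<lambda>x. f x + g x) = (\<lambda>x. partial_deriv i f x + partial_deriv i g x)"
  by (intro ext, subst partial_deriv_eqI, rule has_derivative_add[OF has_derivative_polynomial has_derivative_polynomial])
    (auto simp: partial_deriv_def)

lemma partial_deriv_mult:
  "real_polynomial_function f \<Longrightarrow> real_polynomial_function g \<Longrightarrow>
    partial_deriv i (\<lambda>x. f x * g x) = (\<lambda>x. f x * partial_deriv i g x + partial_deriv i f x * g x)"
  by (intro ext, subst partial_deriv_eqI, rule has_derivative_mult[OF has_derivative_polynomial has_derivative_polynomial])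
    (auto simp: partial_deriv_def)

lemma partial_deriv_cmult:
  "real_polynomial_function f \<Longrightarrow> partial_deriv i (\<lambda>x. c * f x) = (\<lambda>x. c * partial_deriv i f x)"
  by (subst partial_deriv_mult) auto

lemma partial_deriv_diff:
  assumes "real_polynomial_function f" "real_polynomial_function g"
  shows "partial_deriv i (\<lambda>x. f x - g x) = (\<lambda>x. partial_deriv i f x - partial_deriv i g x)"
  using partial_deriv_add[of f "\<lambda>x. (-1) * g x" i] partial_deriv_cmult[of g i "-1"] assms
  by (auto simp: real_polynomial_function.intros)

lemma polynomial_component [intro]: "real_polynomial_function (\<lambda>x. x $ j)"
  by (rule polynomial_linear) (rule bounded_linear_vec_nth)

lemma polynomial_partial_deriv [intro]:
  "real_polynomial_function f \<Longrightarrow> real_polynomial_function (partial_deriv i f)"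
  by (induction f rule: real_polynomial_function.induct)
    (auto simp: partial_deriv_linear partial_deriv_add partial_deriv_mult)

lemma partial_deriv_sum:
  assumes "finite I" "\<And>i. i \<in> I \<Longrightarrow> real_polynomial_function (f i)"
  shows "partial_deriv j (\<lambda>x. \<Sum>i\<in>I. f i x) = (\<lambda>x. \<Sum>i\<in>I. partial_deriv j (f i) x)"
  using assms
proof (induction I rule: finite_induct)
  case (insert k I)
  then show ?case
    by (simp add: partial_deriv_add[of "f k" "\<lambda>x. \<Sum>i\<in>I. f i x"] real_polynomial_function_sum)
qed simp

lemma partial_deriv_commute:
  "real_polynomial_function f \<Longrightarrow> partial_deriv i (partial_deriv j f) = partial_deriv j (partial_deriv i f)"
proof (induction f rule: real_polynomial_function.induct)
  case (mult f g)
  then show ?case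
    by (simp add: partial_deriv_mult partial_deriv_add polynomial_partial_deriv polynomial_mult algebra_simps)
qed (auto simp: partial_deriv_linear partial_deriv_add polynomial_partial_deriv)

lemma frechet_derivative_partial:
  assumes "real_polynomial_function (f :: real^'n \<Rightarrow> real)"
  shows "frechet_derivative f (at x) v = (\<Sum>i\<in>UNIV. v $ i * partial_deriv i f x)"
proof -
  have lin: "linear (frechet_derivative f (at x))"
    using has_derivative_polynomial[OF assms, of x] by (rule has_derivative_linear)
  have "v = (\<Sum>i\<in>UNIV. v $ i *\<^sub>R axis i 1)"
    by (simp add: vec_eq_iff axis_def if_distrib cong: if_cong)
  then have "frechet_derivative f (at x) v = frechet_derivative f (at x) (\<Sum>i\<in>UNIV. v $ i *\<^sub>R axis i 1)" by simp
  also have "\<dots> = (\<Sum>i\<in>UNIV. v $ i * partial_deriv i f x)"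
    using lin by (simp add: linear_sum linear_cmul partial_deriv_def)
  finally show ?thesis .
qed

lemma polynomial_along_curve:
  assumes f: "real_polynomial_function (f :: real^'n \<Rightarrow> real)" and \<gamma>: "(\<gamma> has_vector_derivative v) (at t)"
  shows "((\<lambda>t. f (\<gamma> t)) has_real_derivative (\<Sum>i\<in>UNIV. v $ i * partial_deriv i f (\<gamma> t))) (at t)"
proof -
  have "((\<lambda>t. f (\<gamma> t)) has_derivative (\<lambda>h. frechet_derivative f (at (\<gamma> t)) (h *\<^sub>R v))) (at t)"
    using has_derivative_compose[OF \<gamma>[unfolded has_vector_derivative_def] has_derivative_polynomial[OF f]] .
  then show ?thesis
    by (rule has_derivative_imp_has_field_derivative)
      (simp add: frechet_derivative_partial[OF f] sum_distrib_left mult_ac)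
qed

lemma laplacian_partial:
  assumes "real_polynomial_function (f :: real^'n \<Rightarrow> real)"
  shows "laplacian f x = (\<Sum>i\<in>UNIV. partial_deriv i (partial_deriv i f) x)"
proof -
  have d: "((\<lambda>t. g (x + t *\<^sub>R axis i 1)) has_real_derivative partial_deriv i g (x + t *\<^sub>R axis i 1)) (at t)"
    if g: "real_polynomial_function g" for g and i :: 'n and t
  proof -
    have "((\<lambda>t. x + t *\<^sub>R axis i 1) has_vector_derivative axis i (1::real)) (at t)"
      by (auto intro!: derivative_eq_intros)
    from polynomial_along_curve[OF g this] show ?thesis
      by (simp add: axis_def if_distrib[where f="\<lambda>u. u * _"] cong: if_cong)
  qed
  have 2: "(deriv ^^ 2) (\<lambda>t. f (x + t *\<^sub>R axis i 1)) 0 = partial_deriv i (partial_deriv i f) x" for i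
  proof -
    have "deriv (\<lambda>t. f (x + t *\<^sub>R axis i 1)) = (\<lambda>t. partial_deriv i f (x + t *\<^sub>R axis i 1))"
      using DERIV_imp_deriv[OF d[OF assms]] by (rule ext)
    then show ?thesis
      using DERIV_imp_deriv[OF d[OF polynomial_partial_deriv[OF assms], of i i 0]]
      by (simp add: numeral_2_eq_2)
  qed
  have inj: "inj (\<lambda>i::'n. axis i (1::real))" by (auto simp: inj_def axis_eq_axis)
  have B: "(Basis :: (real^'n) set) = range (\<lambda>i. axis i 1)" by (auto simp: Basis_vec_def)
  show ?thesis unfolding laplacian_def B by (subst sum.reindex[OF inj]) (simp add: 2)
qed

text \<open>The infinitesimal generator of the rotations in the plane of the coordinates \<open>i\<close> and \<open>j\<close>. Unlike
  partial derivatives it is intrinsic to the sphere.\<close>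

definition rotation_deriv :: "'n \<Rightarrow> 'n \<Rightarrow> (real^'n::finite \<Rightarrow> real) \<Rightarrow> real^'n \<Rightarrow> real" where
  "rotation_deriv i j f x = x $ i * partial_deriv j f x - x $ j * partial_deriv i f x"

text \<open>The Casimir operator of the rotation group, which is the Laplace--Beltrami operator on the unit
  sphere. The sum runs over all ordered pairs, hence the factor one half.\<close>

definition spherical_laplacian :: "(real^'n::finite \<Rightarrow> real) \<Rightarrow> real^'n \<Rightarrow> real" where
  "spherical_laplacian f x = (\<Sum>i\<in>UNIV. \<Sum>j\<in>UNIV. rotation_deriv i j (rotation_deriv i j f) x) / 2"

lemma polynomial_rotation_deriv [intro]:
  "real_polynomial_function f \<Longrightarrow> real_polynomial_function (rotation_deriv i j f)"
  unfolding rotation_deriv_def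
  by (intro real_polynomial_function_diff polynomial_mult polynomial_component polynomial_partial_deriv)

lemma polynomial_spherical_laplacian [intro]:
  "real_polynomial_function f \<Longrightarrow> real_polynomial_function (spherical_laplacian f)"
  unfolding spherical_laplacian_def
  by (intro real_polynomial_function_divide real_polynomial_function_sum polynomial_rotation_deriv) auto

lemma rotation_deriv_add:
  "real_polynomial_function f \<Longrightarrow> real_polynomial_function g \<Longrightarrow>
    rotation_deriv i j (\<lambda>x. f x + g x) = (\<lambda>x. rotation_deriv i j f x + rotation_deriv i j g x)"
  by (simp add: rotation_deriv_def partial_deriv_add fun_eq_iff algebra_simps)

lemma rotation_deriv_mult:
  "real_polynomial_function f \<Longrightarrow> real_polynomial_function g \<Longrightarrow>
    rotation_deriv i j (\<lambda>x. f x * g x) = (\<lambda>x. f x * rotation_deriv i j g x + rotation_deriv i j f x * g x)"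
  by (simp add: rotation_deriv_def partial_deriv_mult fun_eq_iff algebra_simps)

lemma rotation_deriv_const [simp]: "rotation_deriv i j (\<lambda>x. c) = (\<lambda>x. 0)"
  by (simp add: rotation_deriv_def fun_eq_iff)

lemma rotation_deriv_cmult:
  "real_polynomial_function f \<Longrightarrow> rotation_deriv i j (\<lambda>x. c * f x) = (\<lambda>x. c * rotation_deriv i j f x)"
  by (subst rotation_deriv_mult) auto

lemma spherical_laplacian_add:
  "real_polynomial_function f \<Longrightarrow> real_polynomial_function g \<Longrightarrow>
    spherical_laplacian (\<lambda>x. f x + g x) = (\<lambda>x. spherical_laplacian f x + spherical_laplacian g x)"
  by (simp add: spherical_laplacian_def rotation_deriv_add polynomial_rotation_deriv sum.distrib fun_eq_iff field_simps)

lemma spherical_laplacian_cmult: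
  "real_polynomial_function f \<Longrightarrow> spherical_laplacian (\<lambda>x. c * f x) = (\<lambda>x. c * spherical_laplacian f x)"
  by (simp add: spherical_laplacian_def rotation_deriv_cmult polynomial_rotation_deriv sum_distrib_left fun_eq_iff field_simps)

lemma spherical_laplacian_zero [simp]: "spherical_laplacian (\<lambda>x. c) = (\<lambda>x. 0)"
  by (simp add: spherical_laplacian_def fun_eq_iff)

lemma spherical_laplacian_sum:
  assumes "finite I" "\<And>i. i \<in> I \<Longrightarrow> real_polynomial_function (f i)"
  shows "spherical_laplacian (\<lambda>x. \<Sum>i\<in>I. f i x) = (\<lambda>x. \<Sum>i\<in>I. spherical_laplacian (f i) x)"
  using assms
proof (induction I rule: finite_induct)
  case (insert k I)
  then show ?case
    by (simp add: spherical_laplacian_add[of "f k" "\<lambda>x. \<Sum>i\<in>I. f i x"] real_polynomial_function_sum)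
qed simp

lemma norm_sq_components: "(norm (x::real^'n))\<^sup>2 = (\<Sum>i\<in>UNIV. x $ i * x $ i)"
  by (simp add: power2_norm_eq_inner inner_vec_def)

lemma polynomial_norm_sq [intro]: "real_polynomial_function (\<lambda>x::real^'n. (norm x)\<^sup>2)"
  unfolding norm_sq_components by (intro real_polynomial_function_sum polynomial_mult polynomial_component) auto

text \<open>Expressing the rotation generators by partial derivatives separates the Laplacian into its radial
  and angular parts; the radial part contains only Euler's operator, which is explicit on homogeneous
  polynomials.\<close>

lemma spherical_laplacian_partial:
  fixes f :: "real^'n::finite \<Rightarrow> real"
  assumes f: "real_polynomial_function f"
  shows "spherical_laplacian f x = (norm x)\<^sup>2 * laplacian f x
    - (\<Sum>i\<in>UNIV. \<Sum>j\<in>UNIV. x $ i * x $ j * partial_deriv i (partial_deriv j f) x)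
    - (real CARD('n) - 1) * (\<Sum>i\<in>UNIV. x $ i * partial_deriv i f x)"
proof -
  have pd: "partial_deriv k (rotation_deriv i j f) x =
     x $ i * partial_deriv k (partial_deriv j f) x + (if k = i then partial_deriv j f x else 0)
     - (x $ j * partial_deriv k (partial_deriv i f) x + (if k = j then partial_deriv i f x else 0))" for i j k
    unfolding rotation_deriv_def
    using f by (subst partial_deriv_diff) (auto simp: partial_deriv_mult partial_deriv_component polynomial_partial_deriv polynomial_component polynomial_mult)
  have D: "rotation_deriv i j (rotation_deriv i j f) x =
      x $ i * x $ i * partial_deriv j (partial_deriv j f) x
    + x $ j * x $ j * partial_deriv i (partial_deriv i f) x
    - 2 * (x $ i * x $ j * partial_deriv i (partial_deriv j f) x)
    - x $ i * partial_deriv i f x - x $ j * partial_deriv j f x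
    + (if i = j then 2 * (x $ i * partial_deriv i f x) else 0)" for i j
    unfolding rotation_deriv_def[of i j "rotation_deriv i j f"] pd
    using partial_deriv_commute[OF f, of i j]
    by (auto simp: algebra_simps)
  let ?E = "\<Sum>i\<in>UNIV. x $ i * partial_deriv i f x"
  let ?L = "\<Sum>i\<in>UNIV. partial_deriv i (partial_deriv i f) x"
  have s1: "(\<Sum>i\<in>UNIV. \<Sum>j\<in>UNIV. x $ i * x $ i * partial_deriv j (partial_deriv j f) x) = (norm x)\<^sup>2 * ?L"
    unfolding norm_sq_components by (simp add: sum_product)
  have s2: "(\<Sum>i\<in>UNIV. \<Sum>j\<in>UNIV. x $ j * x $ j * partial_deriv i (partial_deriv i f) x) = (norm x)\<^sup>2 * ?L"
    by (subst sum.swap) (rule s1)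
  have s3: "(\<Sum>i\<in>UNIV. \<Sum>j\<in>(UNIV::'n set). x $ i * partial_deriv i f x) = real CARD('n) * ?E"
    by (simp add: sum_distrib_left)
  have s4: "(\<Sum>i\<in>(UNIV::'n set). \<Sum>j\<in>UNIV. x $ j * partial_deriv j f x) = real CARD('n) * ?E" by simp
  have s5: "(\<Sum>i\<in>UNIV. \<Sum>j\<in>UNIV. if i = j then 2 * (x $ i * partial_deriv i f x) else 0) = 2 * ?E"
    by (simp add: sum_distrib_left)
  have s6: "(\<Sum>i\<in>UNIV. \<Sum>j\<in>UNIV. 2 * (x $ i * x $ j * partial_deriv i (partial_deriv j f) x)) =
      2 * (\<Sum>i\<in>UNIV. \<Sum>j\<in>UNIV. x $ i * x $ j * partial_deriv i (partial_deriv j f) x)"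
    by (simp only: sum_distrib_left)
  show ?thesis
    unfolding spherical_laplacian_def laplacian_partial[OF f] D sum.distrib sum_subtractf s1 s2 s3 s4 s5 s6
    by (simp only: algebra_simps) (simp add: field_simps)
qed

definition homogeneous :: "nat \<Rightarrow> (real^'n::finite \<Rightarrow> real) \<Rightarrow> bool" where
  "homogeneous k f \<longleftrightarrow> real_polynomial_function f \<and> (\<forall>c x. f (c *\<^sub>R x) = c ^ k * f x)"

lemma homogeneous_poly: "homogeneous k f \<Longrightarrow> real_polynomial_function f" by (simp add: homogeneous_def)

lemma Euler_identity:
  assumes "homogeneous k (f :: real^'n \<Rightarrow> real)"
  shows "(\<Sum>i\<in>UNIV. x $ i * partial_deriv i f x) = real k * f x"
proof -
  have f: "real_polynomial_function f" and h: "\<And>c x. f (c *\<^sub>R x) = c ^ k * f x"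
    using assms by (auto simp: homogeneous_def)
  have "((\<lambda>c. c *\<^sub>R x) has_vector_derivative x) (at 1)"
    by (auto intro!: derivative_eq_intros)
  from polynomial_along_curve[OF f this]
  have 1: "((\<lambda>c. c ^ k * f x) has_real_derivative (\<Sum>i\<in>UNIV. x $ i * partial_deriv i f x)) (at 1)" by (simp add: h)
  have 2: "((\<lambda>c. c ^ k * f x) has_real_derivative real k * f x) (at 1)"
    by (auto intro!: derivative_eq_intros)
  show ?thesis using DERIV_unique[OF 1 2] .
qed

text \<open>Apply Euler's identity twice.\<close>

lemma Euler_second:
  assumes "homogeneous k (f :: real^'n \<Rightarrow> real)"
  shows "(\<Sum>i\<in>UNIV. \<Sum>j\<in>UNIV. x $ i * x $ j * partial_deriv i (partial_deriv j f) x) = real k * (real k - 1) * f x"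
proof -
  have f: "real_polynomial_function f" using assms by (auto simp: homogeneous_def)
  have pd: "partial_deriv i (\<lambda>x. \<Sum>j\<in>UNIV. x $ j * partial_deriv j f x) x
      = partial_deriv i f x + (\<Sum>j\<in>UNIV. x $ j * partial_deriv i (partial_deriv j f) x)" for i
  proof -
    have "partial_deriv i (\<lambda>x. \<Sum>j\<in>UNIV. x $ j * partial_deriv j f x)
      = (\<lambda>x. \<Sum>j\<in>UNIV. partial_deriv i (\<lambda>x. x $ j * partial_deriv j f x) x)"
      using f by (intro partial_deriv_sum) auto
    then show ?thesis
      using f by (simp add: partial_deriv_mult polynomial_component polynomial_partial_deriv partial_deriv_component sum.distrib
        if_distrib[where f="\<lambda>u. u * _"] cong: if_cong)
  qed
  have "real k * partial_deriv i f x = partial_deriv i f x + (\<Sum>j\<in>UNIV. x $ j * partial_deriv i (partial_deriv j f) x)" for i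
    using pd[of i] partial_deriv_cmult[OF f, of i "real k"] by (simp add: Euler_identity[OF assms])
  then have "(\<Sum>i\<in>UNIV. x $ i * (real k * partial_deriv i f x)) =
    (\<Sum>i\<in>UNIV. x $ i * partial_deriv i f x) + (\<Sum>i\<in>UNIV. x $ i * (\<Sum>j\<in>UNIV. x $ j * partial_deriv i (partial_deriv j f) x))"
    by (simp add: distrib_left sum.distrib)
  moreover have "(\<Sum>i\<in>UNIV. x $ i * (real k * partial_deriv i f x)) = real k * (\<Sum>i\<in>UNIV. x $ i * partial_deriv i f x)"
    by (simp add: sum_distrib_left mult_ac)
  ultimately show ?thesis
    by (simp add: Euler_identity[OF assms] sum_distrib_left mult.assoc algebra_simps)
qed

lemma spherical_laplacian_homogeneous:
  fixes f :: "real^'n::finite \<Rightarrow> real"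
  assumes "homogeneous k f"
  shows "spherical_laplacian f x = (norm x)\<^sup>2 * laplacian f x - lb_eigenvalue (CARD('n) - 1) k * f x"
proof -
  have 1: "real (CARD('n) - 1) = real CARD('n) - 1"
    using zero_less_card_finite[where 'a='n] by linarith
  show ?thesis
    unfolding spherical_laplacian_partial[OF homogeneous_poly[OF assms]] Euler_identity[OF assms] Euler_second[OF assms]
      lb_eigenvalue_def 1
    by (simp add: algebra_simps)
qed

lemma rotation_deriv_norm_sq [simp]: "rotation_deriv i j (\<lambda>x::real^'n. (norm x)\<^sup>2) = (\<lambda>x. 0)"
proof -
  have "partial_deriv k (\<lambda>x::real^'n. (norm x)\<^sup>2) = (\<lambda>x. 2 * x $ k)" for k
    unfolding norm_sq_components
    by (subst partial_deriv_sum) (auto simp: partial_deriv_mult polynomial_component partial_deriv_component fun_eq_iff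
        sum.distrib if_distrib[where f="\<lambda>u. _ * u"] if_distrib[where f="\<lambda>u. u * _"] cong: if_cong)
  then show ?thesis by (simp add: rotation_deriv_def fun_eq_iff)
qed

lemma spherical_laplacian_norm_sq_mult:
  assumes "real_polynomial_function (f :: real^'n \<Rightarrow> real)"
  shows "spherical_laplacian (\<lambda>x. (norm x)\<^sup>2 * f x) = (\<lambda>x. (norm x)\<^sup>2 * spherical_laplacian f x)"
  using assms by (simp add: spherical_laplacian_def rotation_deriv_mult polynomial_norm_sq polynomial_rotation_deriv sum_distrib_left fun_eq_iff)

section \<open>Rotations and integration by parts on the sphere\<close>

definition plane_rotation :: "'n \<Rightarrow> 'n \<Rightarrow> real \<Rightarrow> real^'n::finite \<Rightarrow> real^'n" where
  "plane_rotation i j t x = (\<chi> k. if k = i then cos t * x $ i - sin t * x $ j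
      else if k = j then sin t * x $ i + cos t * x $ j else x $ k)"

lemma norm_plane_rotation:
  assumes "i \<noteq> j" shows "norm (plane_rotation i j t x) = norm (x :: real^'n)"
proof -
  let ?y = "plane_rotation i j t x"
  have split: "(\<Sum>k\<in>UNIV. z $ k * z $ k) = z $ i * z $ i + z $ j * z $ j + (\<Sum>k\<in>UNIV-{i,j}. z $ k * z $ k)" for z :: "real^'n"
    using assms by (subst sum.subset_diff[of "{i,j}" UNIV]) auto
  have pyth: "cos t * cos t + sin t * sin t = 1" by (rule sin_cos_squared_add3)
  have "(cos t * a - sin t * b) * (cos t * a - sin t * b) + (sin t * a + cos t * b) * (sin t * a + cos t * b)
      = a * a + b * b" for a b
    using pyth by algebra
  then have "?y $ i * ?y $ i + ?y $ j * ?y $ j = x $ i * x $ i + x $ j * x $ j"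
    using assms unfolding plane_rotation_def by simp
  moreover have "(\<Sum>k\<in>UNIV-{i,j}. ?y $ k * ?y $ k) = (\<Sum>k\<in>UNIV-{i,j}. x $ k * x $ k)"
    by (intro sum.cong) (auto simp: plane_rotation_def)
  ultimately have "(norm ?y)\<^sup>2 = (norm x)\<^sup>2" unfolding norm_sq_components split by simp
  then show ?thesis by simp
qed

lemma orthogonal_plane_rotation: "i \<noteq> j \<Longrightarrow> orthogonal_transformation (plane_rotation i j t)"
  unfolding orthogonal_transformation
  by (auto simp: norm_plane_rotation intro!: linearI) (auto simp: plane_rotation_def vec_eq_iff algebra_simps)

lemma plane_rotation_zero [simp]: "plane_rotation i j 0 x = x"
  by (auto simp: plane_rotation_def vec_eq_iff)

text \<open>The rotations form the flow of the vector field behind \<open>rotation_deriv\<close>; this links it with the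
  rotation invariance of the measure and with extrema on the sphere.\<close>

lemma polynomial_along_rotation:
  assumes f: "real_polynomial_function (f :: real^'n \<Rightarrow> real)" and "i \<noteq> j"
  shows "((\<lambda>t. f (plane_rotation i j t x)) has_real_derivative rotation_deriv i j f (plane_rotation i j t x)) (at t)"
proof -
  let ?y = "plane_rotation i j t x"
  have "((\<lambda>t. plane_rotation i j t x) has_vector_derivative
      (\<chi> k. if k = i then - ?y $ j else if k = j then ?y $ i else 0)) (at t)"
    unfolding has_vector_derivative_def
  proof (subst has_derivative_componentwise_within, intro ballI)
    fix b :: "real^'n" assume "b \<in> Basis"
    then obtain k where b: "b = axis k 1" by (auto simp: Basis_vec_def)
    have "((\<lambda>t. plane_rotation i j t x $ k) has_real_derivative
        (if k = i then - ?y $ j else if k = j then ?y $ i else 0)) (at t)"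
      using \<open>i \<noteq> j\<close> unfolding plane_rotation_def
      by (auto intro!: derivative_eq_intros)
    moreover have "(\<lambda>h. (h *\<^sub>R (\<chi> k. if k = i then - ?y $ j else if k = j then ?y $ i else 0)) \<bullet> b)
        = (*) (if k = i then - ?y $ j else if k = j then ?y $ i else 0)"
      unfolding b by (simp add: inner_axis fun_eq_iff)
    moreover have "(\<lambda>s. plane_rotation i j s x \<bullet> b) = (\<lambda>s. plane_rotation i j s x $ k)"
      unfolding b by (simp add: inner_axis)
    ultimately show "((\<lambda>s. plane_rotation i j s x \<bullet> b) has_derivative
       (\<lambda>h. (h *\<^sub>R (\<chi> k. if k = i then - ?y $ j else if k = j then ?y $ i else 0)) \<bullet> b)) (at t)"
      by (simp only: has_field_derivative_def)
  qed
  from polynomial_along_curve[OF f this]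
  have "((\<lambda>t. f (plane_rotation i j t x)) has_real_derivative
    (\<Sum>k\<in>UNIV. (if k = i then - ?y $ j else if k = j then ?y $ i else 0) * partial_deriv k f ?y)) (at t)" by simp
  also have "(\<Sum>k\<in>UNIV. (if k = i then - ?y $ j else if k = j then ?y $ i else 0) * partial_deriv k f ?y)
     = (\<Sum>k\<in>{i,j}. (if k = i then - ?y $ j else if k = j then ?y $ i else 0) * partial_deriv k f ?y)"
    by (intro sum.mono_neutral_right) auto
  also have "\<dots> = rotation_deriv i j f ?y" using \<open>i \<noteq> j\<close> by (auto simp: rotation_deriv_def)
  finally show ?thesis .
qed

lemma rotation_deriv_diag [simp]: "rotation_deriv i i f = (\<lambda>x. 0)"
  by (simp add: rotation_deriv_def fun_eq_iff)

lemma continuous_on_polynomial [intro]: "real_polynomial_function f \<Longrightarrow> continuous_on A f"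
  using continuous_on_polymonial_function real_polynomial_function_eq by blast

lemma integrable_polynomial_sphere [intro]:
  "real_polynomial_function (f :: real^'n \<Rightarrow> real) \<Longrightarrow> integrable sphere_measure f"
  by (intro integrable_continuous_sphere continuous_on_polynomial)

text \<open>The integral of \<open>f\<close> does not change when \<open>f\<close> is rotated by an angle \<open>t\<close>. By Taylor's formula, whose
  remainder is bounded uniformly on the compact sphere, \<open>t\<close> times the integral of the derivative is
  of order \<open>t^2\<close>, which forces it to vanish.\<close>

lemma integral_rotation_deriv:
  assumes f: "real_polynomial_function (f :: real^'n \<Rightarrow> real)"
  shows "(LINT x|sphere_measure. rotation_deriv i j f x) = 0"
proof (cases "i = j")
  case False
  interpret prob_space "sphere_measure :: (real^'n) measure" by (rule prob_space_sphere_measure)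
  let ?D = "rotation_deriv i j f" and ?R = "plane_rotation i j"
  have D: "real_polynomial_function ?D" using f by auto
  have DD: "real_polynomial_function (rotation_deriv i j ?D)" using D by auto
  obtain C where C: "C > 0" "\<And>x. x \<in> sphere 0 1 \<Longrightarrow> \<bar>rotation_deriv i j ?D x\<bar> \<le> C"
    using bounded_continuous_sphere[OF continuous_on_polynomial[OF DD]] by blast
  have S: "?R t x \<in> sphere 0 1" if "x \<in> sphere 0 1" for t x
    using that by (simp add: norm_plane_rotation[OF False])
  have taylor: "\<bar>f (?R t x) - f x - t * ?D x\<bar> \<le> C * t\<^sup>2" if x: "x \<in> sphere 0 1" and t: "0 < t" for t x
  proof -
    obtain z where z: "0 < z" "z < t" "f (?R t x) - f (?R 0 x) = (t - 0) * ?D (?R z x)"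
      using MVT2[OF t, of "\<lambda>t. f (?R t x)" "\<lambda>t. ?D (?R t x)"] polynomial_along_rotation[OF f False] by blast
    obtain w where w: "0 < w" "w < z" "?D (?R z x) - ?D (?R 0 x) = (z - 0) * rotation_deriv i j ?D (?R w x)"
      using MVT2[OF z(1), of "\<lambda>t. ?D (?R t x)" "\<lambda>t. rotation_deriv i j ?D (?R t x)"]
        polynomial_along_rotation[OF D False] by blast
    have "f (?R t x) - f x - t * ?D x = t * (?D (?R z x) - ?D x)" using z by (simp add: algebra_simps)
    also have "\<bar>\<dots>\<bar> = t * (z * \<bar>rotation_deriv i j ?D (?R w x)\<bar>)" using w z t by (simp add: abs_mult)
    also have "\<dots> \<le> t * (t * C)" using z t C(2)[OF S[OF x]] C(1) by (intro mult_left_mono mult_mono) auto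
    finally show ?thesis by (simp add: power2_eq_square algebra_simps)
  qed
  have fR: "continuous_on (sphere 0 1) (\<lambda>x. f (?R t x))" for t
    using orthogonal_plane_rotation[OF False, of t] continuous_on_polynomial[OF f, of UNIV]
    by (intro continuous_on_compose2[OF continuous_on_polynomial[OF f, of UNIV]] linear_continuous_on)
      (auto simp: orthogonal_transformation linear_conv_bounded_linear)
  have small: "\<bar>LINT x|sphere_measure. ?D x\<bar> \<le> C * t" if t: "0 < t" for t
  proof -
    have int: "integrable sphere_measure (\<lambda>x. f (?R t x))" "integrable sphere_measure f" "integrable sphere_measure ?D"
      using integrable_continuous_sphere[OF fR] f D by auto
    have "(LINT x|sphere_measure. f (?R t x)) = (LINT x|sphere_measure. f x)"
      by (rule integral_sphere_orthogonal[OF orthogonal_plane_rotation[OF False] continuous_on_polynomial[OF f]])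
    then have "\<bar>t * (LINT x|sphere_measure. ?D x)\<bar> = \<bar>LINT x|sphere_measure. f (?R t x) - f x - t * ?D x\<bar>"
      using int by simp
    also have "\<dots> \<le> (LINT x|sphere_measure. \<bar>f (?R t x) - f x - t * ?D x\<bar>)"
      by (rule integral_abs_bound)
    also have "\<dots> \<le> (LINT x|(sphere_measure :: (real^'n) measure). C * t\<^sup>2)"
      using int taylor t by (intro Bochner_Integration.integral_mono) auto
    also have "\<dots> = C * t\<^sup>2" using prob_space by simp
    finally have "t * \<bar>LINT x|sphere_measure. ?D x\<bar> \<le> t * (C * t)" using t by (simp add: abs_mult power2_eq_square algebra_simps)
    then show ?thesis using t by simp
  qed
  show ?thesis
  proof (rule ccontr)
    assume "(LINT x|sphere_measure. ?D x) \<noteq> 0"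
    then have p: "\<bar>LINT x|sphere_measure. ?D x\<bar> > 0" by simp
    then show False using small[of "\<bar>LINT x|sphere_measure. ?D x\<bar> / (2 * C)"] C(1) by (auto simp: field_simps)
  qed
qed simp

lemma integral_rotation_deriv_by_parts:
  assumes f: "real_polynomial_function (f :: real^'n \<Rightarrow> real)" and g: "real_polynomial_function g"
  shows "(LINT x|sphere_measure. f x * rotation_deriv i j g x) = - (LINT x|sphere_measure. rotation_deriv i j f x * g x)"
proof -
  have "(LINT x|sphere_measure. f x * rotation_deriv i j g x + rotation_deriv i j f x * g x) = 0"
    using integral_rotation_deriv[OF polynomial_mult[OF f g], of i j] by (simp add: rotation_deriv_mult f g)
  moreover have "integrable sphere_measure (\<lambda>x. f x * rotation_deriv i j g x)" "integrable sphere_measure (\<lambda>x. rotation_deriv i j f x * g x)"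
    using f g by (auto intro!: integrable_polynomial_sphere)
  ultimately show ?thesis by simp
qed

lemma spherical_laplacian_selfadjoint:
  assumes f: "real_polynomial_function (f :: real^'n \<Rightarrow> real)" and g: "real_polynomial_function g"
  shows "(LINT x|sphere_measure. f x * spherical_laplacian g x) = (LINT x|sphere_measure. spherical_laplacian f x * g x)"
proof -
  let ?D = rotation_deriv
  have expand: "(LINT x|sphere_measure. f x * spherical_laplacian g x)
      = (\<Sum>i\<in>UNIV. \<Sum>j\<in>UNIV. (LINT x|sphere_measure. f x * ?D i j (?D i j g) x)) / 2"
    if "real_polynomial_function f" "real_polynomial_function g" for f g :: "real^'n \<Rightarrow> real"
  proof -
    have i: "integrable sphere_measure (\<lambda>x. f x * ?D i j (?D i j g) x)" for i j using that by (auto intro!: integrable_polynomial_sphere)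
    have "(LINT x|sphere_measure. f x * spherical_laplacian g x)
      = (LINT x|sphere_measure. (\<Sum>i\<in>UNIV. \<Sum>j\<in>UNIV. f x * ?D i j (?D i j g) x) / 2)"
      by (simp add: spherical_laplacian_def sum_distrib_left)
    then show ?thesis using i by (simp add: Bochner_Integration.integral_sum)
  qed
  have "(LINT x|sphere_measure. f x * ?D i j (?D i j g) x) = (LINT x|sphere_measure. g x * ?D i j (?D i j f) x)" for i j
    using integral_rotation_deriv_by_parts[OF f polynomial_rotation_deriv[OF g], of i j i j]
      integral_rotation_deriv_by_parts[OF polynomial_rotation_deriv[OF f, of i j] g, of i j]
    by (simp add: mult.commute)
  then show ?thesis using expand[OF f g] expand[OF g f] by (simp add: mult.commute)
qed

lemma integral_spherical_laplacian:
  assumes f: "real_polynomial_function (f :: real^'n \<Rightarrow> real)"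
  shows "(LINT x|sphere_measure. spherical_laplacian f x) = 0"
  using spherical_laplacian_selfadjoint[OF f polynomial_const[of 1]] by simp

section \<open>Spaces of homogeneous polynomials\<close>

text \<open>Real functions as a vector space, in order to have spans and dimension bounds for sets of
  polynomials.\<close>

interpretation fn: vector_space "\<lambda>(c::real) (f::'a \<Rightarrow> real) x. c * f x"
  by unfold_locales (auto simp: fun_eq_iff algebra_simps)

fun monomials :: "nat \<Rightarrow> (real^'n::finite \<Rightarrow> real) set" where
  "monomials 0 = {\<lambda>x. 1}"
| "monomials (Suc k) = (\<lambda>(i, m) x. x $ i * m x) ` (UNIV \<times> monomials k)"

lemma finite_monomials: "finite (monomials k)"
  by (induction k) auto

lemma monomials_mult: "m \<in> monomials k \<Longrightarrow> m' \<in> monomials l \<Longrightarrow> (\<lambda>x. m x * m' x) \<in> monomials (k + l)"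
proof (induction k arbitrary: m)
  case (Suc k)
  then obtain i m1 where "m = (\<lambda>x. x $ i * m1 x)" "m1 \<in> monomials k" by auto
  then show ?case using Suc.IH[of m1] Suc.prems(2)
    by (auto simp: mult.assoc intro!: rev_image_eqI[of "(i, \<lambda>x. m1 x * m' x)"])
qed (auto simp: eta_contract_eq)

lemma homogeneous_monomials: "m \<in> monomials k \<Longrightarrow> homogeneous k m"
  by (induction k arbitrary: m) (auto simp: homogeneous_def polynomial_component polynomial_mult)

lemma homogeneous_add: "homogeneous k f \<Longrightarrow> homogeneous k g \<Longrightarrow> homogeneous k (\<lambda>x. f x + g x)"
  by (auto simp: homogeneous_def algebra_simps)

lemma homogeneous_cmult: "homogeneous k f \<Longrightarrow> homogeneous k (\<lambda>x. c * f x)"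
  by (auto simp: homogeneous_def algebra_simps)

lemma homogeneous_zero: "homogeneous k (\<lambda>x. 0)"
  by (auto simp: homogeneous_def)

lemma homogeneous_span:
  assumes "f \<in> fn.span (monomials k)" shows "homogeneous k f"
  using assms
proof (induction rule: fn.span_induct_alt)
  case base
  then show ?case by (simp add: homogeneous_zero zero_fun_def)
next
  case (step c m y)
  then show ?case using homogeneous_add[OF homogeneous_cmult[OF homogeneous_monomials]]
    by (simp add: plus_fun_def)
qed

lemma sum_fun_apply: "(\<Sum>i\<in>A. f i) x = (\<Sum>i\<in>A. f i x :: real)"
  by (induction A rule: infinite_finite_induct) auto

lemma polynomial_in_span_monomials:
  assumes "real_polynomial_function (f :: real^'n \<Rightarrow> real)"
  shows "f \<in> fn.span (\<Union>k. monomials k)"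
  using assms
proof (induction f rule: real_polynomial_function.induct)
  case (linear f)
  have eq: "f = (\<Sum>i\<in>UNIV. (\<lambda>x. f (axis i 1) * x $ i))"
  proof
    fix x :: "real^'n"
    have "x = (\<Sum>i\<in>UNIV. x $ i *\<^sub>R axis i 1)"
      by (simp add: vec_eq_iff axis_def if_distrib cong: if_cong)
    then have "f x = f (\<Sum>i\<in>UNIV. x $ i *\<^sub>R axis i 1)" by simp
    also have "\<dots> = (\<Sum>i\<in>UNIV. f (axis i 1) * x $ i)"
      using bounded_linear.linear[OF linear] by (simp add: linear_sum linear_cmul mult.commute)
    finally show "f x = (\<Sum>i\<in>UNIV. (\<lambda>x. f (axis i 1) * x $ i)) x"
      by (simp add: sum_fun_apply)
  qed
  have "(\<lambda>x. x $ i) \<in> fn.span (\<Union>k. monomials k)" for i :: 'n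
    by (rule fn.span_base) (auto intro!: exI[of _ "Suc 0"] image_eqI[of _ _ "(i, \<lambda>x. 1)"])
  then show ?case by (subst eq) (intro fn.span_sum fn.span_scale)
next
  case (const c)
  have "(\<lambda>x. 1) \<in> fn.span (\<Union>k. monomials k :: (real^'n \<Rightarrow> real) set)"
    by (rule fn.span_base) (auto intro!: exI[of _ 0])
  from fn.span_scale[OF this, of c] show ?case by simp
next
  case (add f g)
  then show ?case using fn.span_add[of f _ g] by (simp add: plus_fun_def)
next
  case (mult f g)
  have base: "(\<lambda>x. m x * g x) \<in> fn.span (\<Union>k. monomials k)" if m: "m \<in> monomials j" for j m
    using mult(4)
  proof (induction g rule: fn.span_induct_alt)
    case base
    then show ?case by (simp add: fn.span_zero[unfolded zero_fun_def] zero_fun_def)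
  next
    case (step c m' y)
    then obtain k where "m' \<in> monomials k" by auto
    then have "(\<lambda>x. m x * m' x) \<in> fn.span (\<Union>k. monomials k)"
      using monomials_mult[OF m] by (intro fn.span_base) auto
    from fn.span_add[OF fn.span_scale[OF this, of c] step(2)] show ?case
      by (simp add: plus_fun_def algebra_simps)
  qed
  show ?case using mult(3)
  proof (induction f rule: fn.span_induct_alt)
    case base
    then show ?case by (simp add: fn.span_zero[unfolded zero_fun_def] zero_fun_def)
  next
    case (step c m y)
    then obtain k where "m \<in> monomials k" by auto
    from fn.span_add[OF fn.span_scale[OF base[OF this], of c] step(2)] show ?case
      by (simp add: plus_fun_def algebra_simps)
  qed
qed

lemma polynomial_homogeneous_parts:
  assumes "real_polynomial_function (f :: real^'n \<Rightarrow> real)"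
  shows "\<exists>n h. (\<forall>k. h k \<in> fn.span (monomials k)) \<and> (\<forall>k>n. h k = (\<lambda>x. 0)) \<and> f = (\<lambda>x. \<Sum>k\<le>n. h k x)"
  using polynomial_in_span_monomials[OF assms]
proof (induction rule: fn.span_induct_alt)
  case base
  show ?case by (intro exI[of _ 0] exI[of _ "\<lambda>k x. 0"]) (simp add: fn.span_zero[unfolded zero_fun_def] zero_fun_def)
next
  case (step c m y)
  then obtain k where k: "m \<in> monomials k" by auto
  from step obtain n h where h: "\<And>k. h k \<in> fn.span (monomials k)" "\<And>k. k > n \<Longrightarrow> h k = (\<lambda>x. 0)" "y = (\<lambda>x. \<Sum>k\<le>n. h k x)"
    by blast
  define h' where "h' = (\<lambda>j x. (if j = k then c * m x else 0) + h j x)"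
  define N where "N = max n k"
  have "h' j \<in> fn.span (monomials j)" for j
  proof (cases "j = k")
    case True
    then have "h' j = (\<lambda>x. c * m x) + h j" by (simp add: h'_def plus_fun_def)
    then show ?thesis using fn.span_add[OF fn.span_scale[OF fn.span_base[OF k], of c] h(1)[of k]] True by simp
  qed (simp add: h'_def h)
  moreover have "\<forall>j>N. h' j = (\<lambda>x. 0)" by (auto simp: h'_def N_def h)
  moreover have "(\<lambda>x. c * m x) + y = (\<lambda>x. \<Sum>j\<le>N. h' j x)"
  proof
    fix x
    have "(\<Sum>j\<le>n. h j x) = (\<Sum>j\<le>N. h j x)" by (intro sum.mono_neutral_left) (auto simp: N_def h)
    moreover have "(\<Sum>j\<le>N. if j = k then c * m x else 0) = c * m x" by (simp add: N_def)
    ultimately show "((\<lambda>x. c * m x) + y) x = (\<Sum>j\<le>N. h' j x)" by (simp add: h h'_def sum.distrib)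
  qed
  ultimately show ?case by blast
qed

text \<open>A polynomial is a sum of parts in the spans of the monomials of the various degrees. Along each ray
  both sides are polynomials in the scaling factor, and comparing coefficients leaves only the part
  of degree \<open>k\<close>. Hence homogeneous polynomials of a given degree form a finite-dimensional space.\<close>

lemma homogeneous_in_span_monomials:
  assumes "homogeneous k (f :: real^'n \<Rightarrow> real)"
  shows "f \<in> fn.span (monomials k)"
proof -
  obtain n h where h: "\<And>k. h k \<in> fn.span (monomials k)" "\<And>k. k > n \<Longrightarrow> h k = (\<lambda>x. 0)" "f = (\<lambda>x. \<Sum>k\<le>n. h k x)"
    using polynomial_homogeneous_parts[OF homogeneous_poly[OF assms]] by blast
  define N where "N = max n k"
  have fN: "f x = (\<Sum>j\<le>N. h j x)" for x
    unfolding h(3) by (intro sum.mono_neutral_left) (auto simp: N_def h)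
  have "f = h k"
  proof
    fix x
    have "(\<Sum>j\<le>N. h j x * c ^ j) = (\<Sum>j\<le>N. (if j = k then f x else 0) * c ^ j)" for c
    proof -
      have "(\<Sum>j\<le>N. h j x * c ^ j) = (\<Sum>j\<le>N. h j (c *\<^sub>R x))"
        using homogeneous_span[OF h(1)] by (intro sum.cong) (auto simp: homogeneous_def)
      also have "\<dots> = c ^ k * f x" using assms by (simp add: fN[symmetric] homogeneous_def)
      also have "\<dots> = (\<Sum>j\<le>N. (if j = k then f x else 0) * c ^ j)"
        by (simp add: if_distrib[where f="\<lambda>u. u * _"] N_def cong: if_cong)
      finally show ?thesis .
    qed
    then have "\<forall>j\<le>N. h j x = (if j = k then f x else 0)"
      using polyfun_eq_coeffs[of "\<lambda>j. h j x" N "\<lambda>j. if j = k then f x else 0"] by blast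
    then show "f x = h k x" by (simp add: N_def)
  qed
  then show ?thesis using h(1) by simp
qed

text \<open>For a scaling factor \<open>c \<noteq> 0\<close> this is the chain rule; the case \<open>c = 0\<close> follows by
  continuity.\<close>

lemma homogeneous_partial_deriv:
  assumes "homogeneous (Suc k) (f :: real^'n \<Rightarrow> real)"
  shows "homogeneous k (partial_deriv i f)"
proof -
  let ?g = "partial_deriv i f"
  have f: "real_polynomial_function f" and h: "\<And>c x. f (c *\<^sub>R x) = c ^ Suc k * f x"
    using assms by (auto simp: homogeneous_def)
  have nz: "?g (c *\<^sub>R x) = c ^ k * ?g x" if "c \<noteq> 0" for c x
  proof -
    have "((\<lambda>x. f (c *\<^sub>R x)) has_derivative (\<lambda>v. frechet_derivative f (at (c *\<^sub>R x)) (c *\<^sub>R v))) (at x)"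
      by (rule has_derivative_compose[OF _ has_derivative_polynomial[OF f]]) (auto intro!: derivative_eq_intros)
    from partial_deriv_eqI[OF this, of i] have "partial_deriv i (\<lambda>x. f (c *\<^sub>R x)) x = frechet_derivative f (at (c *\<^sub>R x)) (c *\<^sub>R axis i 1)" .
    also have "\<dots> = c * ?g (c *\<^sub>R x)"
      using has_derivative_linear[OF has_derivative_polynomial[OF f]] by (simp add: partial_deriv_def linear_cmul)
    finally have "c * ?g (c *\<^sub>R x) = c ^ Suc k * ?g x" unfolding h using f by (auto simp: partial_deriv_cmult)
    then show ?thesis using that by simp
  qed
  have "?g (c *\<^sub>R x) = c ^ k * ?g x" for c x
  proof (cases "c = 0")
    case True
    have cont: "continuous_on UNIV (\<lambda>c. ?g (c *\<^sub>R x))" "continuous_on UNIV (\<lambda>c. c ^ k * ?g x)"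
      using f by (auto intro!: continuous_intros continuous_on_compose2[OF continuous_on_polynomial[of ?g UNIV]])
    have 1: "((\<lambda>c. ?g (c *\<^sub>R x)) \<longlongrightarrow> ?g (0 *\<^sub>R x)) (at 0)"
      using isContD[of 0 "\<lambda>c. ?g (c *\<^sub>R x)"] cont(1) by (simp only: continuous_on_eq_continuous_at[OF open_UNIV]) simp
    have 2: "((\<lambda>c. c ^ k * ?g x) \<longlongrightarrow> 0 ^ k * ?g x) (at 0)"
      using isContD[of 0 "\<lambda>c. c ^ k * ?g x"] cont(2) by (simp only: continuous_on_eq_continuous_at[OF open_UNIV]) simp
    have "eventually (\<lambda>c. ?g (c *\<^sub>R x) = c ^ k * ?g x) (at 0)"
      using nz by (auto simp: eventually_at_filter)
    then have 3: "((\<lambda>c. c ^ k * ?g x) \<longlongrightarrow> ?g (0 *\<^sub>R x)) (at (0::real))"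
      using 1 tendsto_cong by fastforce
    then show ?thesis using tendsto_unique[OF _ 3 2] True by simp
  qed (rule nz)
  then show ?thesis using f by (auto simp: homogeneous_def)
qed

lemma homogeneous_sum: "(\<And>i. i \<in> I \<Longrightarrow> homogeneous k (f i)) \<Longrightarrow> finite I \<Longrightarrow> homogeneous k (\<lambda>x. \<Sum>i\<in>I. f i x)"
proof -
  assume "finite I" "\<And>i. i \<in> I \<Longrightarrow> homogeneous k (f i)"
  then show ?thesis
    by (induction I rule: finite_induct) (auto simp: homogeneous_zero homogeneous_add)
qed

lemma laplacian_eq: "real_polynomial_function f \<Longrightarrow> laplacian f = (\<lambda>x. \<Sum>i\<in>UNIV. partial_deriv i (partial_deriv i f) x)"
  by (rule ext) (rule laplacian_partial)

lemma homogeneous_laplacian: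
  assumes "homogeneous (Suc (Suc k)) (f :: real^'n \<Rightarrow> real)"
  shows "homogeneous k (laplacian f)"
  unfolding laplacian_eq[OF homogeneous_poly[OF assms]]
  by (intro homogeneous_sum homogeneous_partial_deriv assms) auto

lemma laplacian_low_degree:
  assumes "homogeneous k (f :: real^'n \<Rightarrow> real)" "k < 2" shows "laplacian f = (\<lambda>x. 0)"
proof -
  have c: "g = (\<lambda>x. g 0)" if "homogeneous 0 g" for g :: "real^'n \<Rightarrow> real"
  proof
    fix x
    have "g (0 *\<^sub>R x) = 0 ^ 0 * g x" using that unfolding homogeneous_def by blast
    then show "g x = g 0" by simp
  qed
  have pd0: "partial_deriv i g = (\<lambda>x. 0)" if "homogeneous 0 g" for g :: "real^'n \<Rightarrow> real" and i
    using c[OF that] partial_deriv_const by metis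
  have "partial_deriv i (partial_deriv i f) = (\<lambda>x. 0)" for i
  proof (cases k)
    case 0
    then show ?thesis using assms pd0[of f] by simp
  next
    case (Suc k')
    then show ?thesis using assms pd0[of "partial_deriv i f"] homogeneous_partial_deriv[of k' f i] by simp
  qed
  then show ?thesis by (simp add: laplacian_eq[OF homogeneous_poly[OF assms(1)]])
qed

section \<open>Solid harmonics and the decomposition of polynomials\<close>

lemma solid_harmonics_iff:
  "h \<in> solid_harmonics l \<longleftrightarrow> homogeneous l h \<and> laplacian h = (\<lambda>x. 0)"
  by (auto simp: solid_harmonics_def homogeneous_def fun_eq_iff)

lemma solid_harmonics_poly: "h \<in> solid_harmonics l \<Longrightarrow> real_polynomial_function h"
  by (auto simp: solid_harmonics_iff intro: homogeneous_poly)

lemma laplacian_add: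
  "real_polynomial_function f \<Longrightarrow> real_polynomial_function g \<Longrightarrow>
     laplacian (\<lambda>x::real^'n. f x + g x) = (\<lambda>x. laplacian f x + laplacian g x)"
  by (simp add: laplacian_eq polynomial_add partial_deriv_add polynomial_partial_deriv sum.distrib)

lemma laplacian_cmult:
  "real_polynomial_function f \<Longrightarrow> laplacian (\<lambda>x::real^'n. c * f x) = (\<lambda>x. c * laplacian f x)"
  by (simp add: laplacian_eq polynomial_mult polynomial_const partial_deriv_cmult polynomial_partial_deriv sum_distrib_left)

lemma solid_harmonics_add: "h \<in> solid_harmonics l \<Longrightarrow> g \<in> solid_harmonics l \<Longrightarrow> (\<lambda>x. h x + g x) \<in> solid_harmonics l"
  by (auto simp: solid_harmonics_iff laplacian_add[OF homogeneous_poly homogeneous_poly] intro: homogeneous_add)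

lemma solid_harmonics_cmult: "h \<in> solid_harmonics l \<Longrightarrow> (\<lambda>x. c * h x) \<in> solid_harmonics l"
  by (auto simp: solid_harmonics_iff laplacian_cmult[OF homogeneous_poly] intro: homogeneous_cmult)

lemma solid_harmonics_zero: "(\<lambda>x. 0) \<in> solid_harmonics l"
  using laplacian_low_degree[OF homogeneous_zero[of 0]] by (simp add: solid_harmonics_iff homogeneous_zero)

lemma solid_harmonics_sum:
  "(\<And>i. i \<in> I \<Longrightarrow> h i \<in> solid_harmonics l) \<Longrightarrow> finite I \<Longrightarrow> (\<lambda>x. \<Sum>i\<in>I. h i x) \<in> solid_harmonics l"
proof -
  assume "finite I" "\<And>i. i \<in> I \<Longrightarrow> h i \<in> solid_harmonics l"
  then show ?thesis
    by (induction I rule: finite_induct) (auto simp: solid_harmonics_zero solid_harmonics_add)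
qed

lemma solid_harmonics_const: "(\<lambda>x. c) \<in> solid_harmonics 0"
proof -
  have "homogeneous 0 (\<lambda>x::real^'n. c)" by (auto simp: homogeneous_def)
  from laplacian_low_degree[OF this] this show ?thesis by (auto simp: solid_harmonics_iff)
qed

lemma spherical_laplacian_solid_harmonic:
  fixes h :: "real^'n::finite \<Rightarrow> real"
  assumes "h \<in> solid_harmonics l"
  shows "spherical_laplacian h = (\<lambda>x. - lb_eigenvalue (CARD('n) - 1) l * h x)"
  using assms by (auto simp: solid_harmonics_iff spherical_laplacian_homogeneous)

lemma lb_eigenvalue_strict_mono:
  assumes "d \<ge> 1" "k < l" shows "lb_eigenvalue d k < lb_eigenvalue d l"
proof -
  have "real k * (real k + real d - 1) \<le> real k * (real l + real d - 1)" using assms by (intro mult_left_mono) auto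
  also have "\<dots> < real l * (real l + real d - 1)" using assms by (intro mult_strict_right_mono) auto
  finally show ?thesis by (simp add: lb_eigenvalue_def)
qed

lemma lb_eigenvalue_nonneg: "d \<ge> 1 \<Longrightarrow> lb_eigenvalue d l \<ge> 0"
  unfolding lb_eigenvalue_def by (cases "l = 0") auto

text \<open>They are eigenfunctions of the self-adjoint spherical Laplacian for different eigenvalues. The
  assumption excludes the sphere of dimension \<open>0\<close>, where the eigenvalues of degree \<open>0\<close> and \<open>1\<close> coincide.\<close>

lemma solid_harmonics_orthogonal:
  fixes h g :: "real^'n::finite \<Rightarrow> real"
  assumes d: "CARD('n) \<ge> 2" and h: "h \<in> solid_harmonics k" and g: "g \<in> solid_harmonics l" and "k \<noteq> l"
  shows "(LINT x|sphere_measure. h x * g x) = 0"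
proof -
  let ?e = "lb_eigenvalue (CARD('n) - 1)"
  have ne: "?e k \<noteq> ?e l"
  proof -
    have "CARD('n) - 1 \<ge> 1" using d by linarith
    from lb_eigenvalue_strict_mono[OF this, of k l] lb_eigenvalue_strict_mono[OF this, of l k]
    show ?thesis using \<open>k \<noteq> l\<close> by (cases k l rule: linorder_cases) auto
  qed
  have "(LINT x|sphere_measure. h x * (- ?e l * g x)) = (LINT x|sphere_measure. (- ?e k * h x) * g x)"
    using spherical_laplacian_selfadjoint[OF solid_harmonics_poly[OF h] solid_harmonics_poly[OF g]]
    by (simp add: spherical_laplacian_solid_harmonic[OF h] spherical_laplacian_solid_harmonic[OF g])
  moreover have "(LINT x|sphere_measure. h x * (- ?e l * g x)) = - ?e l * (LINT x|sphere_measure. h x * g x)"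
    by (subst integral_mult_right_zero[symmetric]) (simp add: mult_ac)
  moreover have "(LINT x|sphere_measure. (- ?e k * h x) * g x) = - ?e k * (LINT x|sphere_measure. h x * g x)"
    by (subst integral_mult_right_zero[symmetric]) (simp add: mult_ac)
  ultimately show ?thesis using ne by simp
qed

lemma homogeneous_sphere_eqI:
  assumes h: "homogeneous l (h :: real^'n::finite \<Rightarrow> real)" and g: "homogeneous l g"
    and eq: "\<And>x. x \<in> sphere 0 1 \<Longrightarrow> h x = g x"
  shows "h = g"
proof
  fix x :: "real^'n"
  obtain y :: "real^'n" where y: "y \<in> sphere 0 1" "x = norm x *\<^sub>R y"
  proof (cases "x = 0")
    case True
    have "norm (axis undefined 1 :: real^'n) = 1" by simp
    then show ?thesis using True by (intro that[of "axis undefined 1"]) auto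
  next
    case False
    then show ?thesis by (intro that[of "sgn x"]) (auto simp: norm_sgn sgn_div_norm)
  qed
  have "h x = norm x ^ l * h y" "g x = norm x ^ l * g y"
    using h g y(2) unfolding homogeneous_def by metis+
  then show "h x = g x" using eq[OF y(1)] by simp
qed

text \<open>Induction on the degree. On \<open>f\<close> homogeneous of degree \<open>k\<close> the spherical Laplacian is multiplication by
  \<open>-\<lambda>_k\<close> plus \<open>|x|^2\<close> times the Laplacian of \<open>f\<close>, which is decomposed by induction into components
  \<open>G_l\<close>. Subtracting from \<open>f\<close> the functions \<open>|x|^2 G_l / (\<lambda>_k - \<lambda>_l)\<close> leaves an eigenfunction for
  \<open>-\<lambda>_k\<close>, and that is a harmonic polynomial. The statement keeps the components homogeneous of degree
  \<open>k\<close> and eigenfunctions on the whole space, which is what the induction needs.\<close>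

lemma solid_harmonic_decomposition_homogeneous:
  fixes f :: "real^'n::finite \<Rightarrow> real"
  assumes d: "CARD('n) \<ge> 2" and "homogeneous k f"
  shows "\<exists>G. (\<forall>l. homogeneous k (G l) \<and> spherical_laplacian (G l) = (\<lambda>x. - lb_eigenvalue (CARD('n) - 1) l * G l x)
      \<and> (\<exists>h\<in>solid_harmonics l. \<forall>x\<in>sphere 0 1. G l x = h x))
    \<and> f = (\<lambda>x. \<Sum>l\<le>k. G l x)"
  using assms(2)
proof (induction k arbitrary: f rule: less_induct)
  case (less k)
  let ?e = "lb_eigenvalue (CARD('n) - 1)"
  note f = less.prems
  \<comment> \<open>only the component \<open>f'\<close> of top degree is itself a solid harmonic; the lower ones agree with solid harmonics on the sphere\<close>
  have conclude: ?case if G: "\<And>l. l < k \<Longrightarrow> homogeneous k (G l) \<and> spherical_laplacian (G l) = (\<lambda>x. - ?e l * G l x)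
      \<and> (\<exists>h\<in>solid_harmonics l. \<forall>x\<in>sphere 0 1. G l x = h x)"
    and f': "f' \<in> solid_harmonics k" and sum: "\<And>x. f x = f' x + (\<Sum>l<k. G l x)" for G f'
  proof (intro exI[of _ "\<lambda>l. if l < k then G l else if l = k then f' else (\<lambda>x. 0)"] conjI allI)
    fix l
    let ?G = "if l < k then G l else if l = k then f' else (\<lambda>x. 0)"
    show "homogeneous k ?G" using G f' by (auto simp: solid_harmonics_iff homogeneous_zero)
    show "spherical_laplacian ?G = (\<lambda>x. - ?e l * ?G x)"
      using G f' by (auto simp: spherical_laplacian_solid_harmonic)
    show "\<exists>h\<in>solid_harmonics l. \<forall>x\<in>sphere 0 1. ?G x = h x"
    proof -
      have "\<exists>h\<in>solid_harmonics l. \<forall>x\<in>sphere (0::real^'n) 1. 0 = h x"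
        using solid_harmonics_zero by (intro bexI[of _ "\<lambda>x. 0"]) auto
      then show ?thesis using G f' by (cases "l < k"; cases "l = k") auto
    qed
  next
    show "f = (\<lambda>x. \<Sum>l\<le>k. (if l < k then G l else if l = k then f' else (\<lambda>x. 0)) x)"
    proof
      fix x
      have "(\<Sum>l<k. (if l < k then G l else if l = k then f' else (\<lambda>x. 0)) x) = (\<Sum>l<k. G l x)"
        by (intro sum.cong) auto
      then show "f x = (\<Sum>l\<le>k. (if l < k then G l else if l = k then f' else (\<lambda>x. 0)) x)"
        by (simp add: sum sum.lessThan_Suc lessThan_Suc_atMost[symmetric])
    qed
  qed
  show ?case
  proof (cases "k < 2")
    case True
    have z: "\<exists>h\<in>solid_harmonics l. \<forall>x\<in>sphere (0::real^'n) 1. 0 = h x" for l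
      using solid_harmonics_zero by (intro bexI[of _ "\<lambda>x. 0"]) auto
    have "f \<in> solid_harmonics k" using laplacian_low_degree[OF f True] f by (simp add: solid_harmonics_iff)
    then show ?thesis
      by (intro conclude[of "\<lambda>l x. 0" f] conjI z) (simp_all add: homogeneous_zero)
  next
    case False
    then obtain j where k: "k = Suc (Suc j)" by (metis less_2_cases_iff not0_implies_Suc One_nat_def)
    obtain G where G: "\<And>l. homogeneous j (G l)" "\<And>l. spherical_laplacian (G l) = (\<lambda>x. - ?e l * G l x)"
        "\<And>l. \<exists>h\<in>solid_harmonics l. \<forall>x\<in>sphere 0 1. G l x = h x"
      and lap: "laplacian f = (\<lambda>x. \<Sum>l\<le>j. G l x)"
    proof -
      have "j < k" "homogeneous j (laplacian f)" using homogeneous_laplacian[of j f] f k by auto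
      from less.IH[OF this] show thesis by (elim exE conjE) (rule that, auto)
    qed
    define G' where "G' = (\<lambda>l x. if l \<le> j then (1 / (?e k - ?e l)) * ((norm x)\<^sup>2 * G l x) else 0)"
    have ne: "?e k - ?e l \<noteq> 0" if "l < k" for l using lb_eigenvalue_strict_mono[of "CARD('n) - 1" l k] d that by linarith
    have pG: "real_polynomial_function (\<lambda>x. (norm x)\<^sup>2 * G l x)" for l
      using G(1) homogeneous_poly by (intro polynomial_mult polynomial_norm_sq) auto
    have hG': "homogeneous k (G' l)" for l
    proof -
      have "homogeneous k (\<lambda>x. (norm x)\<^sup>2 * G l x)"
        using G(1)[of l] pG[of l] by (auto simp: homogeneous_def k power_mult_distrib power2_eq_square)
      from homogeneous_cmult[OF this] homogeneous_zero show ?thesis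
        unfolding G'_def by (cases "l \<le> j") (simp_all only: if_True if_False)
    qed
    have eG': "spherical_laplacian (G' l) = (\<lambda>x. - ?e l * G' l x)" for l
    proof (cases "l \<le> j")
      case True
      then have "spherical_laplacian (G' l) = (\<lambda>x. (1 / (?e k - ?e l)) * spherical_laplacian (\<lambda>x. (norm x)\<^sup>2 * G l x) x)"
        unfolding G'_def using pG by (simp only: if_True spherical_laplacian_cmult)
      also have "\<dots> = (\<lambda>x. - ?e l * G' l x)"
        unfolding spherical_laplacian_norm_sq_mult[OF homogeneous_poly[OF G(1)]] G(2) G'_def
        using True by (simp add: fun_eq_iff)
      finally show ?thesis .
    qed (simp add: G'_def)
    have sG': "\<exists>h\<in>solid_harmonics l. \<forall>x\<in>sphere 0 1. G' l x = h x" for l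
    proof -
      obtain h where h: "h \<in> solid_harmonics l" "\<forall>x\<in>sphere 0 1. G l x = h x" using G(3) by blast
      show ?thesis
      proof (cases "l \<le> j")
        case True
        then show ?thesis using h by (intro bexI[OF _ solid_harmonics_cmult[OF h(1), of "1 / (?e k - ?e l)"]]) (simp add: G'_def)
      next
        case False
        then show ?thesis by (intro bexI[OF _ solid_harmonics_zero]) (simp add: G'_def)
      qed
    qed
    define f' where "f' = (\<lambda>x. f x + (-1) * (\<Sum>l<k. G' l x))"
    have hs: "homogeneous k (\<lambda>x. \<Sum>l<k. G' l x)" using hG' by (intro homogeneous_sum) auto
    have hf': "homogeneous k f'" unfolding f'_def by (intro homogeneous_add homogeneous_cmult hs f)
    have "laplacian f' x = 0" if "x \<noteq> 0" for x
    proof -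
      have e1: "spherical_laplacian f' x = spherical_laplacian f x + (\<Sum>l<k. ?e l * G' l x)"
        unfolding f'_def using homogeneous_poly[OF hG']
        by (subst spherical_laplacian_add[OF homogeneous_poly[OF f] homogeneous_poly[OF homogeneous_cmult[OF hs]]])
          (simp add: spherical_laplacian_cmult[OF homogeneous_poly[OF hs], of "-1", simplified] spherical_laplacian_sum eG' sum_negf)
      have "(\<Sum>l<k. (?e k - ?e l) * G' l x) = (\<Sum>l<k. if l \<le> j then (norm x)\<^sup>2 * G l x else 0)"
        using ne by (intro sum.cong) (auto simp: G'_def)
      also have "\<dots> = (\<Sum>l\<le>j. (norm x)\<^sup>2 * G l x)"
        by (intro sum.mono_neutral_cong_right) (auto simp: k)
      also have "\<dots> = (norm x)\<^sup>2 * laplacian f x" by (simp add: lap sum_distrib_left)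
      finally have e2: "?e k * (\<Sum>l<k. G' l x) - (\<Sum>l<k. ?e l * G' l x) = (norm x)\<^sup>2 * laplacian f x"
        by (simp add: algebra_simps sum_subtractf sum_distrib_left)
      have "(norm x)\<^sup>2 * laplacian f' x = spherical_laplacian f' x + ?e k * f' x"
        by (simp add: spherical_laplacian_homogeneous[OF hf'])
      also have "\<dots> = 0"
        unfolding e1 using e2 by (simp add: spherical_laplacian_homogeneous[OF f] f'_def algebra_simps)
      finally show ?thesis using that by simp
    qed
    then have "laplacian f' x = 0" if "x \<in> sphere 0 1" for x using that by (cases "x = 0") auto
    then have "laplacian f' = (\<lambda>x. 0)"
      using homogeneous_laplacian[of j f'] hf'
      by (intro homogeneous_sphere_eqI[of j]) (simp_all add: k homogeneous_zero)
    then have "f' \<in> solid_harmonics k" using hf' by (simp add: solid_harmonics_iff)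
    then show ?thesis
      using hG' eG' sG' by (intro conclude[of G' f']) (auto simp: f'_def)
  qed
qed

lemma solid_harmonic_decomposition:
  fixes f :: "real^'n::finite \<Rightarrow> real"
  assumes d: "CARD('n) \<ge> 2" and f: "real_polynomial_function f"
  shows "\<exists>n h. (\<forall>l. h l \<in> solid_harmonics l) \<and> (\<forall>x\<in>sphere 0 1. f x = (\<Sum>l\<le>n. h l x))"
proof -
  obtain n p where p: "\<And>k. p k \<in> fn.span (monomials k)" "f = (\<lambda>x. \<Sum>k\<le>n. p k x)"
    using polynomial_homogeneous_parts[OF f] by blast
  have "\<forall>k. \<exists>h. (\<forall>l. h l \<in> solid_harmonics l) \<and> (\<forall>x\<in>sphere 0 1. p k x = (\<Sum>l\<le>k. h l x))"
  proof
    fix k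
    obtain G where G: "\<And>l. \<exists>h\<in>solid_harmonics l. \<forall>x\<in>sphere 0 1. G l x = h x" "p k = (\<lambda>x. \<Sum>l\<le>k. G l x)"
      using solid_harmonic_decomposition_homogeneous[OF d homogeneous_span[OF p(1)], of k] by blast
    from G(1) obtain h where "\<And>l. h l \<in> solid_harmonics l" "\<And>l x. x \<in> sphere 0 1 \<Longrightarrow> G l x = h l x" by metis
    then show "\<exists>h. (\<forall>l. h l \<in> solid_harmonics l) \<and> (\<forall>x\<in>sphere 0 1. p k x = (\<Sum>l\<le>k. h l x))"
      using G(2) by (intro exI[of _ h]) auto
  qed
  then obtain h where h: "\<And>k l. h k l \<in> solid_harmonics l" "\<And>k x. x \<in> sphere 0 1 \<Longrightarrow> p k x = (\<Sum>l\<le>k. h k l x)" by metis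
  have "f x = (\<Sum>l\<le>n. \<Sum>k\<in>{l..n}. h k l x)" if "x \<in> sphere 0 1" for x
  proof -
    have "f x = (\<Sum>k\<le>n. \<Sum>l\<le>k. h k l x)" using that by (simp add: p(2) h(2))
    also have "\<dots> = (\<Sum>l\<le>n. \<Sum>k\<in>{l..n}. h k l x)"
      unfolding sum.Sigma[OF finite_atMost ballI[OF finite_atMost]] 
      by (subst sum.Sigma) (auto intro!: sum.reindex_bij_witness[where i="\<lambda>(a,b). (b,a)" and j="\<lambda>(a,b). (b,a)"])
    finally show ?thesis .
  qed
  then show ?thesis using h(1)
    by (intro exI[of _ n] exI[of _ "\<lambda>l x. \<Sum>k\<in>{l..n}. h k l x"]) (auto intro!: solid_harmonics_sum)
qed

section \<open>The reproducing kernel and the harmonic projections\<close>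

definition sphere_ip :: "(real^'n::finite \<Rightarrow> real) \<Rightarrow> (real^'n \<Rightarrow> real) \<Rightarrow> real" where
  "sphere_ip f g = (LINT x|sphere_measure. f x * g x)"

lemma sphere_ip_commute: "sphere_ip f g = sphere_ip g f"
  by (simp add: sphere_ip_def mult.commute)

lemma sphere_ip_sum_right:
  assumes "\<And>i. i \<in> I \<Longrightarrow> integrable sphere_measure (\<lambda>x. f x * g i x)"
  shows "sphere_ip f (\<lambda>x. \<Sum>i\<in>I. c i * g i x) = (\<Sum>i\<in>I. c i * sphere_ip f (g i))"
proof -
  have eq: "f x * (\<Sum>i\<in>I. c i * g i x) = (\<Sum>i\<in>I. c i * (f x * g i x))" for x
    unfolding sum_distrib_left by (intro sum.cong refl mult.left_commute)
  have "sphere_ip f (\<lambda>x. \<Sum>i\<in>I. c i * g i x) = (LINT x|sphere_measure. (\<Sum>i\<in>I. c i * (f x * g i x)))"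
    unfolding sphere_ip_def by (intro Bochner_Integration.integral_cong refl eq)
  also have "\<dots> = (\<Sum>i\<in>I. (LINT x|sphere_measure. c i * (f x * g i x)))"
    using assms by (intro Bochner_Integration.integral_sum) auto
  finally show ?thesis by (simp add: sphere_ip_def)
qed

definition orthonormal_harmonics :: "nat \<Rightarrow> (real^'n::finite \<Rightarrow> real) set \<Rightarrow> bool" where
  "orthonormal_harmonics l E \<longleftrightarrow> finite E \<and> E \<subseteq> solid_harmonics l \<and>
     (\<forall>e\<in>E. \<forall>e'\<in>E. sphere_ip e e' = (if e = e' then 1 else 0))"

lemma sphere_ip_poly_sum:
  assumes "real_polynomial_function (f :: real^'n \<Rightarrow> real)" "\<And>i. i \<in> I \<Longrightarrow> real_polynomial_function (g i)"
  shows "sphere_ip f (\<lambda>x. \<Sum>i\<in>I. c i * g i x) = (\<Sum>i\<in>I. c i * sphere_ip f (g i))"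
  by (rule sphere_ip_sum_right) (use assms in \<open>auto intro!: integrable_polynomial_sphere\<close>)

text \<open>One step of the Gram--Schmidt process.\<close>

lemma orthonormal_extend:
  fixes b :: "real^'n::finite \<Rightarrow> real"
  assumes E: "orthonormal_harmonics l E" and b: "b \<in> solid_harmonics l"
  shows "\<exists>E'. orthonormal_harmonics l E' \<and> E \<subseteq> E' \<and> b \<in> fn.span E'"
proof -
  have fin: "finite E" and ES: "E \<subseteq> solid_harmonics l"
    and on: "\<And>e e'. e \<in> E \<Longrightarrow> e' \<in> E \<Longrightarrow> sphere_ip e e' = (if e = e' then 1 else 0)"
    using E by (auto simp: orthonormal_harmonics_def)
  have poly: "real_polynomial_function e" if "e \<in> E" for e using ES that solid_harmonics_poly by blast
  have pb: "real_polynomial_function b" using b by (rule solid_harmonics_poly)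
  define s where "s = (\<lambda>x. \<Sum>e\<in>E. sphere_ip b e * e x)"
  define r where "r = (\<lambda>x. b x + (-1) * s x)"
  have s: "s \<in> solid_harmonics l"
    unfolding s_def using ES fin by (intro solid_harmonics_sum solid_harmonics_cmult) auto
  have r: "r \<in> solid_harmonics l"
    unfolding r_def by (intro solid_harmonics_add solid_harmonics_cmult b s)
  have pr: "real_polynomial_function r" and ps: "real_polynomial_function s" using r s solid_harmonics_poly by blast+
  have s_span: "s \<in> fn.span E"
  proof -
    have "s = (\<Sum>e\<in>E. (\<lambda>x. sphere_ip b e * e x))" by (simp add: s_def fun_eq_iff sum_fun_apply)
    then show ?thesis by (simp only:) (intro fn.span_sum fn.span_scale fn.span_base)
  qed
  have perp: "sphere_ip e r = 0" if e: "e \<in> E" for e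
  proof -
    have "sphere_ip e s = (\<Sum>e'\<in>E. sphere_ip b e' * sphere_ip e e')"
      unfolding s_def by (rule sphere_ip_poly_sum) (use poly e in auto)
    also have "\<dots> = (\<Sum>e'\<in>E. if e = e' then sphere_ip b e' else 0)" using on e by (intro sum.cong) auto
    also have "\<dots> = sphere_ip b e" using e fin by simp
    finally have "sphere_ip e s = sphere_ip e b" by (simp add: sphere_ip_commute)
    moreover have "sphere_ip e r = sphere_ip e b - sphere_ip e s"
      using poly[OF e] pb ps unfolding sphere_ip_def r_def
      by (subst Bochner_Integration.integral_diff[symmetric]) (auto intro!: integrable_polynomial_sphere simp: algebra_simps)
    ultimately show ?thesis by simp
  qed
  show ?thesis
  proof (cases "r = (\<lambda>x. 0)")
    case True
    then have "b = s" by (simp add: r_def fun_eq_iff)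
    then show ?thesis using s_span E by auto
  next
    case False
    have nz: "sphere_ip r r \<noteq> 0"
    proof
      assume "sphere_ip r r = 0"
      then have "r x = 0" if "x \<in> sphere 0 1" for x
        using integral_square_zero_sphere[OF continuous_on_polynomial[OF pr] _ that] by (simp add: sphere_ip_def)
      then have "r = (\<lambda>x. 0)"
        using r by (intro homogeneous_sphere_eqI[of l]) (auto simp: solid_harmonics_iff homogeneous_zero)
      then show False using False by simp
    qed
    have nn: "sphere_ip r r \<ge> 0" unfolding sphere_ip_def by (intro integral_nonneg_AE) auto
    define c where "c = 1 / sqrt (sphere_ip r r)"
    have c: "c * c * sphere_ip r r = 1" "c \<noteq> 0" using nz nn by (auto simp: c_def)
    define e0 where "e0 = (\<lambda>x. c * r x)"
    have e0: "e0 \<in> solid_harmonics l" unfolding e0_def by (rule solid_harmonics_cmult[OF r])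
    have scale: "sphere_ip f e0 = c * sphere_ip f r" for f
      unfolding sphere_ip_def e0_def by (subst integral_mult_right_zero[symmetric]) (simp add: mult_ac)
    have e00: "sphere_ip e0 e0 = 1"
      using scale[of e0] scale[of r] c by (simp add: sphere_ip_commute[of e0 r])
    have e0e: "sphere_ip e e0 = 0" if "e \<in> E" for e using perp[OF that] by (simp add: scale)
    have on': "orthonormal_harmonics l (insert e0 E)"
      unfolding orthonormal_harmonics_def
    proof (intro conjI ballI)
      show "finite (insert e0 E)" "insert e0 E \<subseteq> solid_harmonics l" using fin ES e0 by auto
      fix e e' assume "e \<in> insert e0 E" "e' \<in> insert e0 E"
      then consider "e \<in> E" "e' \<in> E" | "e = e0" "e' = e0" | "e = e0" "e' \<in> E" | "e \<in> E" "e' = e0" by blast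
      then show "sphere_ip e e' = (if e = e' then 1 else 0)"
      proof cases
        case 3
        then have "sphere_ip e e' = 0" "e \<noteq> e'" using e0e[of e'] e00 by (auto simp: sphere_ip_commute)
        then show ?thesis by simp
      next
        case 4
        then have "sphere_ip e e' = 0" "e \<noteq> e'" using e0e[of e] e00 by auto
        then show ?thesis by simp
      qed (use on e00 in auto)
    qed
    have "b = (\<lambda>x. (1/c) * e0 x) + s" using c by (simp add: r_def e0_def fun_eq_iff)
    also have "\<dots> \<in> fn.span (insert e0 E)"
    proof (rule fn.span_add)
      show "(\<lambda>x. (1/c) * e0 x) \<in> fn.span (insert e0 E)" by (rule fn.span_scale[OF fn.span_base]) simp
      show "s \<in> fn.span (insert e0 E)" using s_span fn.span_mono[OF subset_insertI[of E e0]] by (rule rev_subsetD)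
    qed
    finally show ?thesis using on' by blast
  qed
qed

lemma orthonormal_basis_exists:
  obtains E where "orthonormal_harmonics l (E :: (real^'n::finite \<Rightarrow> real) set)" "solid_harmonics l \<subseteq> fn.span E"
proof -
  obtain B where B: "B \<subseteq> solid_harmonics l" "\<not> fn.dependent B" "(solid_harmonics l :: (real^'n \<Rightarrow> real) set) \<subseteq> fn.span B"
    by (rule fn.basis_exists)
  have "solid_harmonics l \<subseteq> fn.span (monomials l :: (real^'n \<Rightarrow> real) set)"
    using homogeneous_in_span_monomials by (auto simp: solid_harmonics_iff)
  then have "finite B" using fn.independent_span_bound[OF finite_monomials B(2)] B(1) by blast
  then have "\<exists>E. orthonormal_harmonics l E \<and> B \<subseteq> fn.span E"
    using B(1)
  proof (induction B rule: finite_induct)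
    case empty
    show ?case by (intro exI[of _ "{}"]) (simp add: orthonormal_harmonics_def)
  next
    case (insert b B)
    then obtain E where E: "orthonormal_harmonics l E" "B \<subseteq> fn.span E" by auto
    obtain E' where "orthonormal_harmonics l E'" "E \<subseteq> E'" "b \<in> fn.span E'"
      using orthonormal_extend[OF E(1)] insert.prems by blast
    then show ?case using E(2) fn.span_mono[of E E'] by (intro exI[of _ E']) auto
  qed
  then obtain E where E: "orthonormal_harmonics l E" "B \<subseteq> fn.span E" by blast
  then have "fn.span B \<subseteq> fn.span E" by (intro fn.span_minimal fn.subspace_span)
  then show thesis using that[OF E(1)] B(3) by blast
qed

lemma orthonormal_expansion:
  fixes h :: "real^'n::finite \<Rightarrow> real"
  assumes E: "orthonormal_harmonics l E" and h: "h \<in> fn.span E"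
  shows "h x = (\<Sum>e\<in>E. sphere_ip h e * e x)"
proof -
  have fin: "finite E" and ES: "E \<subseteq> solid_harmonics l"
    and on: "\<And>e e'. e \<in> E \<Longrightarrow> e' \<in> E \<Longrightarrow> sphere_ip e e' = (if e = e' then 1 else 0)"
    using E by (auto simp: orthonormal_harmonics_def)
  have poly: "real_polynomial_function e" if "e \<in> E" for e using ES that solid_harmonics_poly by blast
  obtain u where u: "h = (\<Sum>e\<in>E. (\<lambda>x. u e * e x))" using h fn.span_finite[OF fin] by auto
  then have u': "h = (\<lambda>x. \<Sum>e\<in>E. u e * e x)" by (simp add: fun_eq_iff sum_fun_apply)
  have "sphere_ip h e = u e" if e: "e \<in> E" for e
  proof -
    have "sphere_ip e h = (\<Sum>e'\<in>E. u e' * sphere_ip e e')"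
      unfolding u' by (rule sphere_ip_poly_sum) (use poly e in auto)
    also have "\<dots> = (\<Sum>e'\<in>E. if e = e' then u e' else 0)" using on e by (intro sum.cong) auto
    finally show ?thesis using e fin by (simp add: sphere_ip_commute)
  qed
  then show ?thesis by (simp add: u')
qed

text \<open>The kernel is the usual sum over an orthonormal basis. It is unique because a solid harmonic that
  is orthogonal to itself vanishes on the sphere, and by homogeneity everywhere.\<close>

lemma harmonic_kernel_expansion:
  obtains E where "orthonormal_harmonics l (E :: (real^'n::finite \<Rightarrow> real) set)"
    "\<And>h x. h \<in> solid_harmonics l \<Longrightarrow> h x = (\<Sum>e\<in>E. sphere_ip h e * e x)"
    "\<And>x y. harmonic_kernel l x y = (\<Sum>e\<in>E. e x * e y)"
proof -
  obtain E where E: "orthonormal_harmonics l (E :: (real^'n \<Rightarrow> real) set)" "solid_harmonics l \<subseteq> fn.span E"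
    by (rule orthonormal_basis_exists)
  have exp: "h x = (\<Sum>e\<in>E. sphere_ip h e * e x)" if "h \<in> solid_harmonics l" for h x
    using orthonormal_expansion[OF E(1)] E(2) that by blast
  have fin: "finite E" and ES: "E \<subseteq> solid_harmonics l" using E(1) by (auto simp: orthonormal_harmonics_def)
  have poly: "real_polynomial_function e" if "e \<in> E" for e using ES that solid_harmonics_poly by blast
  have "harmonic_kernel l x = (\<lambda>y. \<Sum>e\<in>E. e x * e y)" for x
    unfolding harmonic_kernel_def
  proof (rule the_equality)
    let ?k = "\<lambda>y. \<Sum>e\<in>E. e x * e y"
    have k: "?k \<in> solid_harmonics l" using ES fin by (intro solid_harmonics_sum solid_harmonics_cmult) auto
    have rep: "(LINT y|sphere_measure. ?k y * h y) = h x" if h: "h \<in> solid_harmonics l" for h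
    proof -
      have "sphere_ip h ?k = (\<Sum>e\<in>E. e x * sphere_ip h e)"
        by (rule sphere_ip_poly_sum) (use poly h solid_harmonics_poly in auto)
      then show ?thesis using exp[OF h, of x] by (simp add: sphere_ip_def mult.commute)
    qed
    then show "?k \<in> solid_harmonics l \<and> (\<forall>h\<in>solid_harmonics l. (LINT y|sphere_measure. ?k y * h y) = h x)" using k by blast
    fix k' assume k': "k' \<in> solid_harmonics l \<and> (\<forall>h\<in>solid_harmonics l. (LINT y|sphere_measure. k' y * h y) = h x)"
    define r where "r = (\<lambda>y. k' y + (-1) * ?k y)"
    have r: "r \<in> solid_harmonics l" unfolding r_def using k k' by (intro solid_harmonics_add solid_harmonics_cmult) auto
    have pr: "real_polynomial_function r" "real_polynomial_function k'" "real_polynomial_function ?k"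
      using r k k' solid_harmonics_poly by blast+
    have "(LINT y|sphere_measure. r y * r y) = (LINT y|sphere_measure. k' y * r y) - (LINT y|sphere_measure. ?k y * r y)"
      using pr by (subst Bochner_Integration.integral_diff[symmetric])
        (auto intro!: integrable_polynomial_sphere polynomial_mult Bochner_Integration.integral_cong simp: r_def algebra_simps)
    also have "\<dots> = 0" using k' rep r by simp
    finally have "r y = 0" if "y \<in> sphere 0 1" for y
      using integral_square_zero_sphere[OF continuous_on_polynomial[OF pr(1)] _ that] by blast
    then have "r = (\<lambda>y. 0)"
      using r by (intro homogeneous_sphere_eqI[of l]) (auto simp: solid_harmonics_iff homogeneous_zero)
    then show "k' = ?k" by (simp add: r_def fun_eq_iff)
  qed
  then have ker: "harmonic_kernel l x y = (\<Sum>e\<in>E. e x * e y)" for x y by simp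
  show thesis
  proof (rule that[OF E(1)])
    show "h x = (\<Sum>e\<in>E. sphere_ip h e * e x)" if "h \<in> solid_harmonics l" for h x using that by (rule exp)
    show "harmonic_kernel l x y = (\<Sum>e\<in>E. e x * e y)" for x y by (rule ker)
  qed
qed

lemma integrable_mult_polynomial:
  assumes f: "integrable sphere_measure f" and g: "real_polynomial_function (g :: real^'n::finite \<Rightarrow> real)"
  shows "integrable sphere_measure (\<lambda>x. f x * g x)"
proof -
  obtain B where B: "B > 0" "\<And>x. x \<in> sphere 0 1 \<Longrightarrow> \<bar>g x\<bar> \<le> B"
    using bounded_continuous_sphere[OF continuous_on_polynomial[OF g]] by blast
  have gm: "g \<in> borel_measurable sphere_measure" using integrable_polynomial_sphere[OF g] by auto
  show ?thesis
  proof (rule Bochner_Integration.integrable_bound)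
    show "integrable sphere_measure (\<lambda>x. B * f x)" using f by simp
    show "(\<lambda>x. f x * g x) \<in> borel_measurable sphere_measure" using f gm by simp
    show "AE x in sphere_measure. norm (f x * g x) \<le> norm (B * f x)"
      using B by (intro AE_I2) (auto simp: abs_mult mult.commute[of B] intro!: mult_left_mono)
  qed
qed

text \<open>The projection is expressed through finitely many inner products, also for functions that are
  merely integrable. In contrast to the description of the kernel as a unique object, this form can
  be computed with.\<close>

lemma harmonic_proj_expansion:
  fixes l :: nat
  obtains E where "orthonormal_harmonics l (E :: (real^'n::finite \<Rightarrow> real) set)"
    "\<And>h x. h \<in> solid_harmonics l \<Longrightarrow> h x = (\<Sum>e\<in>E. sphere_ip h e * e x)"
    "\<And>f x. integrable sphere_measure f \<Longrightarrow> harmonic_proj l f x = (\<Sum>e\<in>E. sphere_ip f e * e x)"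
proof -
  obtain E where E: "orthonormal_harmonics l (E :: (real^'n::finite \<Rightarrow> real) set)"
    "\<And>h x. h \<in> solid_harmonics l \<Longrightarrow> h x = (\<Sum>e\<in>E. sphere_ip h e * e x)"
    "\<And>x y. harmonic_kernel l x y = (\<Sum>e\<in>E. e x * e y)"
    by (rule harmonic_kernel_expansion[where l=l and 'n='n]) (rule that)
  have poly: "real_polynomial_function e" if "e \<in> E" for e
    using E(1) that solid_harmonics_poly by (auto simp: orthonormal_harmonics_def)
  have proj: "harmonic_proj l f x = (\<Sum>e\<in>E. sphere_ip f e * e x)" if f: "integrable sphere_measure f" for f x
  proof -
    have "harmonic_proj l f x = sphere_ip f (\<lambda>y. \<Sum>e\<in>E. e x * e y)"
      by (simp add: harmonic_proj_def E(3) sphere_ip_def)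
    also have "\<dots> = (\<Sum>e\<in>E. e x * sphere_ip f e)"
      using integrable_mult_polynomial[OF f poly] by (intro sphere_ip_sum_right) auto
    finally show ?thesis by (simp add: mult.commute)
  qed
  show thesis
  proof (rule that[OF E(1)])
    show "h x = (\<Sum>e\<in>E. sphere_ip h e * e x)" if "h \<in> solid_harmonics l" for h x using that by (rule E(2))
    show "harmonic_proj l f x = (\<Sum>e\<in>E. sphere_ip f e * e x)" if "integrable sphere_measure f" for f x
      using that by (rule proj)
  qed
qed

lemma harmonic_proj_solid_harmonic:
  assumes "integrable sphere_measure (f :: real^'n::finite \<Rightarrow> real)"
  shows "harmonic_proj l f \<in> solid_harmonics l"
proof -
  obtain E where E: "orthonormal_harmonics l (E :: (real^'n::finite \<Rightarrow> real) set)"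
    "\<And>f x. integrable sphere_measure f \<Longrightarrow> harmonic_proj l f x = (\<Sum>e\<in>E. sphere_ip f e * e x)"
    by (rule harmonic_proj_expansion[where l=l and 'n='n]) (rule that)
  have "harmonic_proj l f = (\<lambda>x. \<Sum>e\<in>E. sphere_ip f e * e x)" using E(2)[OF assms] by (rule ext)
  then show ?thesis using E(1) by (auto simp: orthonormal_harmonics_def intro!: solid_harmonics_sum solid_harmonics_cmult)
qed

lemma harmonic_proj_of_solid_harmonic:
  assumes d: "CARD('n::finite) \<ge> 2" and h: "(h :: real^'n \<Rightarrow> real) \<in> solid_harmonics k"
  shows "harmonic_proj l h = (if k = l then h else (\<lambda>x. 0))"
proof -
  obtain E where E: "orthonormal_harmonics l (E :: (real^'n::finite \<Rightarrow> real) set)"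
    "\<And>h x. h \<in> solid_harmonics l \<Longrightarrow> h x = (\<Sum>e\<in>E. sphere_ip h e * e x)"
    "\<And>f x. integrable sphere_measure f \<Longrightarrow> harmonic_proj l f x = (\<Sum>e\<in>E. sphere_ip f e * e x)"
    by (rule harmonic_proj_expansion[where l=l and 'n='n]) (rule that)
  have "sphere_ip h e = 0" if "k \<noteq> l" "e \<in> E" for e
    using solid_harmonics_orthogonal[OF d h] E(1) that unfolding sphere_ip_def orthonormal_harmonics_def by blast
  then show ?thesis
    using E(2)[of h] E(3)[OF integrable_polynomial_sphere[OF solid_harmonics_poly[OF h]]] h by (auto simp: fun_eq_iff)
qed

lemma harmonic_proj_cong:
  assumes "\<And>x. x \<in> sphere 0 1 \<Longrightarrow> f x = g x"
  shows "harmonic_proj l f = harmonic_proj l (g :: real^'n::finite \<Rightarrow> real)"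
  unfolding harmonic_proj_def using assms by (intro ext Bochner_Integration.integral_cong) auto

lemma harmonic_proj_harmonic_sum:
  assumes d: "CARD('n::finite) \<ge> 2" and h: "\<And>l. (h l :: real^'n \<Rightarrow> real) \<in> solid_harmonics l"
    and f: "\<And>x. x \<in> sphere 0 1 \<Longrightarrow> f x = (\<Sum>l\<le>n. h l x)"
  shows "harmonic_proj k f = (if k \<le> n then h k else (\<lambda>x. 0))"
proof -
  have p: "real_polynomial_function (h l)" for l using h solid_harmonics_poly by blast
  obtain E where E: "orthonormal_harmonics k (E :: (real^'n::finite \<Rightarrow> real) set)"
    "\<And>f x. integrable sphere_measure f \<Longrightarrow> harmonic_proj k f x = (\<Sum>e\<in>E. sphere_ip f e * e x)"
    by (rule harmonic_proj_expansion[where l=k and 'n='n]) (rule that)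
  have poly: "real_polynomial_function e" if "e \<in> E" for e
    using E(1) that solid_harmonics_poly by (auto simp: orthonormal_harmonics_def)
  have ip: "sphere_ip (\<lambda>x. \<Sum>l\<le>n. h l x) e = (\<Sum>l\<le>n. sphere_ip (h l) e)" if "e \<in> E" for e
    using sphere_ip_poly_sum[OF poly[OF that], of "{..n}" h "\<lambda>_. 1"] p by (simp add: sphere_ip_commute)
  have "harmonic_proj k f x = (\<Sum>l\<le>n. harmonic_proj k (h l) x)" for x
  proof -
    have int: "integrable sphere_measure (\<lambda>x. \<Sum>l\<le>n. h l x)" using p by (auto intro!: integrable_polynomial_sphere)
    have "harmonic_proj k f x = harmonic_proj k (\<lambda>x. \<Sum>l\<le>n. h l x) x"
      using harmonic_proj_cong[of f "\<lambda>x. \<Sum>l\<le>n. h l x", OF f] by (simp only:)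
    also have "\<dots> = (\<Sum>e\<in>E. \<Sum>l\<le>n. sphere_ip (h l) e * e x)"
      unfolding E(2)[OF int] by (intro sum.cong) (auto simp: ip sum_distrib_right)
    also have "\<dots> = (\<Sum>l\<le>n. harmonic_proj k (h l) x)"
      by (subst sum.swap) (simp add: E(2)[OF integrable_polynomial_sphere[OF p]])
    finally show ?thesis .
  qed
  also have "(\<Sum>l\<le>n. harmonic_proj k (h l) x) = (\<Sum>l\<le>n. if l = k then h k x else 0)" for x
    by (intro sum.cong refl) (simp add: harmonic_proj_of_solid_harmonic[OF d h])
  finally show ?thesis by (auto simp: fun_eq_iff)
qed

lemma polynomial_eq_sum_harmonic_proj:
  assumes d: "CARD('n::finite) \<ge> 2" and f: "real_polynomial_function (f :: real^'n \<Rightarrow> real)"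
  shows "\<exists>n0. \<forall>n\<ge>n0. \<forall>x\<in>sphere 0 1. f x = (\<Sum>l\<le>n. harmonic_proj l f x)"
proof -
  obtain n0 h where hh: "\<forall>l. h l \<in> solid_harmonics l" "\<forall>x\<in>sphere 0 1. f x = (\<Sum>l\<le>n0. h l x)"
    using solid_harmonic_decomposition[OF d f] by (elim exE conjE) (rule that)
  have h: "h l \<in> solid_harmonics l" "x\<in>sphere 0 1 \<Longrightarrow> f x = (\<Sum>l\<le>n0. h l x)" for l x
    using hh by simp_all
  have hp: "harmonic_proj k f = (if k \<le> n0 then h k else (\<lambda>x. 0))" for k
    by (rule harmonic_proj_harmonic_sum[OF d]) (use hh in \<open>simp_all\<close>)
  have "f x = (\<Sum>l\<le>n. harmonic_proj l f x)" if "n \<ge> n0" "x \<in> sphere 0 1" for n x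
  proof -
    have "(\<Sum>l\<le>n. harmonic_proj l f x) = (\<Sum>l\<le>n. if l \<le> n0 then h l x else 0)"
      by (intro sum.cong refl) (simp add: hp)
    also have "\<dots> = (\<Sum>l\<le>n0. h l x)"
      using that by (intro sum.mono_neutral_cong_right) auto
    finally show ?thesis using h(2) that by simp
  qed
  then show ?thesis by blast
qed

text \<open>Self-adjointness moves the Laplacian onto the basis functions, which are eigenfunctions.\<close>

lemma harmonic_proj_spherical_laplacian:
  assumes f: "real_polynomial_function (f :: real^'n::finite \<Rightarrow> real)"
  shows "harmonic_proj l (spherical_laplacian f) = (\<lambda>x. - lb_eigenvalue (CARD('n) - 1) l * harmonic_proj l f x)"
proof
  fix x
  obtain E where E: "orthonormal_harmonics l (E :: (real^'n::finite \<Rightarrow> real) set)"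
    "\<And>f x. integrable sphere_measure f \<Longrightarrow> harmonic_proj l f x = (\<Sum>e\<in>E. sphere_ip f e * e x)"
    by (rule harmonic_proj_expansion[where l=l and 'n='n]) (rule that)
  have "sphere_ip (spherical_laplacian f) e = - lb_eigenvalue (CARD('n) - 1) l * sphere_ip f e" if "e \<in> E" for e
  proof -
    have e: "e \<in> solid_harmonics l" using E(1) that by (auto simp: orthonormal_harmonics_def)
    have "sphere_ip (spherical_laplacian f) e = (LINT x|sphere_measure. f x * (- lb_eigenvalue (CARD('n) - 1) l * e x))"
      using spherical_laplacian_selfadjoint[OF f solid_harmonics_poly[OF e]]
      by (simp add: sphere_ip_def spherical_laplacian_solid_harmonic[OF e])
    also have "\<dots> = - lb_eigenvalue (CARD('n) - 1) l * sphere_ip f e"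
      unfolding sphere_ip_def by (subst integral_mult_right_zero[symmetric]) (simp add: mult_ac)
    finally show ?thesis .
  qed
  then have "(\<Sum>e\<in>E. sphere_ip (spherical_laplacian f) e * e x)
      = (\<Sum>e\<in>E. - lb_eigenvalue (CARD('n) - 1) l * (sphere_ip f e * e x))"
    by (intro sum.cong refl) (simp only: mult.assoc)
  then show "harmonic_proj l (spherical_laplacian f) x = - lb_eigenvalue (CARD('n) - 1) l * harmonic_proj l f x"
    unfolding E(2)[OF integrable_polynomial_sphere[OF f]]
      E(2)[OF integrable_polynomial_sphere[OF polynomial_spherical_laplacian[OF f]]]
    by (simp only: sum_distrib_left)
qed

lemma integral_eq_harmonic_proj_0:
  assumes f: "integrable sphere_measure (f :: real^'n::finite \<Rightarrow> real)"
  shows "(LINT x|sphere_measure. harmonic_proj 0 f x) = (LINT x|sphere_measure. f x)"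
proof -
  interpret prob_space "sphere_measure :: (real^'n) measure" by (rule prob_space_sphere_measure)
  obtain E where E: "orthonormal_harmonics 0 (E :: (real^'n::finite \<Rightarrow> real) set)"
    "\<And>h x. h \<in> solid_harmonics 0 \<Longrightarrow> h x = (\<Sum>e\<in>E. sphere_ip h e * e x)"
    "\<And>f x. integrable sphere_measure f \<Longrightarrow> harmonic_proj 0 f x = (\<Sum>e\<in>E. sphere_ip f e * e x)"
    by (rule harmonic_proj_expansion[where l=0 and 'n='n]) (rule that)
  have ES: "e \<in> solid_harmonics 0" if "e \<in> E" for e using E(1) that by (auto simp: orthonormal_harmonics_def)
  have poly: "real_polynomial_function e" if "e \<in> E" for e using ES[OF that] by (rule solid_harmonics_poly)
  have one: "(1::real) = (\<Sum>e\<in>E. sphere_ip (\<lambda>x. 1) e * e x)" for x :: "real^'n"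
    using E(2)[OF solid_harmonics_const[of 1]] .
  have "(LINT x|sphere_measure. f x) = sphere_ip f (\<lambda>x. \<Sum>e\<in>E. sphere_ip (\<lambda>x. 1) e * e x)"
    unfolding one[symmetric] by (simp add: sphere_ip_def)
  also have "\<dots> = (\<Sum>e\<in>E. sphere_ip (\<lambda>x. 1) e * sphere_ip f e)"
    using integrable_mult_polynomial[OF f poly] by (intro sphere_ip_sum_right) auto
  also have "\<dots> = (\<Sum>e\<in>E. sphere_ip f e * sphere_ip (\<lambda>x. 1) e)" by (simp add: mult.commute)
  also have "\<dots> = sphere_ip (\<lambda>x. 1) (\<lambda>x. \<Sum>e\<in>E. sphere_ip f e * e x)"
    by (rule sphere_ip_poly_sum[symmetric]) (auto intro: poly)
  also have "\<dots> = (LINT x|sphere_measure. harmonic_proj 0 f x)"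
    by (simp add: sphere_ip_def E(3)[OF f])
  finally show ?thesis by simp
qed

lemma integral_harmonic_proj_pos:
  assumes d: "CARD('n::finite) \<ge> 2" and f: "integrable sphere_measure (f :: real^'n::finite \<Rightarrow> real)" and "l > 0"
  shows "(LINT x|sphere_measure. harmonic_proj l f x) = 0"
  using solid_harmonics_orthogonal[OF d harmonic_proj_solid_harmonic[OF f, of l] solid_harmonics_const[of 1]] \<open>l > 0\<close> by simp

section \<open>Integrable functions are determined by their projections\<close>

lemma sphere_ip_zero_of_proj_zero:
  assumes f: "integrable sphere_measure (f :: real^'n::finite \<Rightarrow> real)"
    and z: "\<And>x. x \<in> sphere 0 1 \<Longrightarrow> harmonic_proj l f x = 0" and h: "h \<in> solid_harmonics l"
  shows "sphere_ip f h = 0"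
proof -
  obtain E where E: "orthonormal_harmonics l (E :: (real^'n::finite \<Rightarrow> real) set)"
    "\<And>h x. h \<in> solid_harmonics l \<Longrightarrow> h x = (\<Sum>e\<in>E. sphere_ip h e * e x)"
    "\<And>f x. integrable sphere_measure f \<Longrightarrow> harmonic_proj l f x = (\<Sum>e\<in>E. sphere_ip f e * e x)"
    by (rule harmonic_proj_expansion[where l=l and 'n='n]) (rule that)
  have fin: "finite E" and ES: "\<And>e. e \<in> E \<Longrightarrow> e \<in> solid_harmonics l"
    and on: "\<And>e e'. e \<in> E \<Longrightarrow> e' \<in> E \<Longrightarrow> sphere_ip e e' = (if e = e' then 1 else 0)"
    using E(1) by (auto simp: orthonormal_harmonics_def)
  have poly: "real_polynomial_function e" if "e \<in> E" for e using ES[OF that] by (rule solid_harmonics_poly)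
  have c0: "sphere_ip f e = 0" if e: "e \<in> E" for e
  proof -
    have "sphere_ip e (harmonic_proj l f) = (LINT x|(sphere_measure :: (real^'n) measure). 0)"
      unfolding sphere_ip_def using z by (intro Bochner_Integration.integral_cong) auto
    also have "\<dots> = 0" by simp
    finally have "sphere_ip e (harmonic_proj l f) = 0" .
    moreover have "harmonic_proj l f = (\<lambda>x. \<Sum>e\<in>E. sphere_ip f e * e x)" using E(3)[OF f] by (rule ext)
    moreover have "sphere_ip e (\<lambda>x. \<Sum>e\<in>E. sphere_ip f e * e x) = (\<Sum>e'\<in>E. sphere_ip f e' * sphere_ip e e')"
      by (rule sphere_ip_poly_sum) (use poly e in auto)
    moreover have "\<dots> = (\<Sum>e'\<in>E. if e = e' then sphere_ip f e' else 0)" using on e by (intro sum.cong) auto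
    ultimately show ?thesis using e fin by simp
  qed
  have "h = (\<lambda>x. \<Sum>e\<in>E. sphere_ip h e * e x)" using E(2)[OF h] by (rule ext)
  moreover have "sphere_ip f (\<lambda>x. \<Sum>e\<in>E. sphere_ip h e * e x) = (\<Sum>e\<in>E. sphere_ip h e * sphere_ip f e)"
    using integrable_mult_polynomial[OF f poly] by (intro sphere_ip_sum_right) auto
  ultimately show ?thesis using c0 by simp
qed

text \<open>A function without harmonic components is orthogonal to all polynomials, since these are sums of
  harmonics, and hence to all continuous functions by the theorem of Stone and Weierstrass.\<close>

lemma integral_continuous_zero_of_proj_zero:
  assumes d: "CARD('n::finite) \<ge> 2" and f: "integrable sphere_measure (f :: real^'n::finite \<Rightarrow> real)"
    and z: "\<And>l x. x \<in> sphere 0 1 \<Longrightarrow> harmonic_proj l f x = 0"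
    and g: "continuous_on (sphere 0 1) g"
  shows "(LINT x|sphere_measure. f x * g x) = 0"
proof -
  have poly: "(LINT x|sphere_measure. f x * p x) = 0" if p: "real_polynomial_function p" for p
  proof -
    obtain n h where h: "\<forall>l. h l \<in> solid_harmonics l" "\<forall>x\<in>sphere 0 1. p x = (\<Sum>l\<le>n. h l x)"
      using solid_harmonic_decomposition[OF d p] by (elim exE conjE) (rule that)
    have "(LINT x|sphere_measure. f x * p x) = sphere_ip f (\<lambda>x. \<Sum>l\<le>n. 1 * h l x)"
      unfolding sphere_ip_def using h(2) by (intro Bochner_Integration.integral_cong) auto
    also have "\<dots> = (\<Sum>l\<le>n. 1 * sphere_ip f (h l))"
      using h(1) solid_harmonics_poly integrable_mult_polynomial[OF f] by (intro sphere_ip_sum_right) blast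
    also have "\<dots> = 0"
    proof -
      have "sphere_ip f (h l) = 0" for l
        using h(1) by (intro sphere_ip_zero_of_proj_zero[OF f, of l]) (simp_all add: z)
      then show ?thesis by simp
    qed
    finally show ?thesis .
  qed
  have gm: "g \<in> borel_measurable sphere_measure" by (rule borel_measurable_continuous_sphere[OF g])
  obtain B where B: "B > 0" "\<And>x. x \<in> sphere 0 1 \<Longrightarrow> \<bar>g x\<bar> \<le> B" using bounded_continuous_sphere[OF g] by blast
  have fg: "integrable sphere_measure (\<lambda>x. f x * g x)"
  proof (rule Bochner_Integration.integrable_bound)
    show "integrable sphere_measure (\<lambda>x. B * f x)" using f by simp
    show "(\<lambda>x. f x * g x) \<in> borel_measurable sphere_measure" using f gm by simp
    show "AE x in sphere_measure. norm (f x * g x) \<le> norm (B * f x)"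
      using B by (intro AE_I2) (auto simp: abs_mult mult.commute[of B] intro!: mult_left_mono)
  qed
  have small: "\<bar>LINT x|sphere_measure. f x * g x\<bar> \<le> e * (LINT x|sphere_measure. \<bar>f x\<bar>)" if "e > 0" for e
  proof -
    obtain p where p: "real_polynomial_function p" "\<And>x. x \<in> sphere 0 1 \<Longrightarrow> \<bar>g x - p x\<bar> < e"
      using Stone_Weierstrass_real_polynomial_function[OF compact_sphere g \<open>e > 0\<close>] by blast
    have fp: "integrable sphere_measure (\<lambda>x. f x * p x)" by (rule integrable_mult_polynomial[OF f p(1)])
    have "(LINT x|sphere_measure. f x * g x) = (LINT x|sphere_measure. f x * g x - f x * p x)"
      using poly[OF p(1)] fg fp by simp
    also have "\<bar>\<dots>\<bar> \<le> (LINT x|sphere_measure. \<bar>f x * g x - f x * p x\<bar>)" by (rule integral_abs_bound)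
    also have "\<dots> \<le> (LINT x|sphere_measure. e * \<bar>f x\<bar>)"
    proof (rule Bochner_Integration.integral_mono)
      fix x :: "real^'n" assume "x \<in> space sphere_measure"
      then have "\<bar>g x - p x\<bar> \<le> e" using p(2)[of x] by simp
      then have "\<bar>f x\<bar> * \<bar>g x - p x\<bar> \<le> \<bar>f x\<bar> * e" by (intro mult_left_mono) auto
      then show "\<bar>f x * g x - f x * p x\<bar> \<le> e * \<bar>f x\<bar>" by (simp add: abs_mult[symmetric] right_diff_distrib mult.commute)
    qed (use f fg fp in auto)
    finally show ?thesis by simp
  qed
  show ?thesis
  proof (rule ccontr)
    let ?I = "\<bar>LINT x|sphere_measure. f x * g x\<bar>" and ?N = "LINT x|sphere_measure. \<bar>f x\<bar>"
    assume "(LINT x|sphere_measure. f x * g x) \<noteq> 0"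
    then have I: "?I > 0" by simp
    have "\<exists>e>0. e * b < a" if "a > 0" "b \<ge> 0" for a b :: real
      using that by (intro exI[of _ "a / (b + 1)"]) (simp add: divide_less_eq distrib_left)
    from this[OF I, of ?N] obtain e where "e > 0" "e * ?N < ?I" by auto
    then show False using small[of e] by linarith
  qed
qed

text \<open>Indicators of closed sets are pointwise limits of continuous functions, so the integral of \<open>f\<close> over
  every closed set vanishes. Closed sets are stable under intersection and generate the Borel sets,
  so the same holds for all Borel sets.\<close>

lemma AE_zero_of_integral_continuous_zero:
  assumes f: "integrable sphere_measure (f :: real^'n::finite \<Rightarrow> real)"
    and z: "\<And>g. continuous_on (sphere 0 1) g \<Longrightarrow> (LINT x|sphere_measure. f x * g x) = 0"
  shows "AE x in sphere_measure. f x = 0"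
proof -
  have fm: "f \<in> borel_measurable sphere_measure" using f by auto
  have ind: "(indicator B :: real^'n \<Rightarrow> real) \<in> borel_measurable (sphere_measure :: (real^'n) measure)" if "B \<in> sets borel" for B :: "(real^'n) set"
  proof -
    have "(indicator B :: real^'n \<Rightarrow> real) \<in> borel_measurable (restrict_space borel (sphere 0 1))"
      using that by (intro measurable_restrict_space1) simp
    then show ?thesis by (simp only: measurable_cong_sets[OF sets_sphere_measure refl])
  qed
  have fi: "integrable sphere_measure (\<lambda>x. f x * indicator B x)" if "B \<in> sets borel" for B :: "(real^'n) set"
  proof (rule Bochner_Integration.integrable_bound[OF f])
    show "(\<lambda>x. f x * indicator B x) \<in> borel_measurable sphere_measure"
      by (rule borel_measurable_times[OF fm ind[OF that]])
    show "AE x in sphere_measure. norm (f x * indicator B x) \<le> norm (f x)"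
      by (intro AE_I2) (simp add: indicator_def)
  qed
  have closed: "(LINT x|sphere_measure. f x * indicator C x) = 0" if C: "closed C" for C :: "(real^'n) set"
  proof (cases "C = {}")
    case False
    define g where "g = (\<lambda>m x. max 0 (1 - real m * infdist x C))"
    have gc: "continuous_on (sphere 0 1) (g m)" for m
      unfolding g_def by (intro continuous_intros)
    have lim: "(\<lambda>m. g m x) \<longlonglongrightarrow> indicator C x" for x
    proof (cases "x \<in> C")
      case True
      then show ?thesis by (simp add: g_def)
    next
      case False
      then have pos: "infdist x C > 0"
        using in_closed_iff_infdist_zero[OF C \<open>C \<noteq> {}\<close>] infdist_nonneg[of x C] by (metis less_eq_real_def)
      obtain m0 where m0: "real m0 > 1 / infdist x C" using reals_Archimedean2 by blast
      have "g m x = 0" if "m \<ge> m0" for m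
      proof -
        have "real m > 1 / infdist x C" using m0 that by (meson less_le_trans of_nat_le_iff)
        then have "1 < real m * infdist x C" using pos by (simp add: field_simps)
        then show ?thesis by (simp add: g_def)
      qed
      then have "eventually (\<lambda>m. g m x = 0) sequentially" by (auto simp: eventually_sequentially)
      then show ?thesis using False by (simp add: tendsto_eventually)
    qed
    have "(\<lambda>m. LINT x|sphere_measure. f x * g m x) \<longlonglongrightarrow> (LINT x|sphere_measure. f x * indicator C x)"
    proof (rule integral_dominated_convergence[where w="\<lambda>x. \<bar>f x\<bar>"])
      show "(\<lambda>x. f x * indicator C x) \<in> borel_measurable sphere_measure" using fi[of C] C by auto
      show "(\<lambda>x. f x * g m x) \<in> borel_measurable sphere_measure" for m
        using fm borel_measurable_continuous_sphere[OF gc] by simp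
      show "AE x in sphere_measure. (\<lambda>m. f x * g m x) \<longlonglongrightarrow> f x * indicator C x"
        by (intro AE_I2 tendsto_intros lim)
      show "AE x in sphere_measure. norm (f x * g m x) \<le> \<bar>f x\<bar>" for m
      proof (rule AE_I2)
        fix x
        have "\<bar>g m x\<bar> \<le> 1" using infdist_nonneg[of x C] by (auto simp: g_def)
        then have "\<bar>f x\<bar> * \<bar>g m x\<bar> \<le> \<bar>f x\<bar> * 1" by (intro mult_left_mono) auto
        then show "norm (f x * g m x) \<le> \<bar>f x\<bar>" by (simp add: abs_mult)
      qed
    qed (use f in auto)
    then show ?thesis using z[OF gc] LIMSEQ_unique[OF _ tendsto_const] by simp
  qed simp
  have all: "(LINT x|sphere_measure. f x * indicator B x) = 0" if "B \<in> sets borel" for B :: "(real^'n) set"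
  proof -
    have sb: "sets borel = sigma_sets UNIV (Collect closed :: (real^'n) set set)"
      by (simp add: borel_eq_closed)
    have B: "B \<in> sigma_sets UNIV (Collect closed)" using that sb by simp
    show ?thesis
    proof (rule sigma_sets_induct_disjoint[OF _ _ B])
      show "Int_stable (Collect closed :: (real^'n) set set)" by (auto simp: Int_stable_def)
      show "(LINT x|sphere_measure. f x * indicator A x) = 0" if "A \<in> Collect closed" for A
        using closed that by simp
      show "(LINT x|sphere_measure. f x * indicator (UNIV - A) x) = 0"
        if A: "A \<in> sigma_sets UNIV (Collect closed)" "(LINT x|sphere_measure. f x * indicator A x) = 0" for A
      proof -
        have "A \<in> sets borel" using A sb by simp
        have "f x * indicator (UNIV - A) x = f x * 1 - f x * indicator A x" for x by (simp add: indicator_def)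
        then have "(LINT x|sphere_measure. f x * indicator (UNIV - A) x)
           = (LINT x|sphere_measure. f x * 1 - f x * indicator A x)" by (simp only:)
        also have "\<dots> = (LINT x|sphere_measure. f x * 1) - (LINT x|sphere_measure. f x * indicator A x)"
          using fi[OF \<open>A \<in> sets borel\<close>] f by (intro Bochner_Integration.integral_diff) simp_all
        also have "\<dots> = 0" using z[of "\<lambda>x. 1"] A(2) by (simp only: continuous_on_const)
        finally show ?thesis .
      qed
      show "(LINT x|sphere_measure. f x * indicator (\<Union>i. A i) x) = 0"
        if A: "disjoint_family A" "range A \<subseteq> sigma_sets UNIV (Collect closed)"
          "\<And>i. (LINT x|sphere_measure. f x * indicator (A i) x) = 0" for A :: "nat \<Rightarrow> (real^'n) set"
      proof -
        have Ab: "A i \<in> sets borel" for i using A(2) sb by auto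
        have lim: "(\<lambda>m. LINT x|sphere_measure. f x * indicator (\<Union>i<m. A i) x)
            \<longlonglongrightarrow> (LINT x|sphere_measure. f x * indicator (\<Union>i. A i) x)"
        proof (rule integral_dominated_convergence[where w="\<lambda>x. \<bar>f x\<bar>"])
          have Ub: "(\<Union>i. A i) \<in> sets borel" "(\<Union>i<m. A i) \<in> sets borel" for m using Ab by auto
          show "(\<lambda>x. f x * indicator (\<Union>i. A i) x) \<in> borel_measurable sphere_measure" using fi[OF Ub(1)] by auto
          show "(\<lambda>x. f x * indicator (\<Union>i<m. A i) x) \<in> borel_measurable sphere_measure" for m using fi[OF Ub(2)] by auto
          show "AE x in sphere_measure. (\<lambda>m. f x * indicator (\<Union>i<m. A i) x) \<longlonglongrightarrow> f x * indicator (\<Union>i. A i) x"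
            by (intro AE_I2 tendsto_intros LIMSEQ_indicator_UN)
          show "AE x in sphere_measure. norm (f x * indicator (\<Union>i<m. A i) x) \<le> \<bar>f x\<bar>" for m
            by (intro AE_I2) (auto simp: indicator_def)
        qed (use f in auto)
        have zero: "(LINT x|sphere_measure. f x * indicator (\<Union>i<m. A i) x) = 0" for m
        proof -
          have dis: "indicator (\<Union>i<m. A i) x = (\<Sum>i<m. indicator (A i) x :: real)" for x
            using A(1) by (intro indicator_UN_disjoint) (auto simp: disjoint_family_on_def)
          have "(LINT x|sphere_measure. f x * indicator (\<Union>i<m. A i) x)
             = (LINT x|sphere_measure. (\<Sum>i<m. f x * indicator (A i) x))"
            unfolding dis by (simp only: sum_distrib_left)
          also have "\<dots> = (\<Sum>i<m. (LINT x|sphere_measure. f x * indicator (A i) x))"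
            using fi[OF Ab] by (intro Bochner_Integration.integral_sum) auto
          finally show ?thesis using A(3) by simp
        qed
        show ?thesis using lim unfolding zero by (simp add: LIMSEQ_const_iff)
      qed
    qed auto
  qed
  show ?thesis
  proof (rule density_unique_real[OF f])
    show "integrable sphere_measure (\<lambda>x::real^'n. 0::real)" by simp
    fix A :: "(real^'n) set" assume "A \<in> sets sphere_measure"
    then have "A \<in> sets borel" by (rule emeasure_sphere_measure(2))
    then show "(LINT x:A|sphere_measure. f x) = (LINT x:A|sphere_measure. 0)"
      using all by (simp add: set_lebesgue_integral_def mult.commute)
  qed
qed

lemma harmonic_proj_diff:
  assumes "integrable sphere_measure f" "integrable sphere_measure (g :: real^'n::finite \<Rightarrow> real)"
  shows "harmonic_proj l (\<lambda>x. f x - g x) x = harmonic_proj l f x - harmonic_proj l g x"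
proof -
  obtain E where E: "orthonormal_harmonics l (E :: (real^'n::finite \<Rightarrow> real) set)"
    "\<And>f x. integrable sphere_measure f \<Longrightarrow> harmonic_proj l f x = (\<Sum>e\<in>E. sphere_ip f e * e x)"
    by (rule harmonic_proj_expansion[where l=l and 'n='n]) (rule that)
  have ip: "sphere_ip (\<lambda>x. f x - g x) e = sphere_ip f e - sphere_ip g e" if "e \<in> E" for e
  proof -
    have pe: "real_polynomial_function e" using E(1) that solid_harmonics_poly by (auto simp: orthonormal_harmonics_def)
    show ?thesis
      unfolding sphere_ip_def left_diff_distrib
      by (rule Bochner_Integration.integral_diff) (use assms integrable_mult_polynomial[OF _ pe] in auto)
  qed
  show ?thesis
    unfolding E(2)[OF assms(1)] E(2)[OF assms(2)] E(2)[OF Bochner_Integration.integrable_diff[OF assms]]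
    by (simp add: ip left_diff_distrib sum_subtractf)
qed

text \<open>This makes the Sobolev norm independent of the choice of the Bessel image.\<close>

theorem AE_eq_of_harmonic_proj_eq:
  assumes d: "CARD('n::finite) \<ge> 2" and fg: "integrable sphere_measure f" "integrable sphere_measure (g :: real^'n::finite \<Rightarrow> real)"
    and eq: "\<And>l x. x \<in> sphere 0 1 \<Longrightarrow> harmonic_proj l f x = harmonic_proj l g x"
  shows "AE x in sphere_measure. f x = g x"
proof -
  have i: "integrable sphere_measure (\<lambda>x. f x - g x)" using fg by simp
  have "AE x in sphere_measure. f x - g x = 0"
  proof (rule AE_zero_of_integral_continuous_zero[OF i])
    fix h :: "real^'n \<Rightarrow> real" assume h: "continuous_on (sphere 0 1) h"
    show "(LINT x|sphere_measure. (f x - g x) * h x) = 0"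
      by (rule integral_continuous_zero_of_proj_zero[OF d i _ h]) (simp add: harmonic_proj_diff[OF fg] eq)
  qed
  then show ?thesis by simp
qed

section \<open>Maximum principle and resolvents\<close>

text \<open>Along each rotation through the minimum point the function has a minimum in one variable, so each
  of the second derivatives in the sum is nonnegative.\<close>

lemma spherical_laplacian_at_min:
  assumes U: "real_polynomial_function (U :: real^'n::finite \<Rightarrow> real)" and x0: "x0 \<in> sphere 0 1"
    and min: "\<And>x. x \<in> sphere 0 1 \<Longrightarrow> U x0 \<le> U x"
  shows "spherical_laplacian U x0 \<ge> 0"
proof -
  have "rotation_deriv i j (rotation_deriv i j U) x0 \<ge> 0" for i j
  proof (cases "i = j")
    case False
    let ?D = "rotation_deriv i j" and ?R = "plane_rotation i j"
    have d1: "((\<lambda>t. U (?R t x0)) has_real_derivative ?D U (?R t x0)) (at t)" for t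
      by (rule polynomial_along_rotation[OF U False])
    have d2: "((\<lambda>t. ?D U (?R t x0)) has_real_derivative ?D (?D U) (?R t x0)) (at t)" for t
      by (rule polynomial_along_rotation[OF polynomial_rotation_deriv[OF U] False])
    have minR: "U x0 \<le> U (?R t x0)" for t
      using min[of "?R t x0"] x0 by (simp add: norm_plane_rotation[OF False])
    have crit: "?D U x0 = 0"
      using DERIV_local_min[OF d1[of 0], of 1] minR by simp
    show ?thesis
    proof (rule ccontr)
      assume "\<not> ?thesis"
      then have "?D (?D U) (?R 0 x0) < 0" by simp
      from DERIV_neg_dec_right[OF d2[of 0] this] obtain e where
        e: "e > 0" "\<And>h. 0 < h \<Longrightarrow> h < e \<Longrightarrow> ?D U (?R h x0) < 0" by (auto simp: crit)
      obtain z where z: "0 < z" "z < e/2" "U (?R (e/2) x0) - U (?R 0 x0) = (e/2 - 0) * ?D U (?R z x0)"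
        using MVT2[of 0 "e/2" "\<lambda>t. U (?R t x0)" "\<lambda>t. ?D U (?R t x0)"] e(1) d1 by auto
      have "(e/2) * ?D U (?R z x0) < 0" using e(2)[of z] z e(1) by (intro mult_pos_neg) auto
      then show False using z(3) minR[of "e/2"] by simp
    qed
  qed simp
  then show ?thesis unfolding spherical_laplacian_def by (intro divide_nonneg_nonneg sum_nonneg) auto
qed

text \<open>The eigenvalues of \<open>A = 1 - \<Delta>\<close>. The argument fixes the dimension through the type.\<close>

definition bessel_eigenvalue :: "'n::finite itself \<Rightarrow> nat \<Rightarrow> real" where
  "bessel_eigenvalue _ l = 1 + lb_eigenvalue (CARD('n) - 1) l"

lemma bessel_eigenvalue_0 [simp]: "bessel_eigenvalue T 0 = 1"
  by (simp add: bessel_eigenvalue_def lb_eigenvalue_def)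

lemma bessel_eigenvalue_ge_1: "CARD('n::finite) \<ge> 2 \<Longrightarrow> bessel_eigenvalue TYPE('n) l \<ge> 1"
  using lb_eigenvalue_nonneg[of "CARD('n) - 1" l] by (simp add: bessel_eigenvalue_def)

text \<open>A function of the operator \<open>A = 1 - \<Delta>\<close>, truncated at degree \<open>n\<close>. On polynomials the truncation is
  harmless for large \<open>n\<close>, and no question of convergence arises.\<close>

definition multiplier :: "nat \<Rightarrow> (nat \<Rightarrow> real) \<Rightarrow> (real^'n::finite \<Rightarrow> real) \<Rightarrow> real^'n \<Rightarrow> real" where
  "multiplier n \<phi> f x = (\<Sum>l\<le>n. \<phi> l * harmonic_proj l f x)"

lemma polynomial_harmonic_proj:
  "real_polynomial_function (f :: real^'n::finite \<Rightarrow> real) \<Longrightarrow> real_polynomial_function (harmonic_proj l f)"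
  by (intro solid_harmonics_poly[OF harmonic_proj_solid_harmonic] integrable_polynomial_sphere)

lemma polynomial_multiplier:
  "real_polynomial_function (f :: real^'n::finite \<Rightarrow> real) \<Longrightarrow> real_polynomial_function (multiplier n \<phi> f)"
  unfolding multiplier_def
  by (intro real_polynomial_function_sum polynomial_mult polynomial_const polynomial_harmonic_proj) auto

lemma harmonic_proj_multiplier:
  assumes d: "CARD('n::finite) \<ge> 2" and f: "real_polynomial_function (f :: real^'n::finite \<Rightarrow> real)"
  shows "harmonic_proj l (multiplier n \<phi> f) = (\<lambda>x. if l \<le> n then \<phi> l * harmonic_proj l f x else 0)"
proof -
  have "harmonic_proj l (multiplier n \<phi> f) = (if l \<le> n then (\<lambda>x. \<phi> l * harmonic_proj l f x) else (\<lambda>x. 0))"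
    by (rule harmonic_proj_harmonic_sum[OF d])
      (auto simp: multiplier_def intro!: solid_harmonics_cmult harmonic_proj_solid_harmonic integrable_polynomial_sphere f)
  then show ?thesis by auto
qed

lemma spherical_laplacian_multiplier:
  assumes f: "real_polynomial_function (f :: real^'n::finite \<Rightarrow> real)"
  shows "spherical_laplacian (multiplier n \<phi> f) = multiplier n (\<lambda>l. - lb_eigenvalue (CARD('n) - 1) l * \<phi> l) f"
proof -
  have s: "harmonic_proj l f \<in> solid_harmonics l" for l
    by (intro harmonic_proj_solid_harmonic integrable_polynomial_sphere f)
  have "spherical_laplacian (\<lambda>x. \<Sum>l\<le>n. \<phi> l * harmonic_proj l f x)
     = (\<lambda>x. \<Sum>l\<le>n. spherical_laplacian (\<lambda>x. \<phi> l * harmonic_proj l f x) x)"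
    by (rule spherical_laplacian_sum) (auto intro!: polynomial_mult polynomial_harmonic_proj f)
  also have "\<dots> = (\<lambda>x. \<Sum>l\<le>n. - lb_eigenvalue (CARD('n) - 1) l * \<phi> l * harmonic_proj l f x)"
    by (simp add: spherical_laplacian_cmult[OF polynomial_harmonic_proj[OF f]] spherical_laplacian_solid_harmonic[OF s] mult_ac)
  finally show ?thesis by (simp add: multiplier_def[abs_def])
qed

lemma multiplier_sum:
  "multiplier n (\<lambda>l. \<Sum>j\<in>J. c j * \<phi> j l) f x = (\<Sum>j\<in>J. c j * multiplier n (\<phi> j) f x)"
  unfolding multiplier_def sum_distrib_right sum_distrib_left
  by (subst sum.swap) (simp only: mult.assoc)

lemma multiplier_diff:
  assumes f: "real_polynomial_function (f :: real^'n::finite \<Rightarrow> real)" and g: "real_polynomial_function g"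
  shows "multiplier n \<phi> (\<lambda>x. f x - g x) x = multiplier n \<phi> f x - multiplier n \<phi> g x"
  by (simp add: multiplier_def harmonic_proj_diff[OF integrable_polynomial_sphere[OF f] integrable_polynomial_sphere[OF g]]
      right_diff_distrib sum_subtractf)

lemma multiplier_const:
  assumes d: "CARD('n::finite) \<ge> 2"
  shows "multiplier n \<phi> (\<lambda>x::real^'n. c) x = \<phi> 0 * c"
  by (simp add: multiplier_def harmonic_proj_of_solid_harmonic[OF d solid_harmonics_const] if_distribR
    if_distrib[where f="\<lambda>u. _ * u"] cong: if_cong)

lemma integral_multiplier:
  assumes d: "CARD('n::finite) \<ge> 2" and f: "real_polynomial_function (f :: real^'n::finite \<Rightarrow> real)"
  shows "(LINT x|sphere_measure. multiplier n \<phi> f x) = \<phi> 0 * (LINT x|sphere_measure. f x)"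
proof -
  have i: "integrable sphere_measure (harmonic_proj l f)" for l
    by (intro integrable_polynomial_sphere polynomial_harmonic_proj f)
  have "(LINT x|sphere_measure. multiplier n \<phi> f x) = (\<Sum>l\<le>n. (LINT x|sphere_measure. \<phi> l * harmonic_proj l f x))"
    unfolding multiplier_def using i by (intro Bochner_Integration.integral_sum) auto
  also have "\<dots> = (\<Sum>l\<le>n. if l = 0 then \<phi> 0 * (LINT x|sphere_measure. f x) else 0)"
    using integral_eq_harmonic_proj_0[OF integrable_polynomial_sphere[OF f]]
      integral_harmonic_proj_pos[OF d integrable_polynomial_sphere[OF f]]
    by (intro sum.cong) auto
  finally show ?thesis by simp
qed

definition spectral_degree_le :: "nat \<Rightarrow> (real^'n::finite \<Rightarrow> real) \<Rightarrow> bool" where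
  "spectral_degree_le n f \<longleftrightarrow> real_polynomial_function f \<and> (\<forall>x\<in>sphere 0 1. f x = (\<Sum>l\<le>n. harmonic_proj l f x))"

lemma spectral_degree_leD:
  "spectral_degree_le n f \<Longrightarrow> real_polynomial_function f"
  "spectral_degree_le n f \<Longrightarrow> x \<in> sphere 0 1 \<Longrightarrow> multiplier n (\<lambda>l. 1) f x = f x"
  by (auto simp: spectral_degree_le_def multiplier_def)

lemma spectral_degree_le_multiplier:
  assumes "CARD('n::finite) \<ge> 2" "real_polynomial_function (f :: real^'n::finite \<Rightarrow> real)"
  shows "spectral_degree_le n (multiplier n \<phi> f)"
  using assms by (auto simp: spectral_degree_le_def polynomial_multiplier harmonic_proj_multiplier) (simp add: multiplier_def)

lemma spectral_degree_le_exists: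
  assumes d: "CARD('n::finite) \<ge> 2" and "real_polynomial_function (f :: real^'n::finite \<Rightarrow> real)"
  obtains n0 where "\<And>n. n \<ge> n0 \<Longrightarrow> spectral_degree_le n f"
proof -
  obtain n0 where "\<forall>n\<ge>n0. \<forall>x\<in>sphere 0 1. f x = (\<Sum>l\<le>n. harmonic_proj l f x)"
    using polynomial_eq_sum_harmonic_proj[OF assms] by (elim exE) (rule that)
  then show thesis using assms(2) by (intro that[of n0]) (simp add: spectral_degree_le_def)
qed

text \<open>The solution \<open>U\<close> of \<open>(t + 1) U - \<Delta>U = f\<close> takes its minimum over the sphere at some \<open>x0\<close>. There
  \<open>\<Delta>U \<ge> 0\<close>, so \<open>(t + 1) U(x0) \<ge> f(x0) \<ge> 0\<close>.\<close>

lemma resolvent_nonneg: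
  assumes d: "CARD('n::finite) \<ge> 2" and f: "spectral_degree_le n (f :: real^'n::finite \<Rightarrow> real)" and "t > 0"
    and nn: "\<And>x. x \<in> sphere 0 1 \<Longrightarrow> f x \<ge> 0" and x: "x \<in> sphere 0 1"
  shows "multiplier n (\<lambda>l. 1 / (t + bessel_eigenvalue TYPE('n) l)) f x \<ge> 0"
proof -
  let ?a = "bessel_eigenvalue TYPE('n)"
  define U where "U = multiplier n (\<lambda>l. 1 / (t + ?a l)) f"
  have pf: "real_polynomial_function f" using f by (rule spectral_degree_leD)
  have pU: "real_polynomial_function U" unfolding U_def by (rule polynomial_multiplier[OF pf])
  have "sphere 0 1 \<noteq> ({} :: (real^'n) set)" using x by blast
  then obtain x0 where x0: "x0 \<in> sphere 0 1" "\<And>x. x \<in> sphere 0 1 \<Longrightarrow> U x0 \<le> U x"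
    using continuous_attains_inf[OF compact_sphere _ continuous_on_polynomial[OF pU]] by blast
  have "(t + 1) * U x0 - spherical_laplacian U x0
      = (\<Sum>l\<le>n. ((t + 1) * (1 / (t + ?a l)) - (- lb_eigenvalue (CARD('n) - 1) l * (1 / (t + ?a l)))) * harmonic_proj l f x0)"
    unfolding U_def spherical_laplacian_multiplier[OF pf] multiplier_def
    by (simp only: left_diff_distrib sum_subtractf sum_distrib_left mult.assoc)
  also have "\<dots> = multiplier n (\<lambda>l. 1) f x0"
    unfolding multiplier_def
  proof (intro sum.cong refl arg_cong2[where f="(*)"])
    fix l
    have "t + ?a l > 0" using bessel_eigenvalue_ge_1[OF d, of l] \<open>t > 0\<close> by simp
    moreover have "(t + 1) * (1 / (t + ?a l)) - (- lb_eigenvalue (CARD('n) - 1) l * (1 / (t + ?a l)))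
       = (t + ?a l) / (t + ?a l)"
      by (simp add: bessel_eigenvalue_def add_divide_distrib[symmetric])
    ultimately show "(t + 1) * (1 / (t + ?a l)) - (- lb_eigenvalue (CARD('n) - 1) l * (1 / (t + ?a l))) = 1" by simp
  qed
  also have "\<dots> = f x0" by (rule spectral_degree_leD(2)[OF f x0(1)])
  finally have "(t + 1) * U x0 \<ge> 0" using nn[OF x0(1)] spherical_laplacian_at_min[OF pU x0] by linarith
  then have "U x0 \<ge> 0" using \<open>t > 0\<close> by (simp add: zero_le_mult_iff)
  then show ?thesis using x0(2)[OF x] unfolding U_def by linarith
qed

lemma resolvent_power_nonneg:
  assumes d: "CARD('n::finite) \<ge> 2" and f: "spectral_degree_le n (f :: real^'n::finite \<Rightarrow> real)" and "t > 0"
    and nn: "\<And>x. x \<in> sphere 0 1 \<Longrightarrow> f x \<ge> 0" and x: "x \<in> sphere 0 1"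
  shows "multiplier n (\<lambda>l. 1 / (t + bessel_eigenvalue TYPE('n) l) ^ j) f x \<ge> 0"
  using x
proof (induction j arbitrary: x)
  case 0
  then show ?case using spectral_degree_leD(2)[OF f] nn by simp
next
  case (Suc j)
  let ?a = "bessel_eigenvalue TYPE('n)"
  let ?U = "multiplier n (\<lambda>l. 1 / (t + ?a l) ^ j) f"
  have pf: "real_polynomial_function f" using f by (rule spectral_degree_leD)
  have "multiplier n (\<lambda>l. 1 / (t + ?a l)) ?U x = multiplier n (\<lambda>l. 1 / (t + ?a l) ^ Suc j) f x"
    unfolding multiplier_def[of n "\<lambda>l. 1 / (t + ?a l)"] harmonic_proj_multiplier[OF d pf]
    by (simp add: multiplier_def)
  moreover have "multiplier n (\<lambda>l. 1 / (t + ?a l)) ?U x \<ge> 0"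
    by (rule resolvent_nonneg[OF d spectral_degree_le_multiplier[OF d pf] \<open>t > 0\<close> Suc.IH Suc.prems])
  ultimately show ?case by simp
qed

lemma spectral_degree_le_diff:
  "spectral_degree_le n f \<Longrightarrow> spectral_degree_le n g \<Longrightarrow> spectral_degree_le n (\<lambda>x::real^'n::finite. f x - g x)"
  by (auto simp: spectral_degree_le_def harmonic_proj_diff integrable_polynomial_sphere sum_subtractf)

lemma spectral_degree_le_const:
  assumes d: "CARD('n::finite) \<ge> 2"
  shows "spectral_degree_le n (\<lambda>x::real^'n. c)"
  using multiplier_const[OF d, of n "\<lambda>l. 1" c]
  by (auto simp: spectral_degree_le_def multiplier_def)

text \<open>Apply positivity to \<open>h - f\<close> and \<open>h + f\<close>; the latter is written with \<open>0 - f\<close> so that one lemma on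
  differences serves for both.\<close>

lemma resolvent_power_abs_le:
  assumes d: "CARD('n::finite) \<ge> 2" and f: "spectral_degree_le n (f :: real^'n::finite \<Rightarrow> real)"
    and h: "spectral_degree_le n h" and "t > 0"
    and le: "\<And>x. x \<in> sphere 0 1 \<Longrightarrow> \<bar>f x\<bar> \<le> h x" and x: "x \<in> sphere 0 1"
  shows "\<bar>multiplier n (\<lambda>l. 1 / (t + bessel_eigenvalue TYPE('n) l) ^ j) f x\<bar>
     \<le> multiplier n (\<lambda>l. 1 / (t + bessel_eigenvalue TYPE('n) l) ^ j) h x"
proof -
  let ?m = "multiplier n (\<lambda>l. 1 / (t + bessel_eigenvalue TYPE('n) l) ^ j)"
  have pf: "real_polynomial_function f" "real_polynomial_function h" using f h spectral_degree_leD by auto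
  have f': "spectral_degree_le n (\<lambda>x. 0 - f x)" by (rule spectral_degree_le_diff[OF spectral_degree_le_const[OF d] f])
  have "?m (\<lambda>x. h x - f x) x \<ge> 0"
    using le by (intro resolvent_power_nonneg[OF d spectral_degree_le_diff[OF h f] \<open>t > 0\<close> _ x]) fastforce
  moreover have "?m (\<lambda>x. h x - (0 - f x)) x \<ge> 0"
    using le by (intro resolvent_power_nonneg[OF d spectral_degree_le_diff[OF h f'] \<open>t > 0\<close> _ x]) fastforce
  ultimately show ?thesis
    using pf by (simp only: multiplier_diff polynomial_const real_polynomial_function_diff multiplier_const[OF d])
qed

text \<open>Apply positivity to \<open>B - h\<close>. On constants the operator \<open>A\<close> is the identity, which gives the factor.\<close>

lemma resolvent_power_le_sup:
  assumes d: "CARD('n::finite) \<ge> 2" and h: "spectral_degree_le n (h :: real^'n::finite \<Rightarrow> real)" and "t > 0"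
    and le: "\<And>x. x \<in> sphere 0 1 \<Longrightarrow> h x \<le> B" and x: "x \<in> sphere 0 1"
  shows "multiplier n (\<lambda>l. 1 / (t + bessel_eigenvalue TYPE('n) l) ^ j) h x \<le> B / (t + 1) ^ j"
proof -
  have ph: "real_polynomial_function h" using h spectral_degree_leD by auto
  have "multiplier n (\<lambda>l. 1 / (t + bessel_eigenvalue TYPE('n) l) ^ j) (\<lambda>x. B - h x) x \<ge> 0"
    using le by (intro resolvent_power_nonneg[OF d spectral_degree_le_diff[OF spectral_degree_le_const[OF d] h] \<open>t > 0\<close> _ x]) fastforce
  then show ?thesis
    by (simp add: multiplier_diff[OF polynomial_const ph] multiplier_const[OF d])
qed

text \<open>Two estimates for \<open>(A/(t + A))^k F\<close>, where \<open>G = A^k F\<close>. The first expands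
  \<open>A/(t + A) = 1 - t/(t + A)\<close> by the binomial theorem and is good for small \<open>t\<close>. The second writes the
  function as \<open>1/(t + A)^k\<close> applied to \<open>G\<close> and is good for large \<open>t\<close>.\<close>

lemma resolvent_iterate_majorant:
  fixes F G H :: "real^'n::finite \<Rightarrow> real"
  assumes d: "CARD('n) \<ge> 2" and F: "spectral_degree_le n F" and G: "spectral_degree_le n G" and H: "spectral_degree_le n H"
    and FH: "\<And>x. x \<in> sphere 0 1 \<Longrightarrow> \<bar>F x\<bar> \<le> H x"
    and GH: "\<And>x. x \<in> sphere 0 1 \<Longrightarrow> \<bar>G x\<bar> \<le> K * H x"
    and GF: "\<And>l x. x \<in> sphere 0 1 \<Longrightarrow> harmonic_proj l G x = bessel_eigenvalue TYPE('n) l ^ k * harmonic_proj l F x"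
    and "t > 0" "K > 0" and x: "x \<in> sphere 0 1"
  defines "a \<equiv> bessel_eigenvalue TYPE('n)"
  shows "\<bar>multiplier n (\<lambda>l. (a l / (t + a l)) ^ k) F x\<bar>
      \<le> multiplier n (\<lambda>l. \<Sum>j\<le>k. real (k choose j) * t ^ j * (1 / (t + a l) ^ j)) H x"
    and "\<bar>multiplier n (\<lambda>l. (a l / (t + a l)) ^ k) F x\<bar>
      \<le> K * multiplier n (\<lambda>l. 1 / (t + a l) ^ k) H x"
proof -
  let ?m = "\<lambda>j. multiplier n (\<lambda>l. 1 / (t + a l) ^ j)"
  have pos: "t + a l > 0" for l using bessel_eigenvalue_ge_1[OF d, of l] \<open>t > 0\<close> by (simp add: a_def)
  have expand: "(a l / (t + a l)) ^ k = (\<Sum>j\<le>k. real (k choose j) * (- t) ^ j * (1 / (t + a l) ^ j))" for l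
  proof -
    have "a l / (t + a l) = (- t / (t + a l)) + 1" using pos[of l] by (simp add: field_simps)
    then have "(a l / (t + a l)) ^ k = ((- t / (t + a l)) + 1) ^ k" by simp
    also have "\<dots> = (\<Sum>j\<le>k. real (k choose j) * (- t / (t + a l)) ^ j * 1 ^ (k - j))"
      by (rule binomial_ring)
    also have "\<dots> = (\<Sum>j\<le>k. real (k choose j) * (- t) ^ j * (1 / (t + a l) ^ j))"
      by (intro sum.cong refl) (simp only: power_divide power_one mult_1_right times_divide_eq_right)
    finally show ?thesis .
  qed
  have "\<bar>multiplier n (\<lambda>l. (a l / (t + a l)) ^ k) F x\<bar> = \<bar>\<Sum>j\<le>k. real (k choose j) * (- t) ^ j * ?m j F x\<bar>"
    unfolding expand multiplier_sum ..
  also have "\<dots> \<le> (\<Sum>j\<le>k. \<bar>real (k choose j) * (- t) ^ j * ?m j F x\<bar>)" by (rule sum_abs)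
  also have "\<dots> = (\<Sum>j\<le>k. real (k choose j) * t ^ j * \<bar>?m j F x\<bar>)"
    using \<open>t > 0\<close> by (simp add: abs_mult power_abs)
  also have "\<dots> \<le> (\<Sum>j\<le>k. real (k choose j) * t ^ j * ?m j H x)"
    using resolvent_power_abs_le[OF d F H \<open>t > 0\<close> FH x] \<open>t > 0\<close>
    by (intro sum_mono mult_left_mono) (auto simp: a_def)
  finally show "\<bar>multiplier n (\<lambda>l. (a l / (t + a l)) ^ k) F x\<bar>
      \<le> multiplier n (\<lambda>l. \<Sum>j\<le>k. real (k choose j) * t ^ j * (1 / (t + a l) ^ j)) H x"
    unfolding multiplier_sum .
  \<comment> \<open>for the second bound move \<open>A^k\<close> onto \<open>F\<close>, which turns it into \<open>G\<close>\<close>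
  have KH: "spectral_degree_le n (\<lambda>x. K * H x)"
  proof -
    have "harmonic_proj l (\<lambda>x. K * H x) y = K * harmonic_proj l H y" for l y
      unfolding harmonic_proj_def by (simp add: mult.assoc)
    then show ?thesis using H by (auto simp: spectral_degree_le_def sum_distrib_left[symmetric] polynomial_mult)
  qed
  have "multiplier n (\<lambda>l. (a l / (t + a l)) ^ k) F x = ?m k G x"
    unfolding multiplier_def using GF[OF x] by (intro sum.cong refl) (simp add: a_def power_divide)
  also have "\<bar>\<dots>\<bar> \<le> ?m k (\<lambda>x. K * H x) x"
    unfolding a_def by (rule resolvent_power_abs_le[OF d G KH \<open>t > 0\<close> GH x])
  also have "?m k (\<lambda>x. K * H x) x = K * ?m k H x"
  proof -
    have "harmonic_proj l (\<lambda>x. K * H x) y = K * harmonic_proj l H y" for l y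
      unfolding harmonic_proj_def by (simp add: mult.assoc)
    then show ?thesis by (simp add: multiplier_def sum_distrib_left mult_ac)
  qed
  finally show "\<bar>multiplier n (\<lambda>l. (a l / (t + a l)) ^ k) F x\<bar> \<le> K * ?m k H x" .
qed

section \<open>Fractional powers\<close>

text \<open>The integrand is \<open>x^(\<sigma>-1)\<close> on \<open>(0, 1]\<close> and \<open>x^(\<sigma>-1-k)\<close> on \<open>[1, \<infinity>)\<close>.\<close>

lemma powr_kernel_integrable:
  fixes \<sigma> :: real
  assumes "0 < \<sigma>" "\<sigma> < real k"
  shows "integrable lborel (\<lambda>x. indicator {0<..} x * (x powr (\<sigma> - 1) * min 1 ((1 / x) ^ k)))"
proof -
  let ?f = "\<lambda>x::real. indicator {0<..1} x * x powr (\<sigma> - 1)"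
  let ?g = "\<lambda>x::real. indicator {1..} x * x powr (\<sigma> - 1 - real k)"
  have f: "integrable lborel ?f"
  proof -
    have "(\<lambda>x::real. x powr (\<sigma> - 1)) absolutely_integrable_on {0..1}"
      using assms by (intro nonnegative_absolutely_integrable_1 integrable_on_powr_from_0) auto
    then have "integrable lborel (\<lambda>x. indicator {0..1} x * x powr (\<sigma> - 1))"
      unfolding set_integrable_def by (simp add: integrable_completion)
    then show ?thesis
      by (rule Bochner_Integration.integrable_bound) (auto simp: indicator_def)
  qed
  have g: "integrable lborel ?g"
  proof -
    have "(\<lambda>x::real. x powr (\<sigma> - 1 - real k)) integrable_on {1..}"
      using has_integral_powr_to_inf[of "\<sigma> - 1 - real k" 1] assms unfolding integrable_on_def by auto
    then have "(\<lambda>x::real. x powr (\<sigma> - 1 - real k)) absolutely_integrable_on {1..}"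
      by (rule nonnegative_absolutely_integrable_1) auto
    then show ?thesis
      unfolding set_integrable_def by (simp add: integrable_completion)
  qed
  show ?thesis
  proof (rule Bochner_Integration.integrable_bound[OF Bochner_Integration.integrable_add[OF f g]])
    show "AE x in lborel. norm (indicator {0<..} x * (x powr (\<sigma> - 1) * min 1 ((1 / x) ^ k))) \<le> norm (?f x + ?g x)"
    proof (rule AE_I2)
      fix x :: real
      consider "x \<le> 0" | "0 < x" "x \<le> 1" | "1 < x" by linarith
      then show "norm (indicator {0<..} x * (x powr (\<sigma> - 1) * min 1 ((1 / x) ^ k))) \<le> norm (?f x + ?g x)"
      proof cases
        case 2
        have "norm (x powr (\<sigma> - 1) * min 1 ((1 / x) ^ k)) \<le> x powr (\<sigma> - 1) * 1"
          using 2 by (simp add: abs_mult)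
        also have "\<dots> \<le> norm (?f x + ?g x)" using 2 by (simp add: indicator_def)
        finally show ?thesis using 2 by simp
      next
        case 3
        have "norm (x powr (\<sigma> - 1) * min 1 ((1 / x) ^ k)) \<le> x powr (\<sigma> - 1) * (1/x)^k"
          using 3 by (simp add: abs_mult) 
        also have "\<dots> = x powr (\<sigma> - 1 - real k)"
          using 3 by (simp add: powr_diff powr_realpow power_divide)
        also have "\<dots> \<le> norm (?f x + ?g x)" using 3 by (simp add: indicator_def)
        finally show ?thesis using 3 by simp
      qed simp
    qed
  qed measurable
qed

text \<open>By the substitution \<open>t = a x\<close> the integral of \<open>t^(\<sigma>-1) (a/(t + a))^k\<close> over \<open>t > 0\<close> is \<open>a^\<sigma>\<close> times a
  positive constant. Hence the sum on the left is, up to that constant, the integral of the sums in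
  the hypothesis against \<open>t^(\<sigma>-1)\<close>. Inserting their bound and substituting \<open>t = M x\<close> produces \<open>M^\<sigma>\<close>.
  Think of the \<open>a l\<close> as eigenvalues and of the \<open>c l\<close> as a linear functional of the components of a
  function.\<close>

lemma fractional_power_bound:
  fixes \<sigma> :: real
  assumes \<sigma>: "0 < \<sigma>" "\<sigma> < real k"
  shows "\<exists>C>0. \<forall>(n::nat) a c B M. (\<forall>l\<le>n. a l > 0) \<longrightarrow> B \<ge> 0 \<longrightarrow> M > 0 \<longrightarrow>
     (\<forall>t>0. \<bar>\<Sum>l\<le>n. (a l / (t + a l)) ^ k * c l\<bar> \<le> B * min 1 ((M / t) ^ k)) \<longrightarrow>
     \<bar>\<Sum>l\<le>n. a l powr \<sigma> * c l\<bar> \<le> C * B * M powr \<sigma>"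
proof -
  define \<phi> where "\<phi> = (\<lambda>a x::real. indicator {0<..} x * (x powr (\<sigma> - 1) * (a / (x + a)) ^ k))"
  define \<psi> where "\<psi> = (\<lambda>M x::real. indicator {0<..} x * (x powr (\<sigma> - 1) * min 1 ((M / x) ^ k)))"
  define J where "J = (LINT x|lborel. \<phi> 1 x)"
  define J' where "J' = (LINT x|lborel. \<psi> 1 x)"
  have i\<psi>: "integrable lborel (\<psi> 1)" unfolding \<psi>_def by (rule powr_kernel_integrable[OF \<sigma>])
  have i\<phi>: "integrable lborel (\<phi> 1)"
  proof (rule Bochner_Integration.integrable_bound[OF i\<psi>])
    show "\<phi> 1 \<in> borel_measurable lborel" unfolding \<phi>_def by measurable
    show "AE x in lborel. norm (\<phi> 1 x) \<le> norm (\<psi> 1 x)"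
    proof (rule AE_I2)
      fix x :: real
      show "norm (\<phi> 1 x) \<le> norm (\<psi> 1 x)"
      proof (cases "x > 0")
        case True
        have "(1 / (x + 1)) ^ k \<le> 1" using True by (intro power_le_one) auto
        moreover have "(1 / (x + 1)) ^ k \<le> (1 / x) ^ k" using True by (intro power_mono) (auto simp: field_simps)
        ultimately have "x powr (\<sigma> - 1) * (1 / (x + 1)) ^ k \<le> x powr (\<sigma> - 1) * min 1 ((1 / x) ^ k)"
          by (intro mult_left_mono) auto
        moreover have "0 \<le> x powr (\<sigma> - 1) * (1 / (x + 1)) ^ k" using True by (intro mult_nonneg_nonneg) auto
        ultimately show ?thesis using True by (simp add: \<phi>_def \<psi>_def)
      qed (simp add: \<phi>_def)
    qed
  qed
  have scale\<phi>: "\<phi> a (a * x) = a powr (\<sigma> - 1) * \<phi> 1 x" if "a > 0" for a x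
  proof -
    have "a / (a * (x + 1)) = 1 / (x + 1)" using that by (simp only: divide_divide_eq_left[symmetric]) simp
    then have "a / (a * x + a) = 1 / (x + 1)" by (simp only: distrib_left mult_1_right)
    then show ?thesis using that by (auto simp: \<phi>_def indicator_def zero_less_mult_iff powr_mult)
  qed
  have scale\<psi>: "\<psi> a (a * x) = a powr (\<sigma> - 1) * \<psi> 1 x" if "a > 0" for a x
    using that by (auto simp: \<psi>_def indicator_def zero_less_mult_iff powr_mult)
  have pw: "a * a powr (\<sigma> - 1) = a powr \<sigma>" if "a > 0" for a :: real
    using that by (simp add: powr_diff)
  have I\<phi>: "integrable lborel (\<phi> a)" "(LINT x|lborel. \<phi> a x) = a powr \<sigma> * J" if a: "a > 0" for a
  proof -
    have "integrable lborel (\<lambda>x. \<phi> a (0 + a * x))" using i\<phi> scale\<phi>[OF a] by simp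
    then show "integrable lborel (\<phi> a)" using lborel_integrable_real_affine_iff[of a "\<phi> a" 0] a by simp
    show "(LINT x|lborel. \<phi> a x) = a powr \<sigma> * J"
      using lborel_integral_real_affine[of a "\<phi> a" 0] a scale\<phi>[OF a] by (simp add: J_def pw[symmetric])
  qed
  have I\<psi>: "integrable lborel (\<psi> a)" "(LINT x|lborel. \<psi> a x) = a powr \<sigma> * J'" if a: "a > 0" for a
  proof -
    have "integrable lborel (\<lambda>x. \<psi> a (0 + a * x))" using i\<psi> scale\<psi>[OF a] by simp
    then show "integrable lborel (\<psi> a)" using lborel_integrable_real_affine_iff[of a "\<psi> a" 0] a by simp
    show "(LINT x|lborel. \<psi> a x) = a powr \<sigma> * J'"
      using lborel_integral_real_affine[of a "\<psi> a" 0] a scale\<psi>[OF a] by (simp add: J'_def pw[symmetric])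
  qed
  have Jpos: "J > 0"
  proof -
    have "(LINT x|lborel. indicator {1..2::real} x * ((1/2) * (1/3) ^ k)) \<le> J"
      unfolding J_def
    proof (rule Bochner_Integration.integral_mono)
      fix x :: real
      show "indicator {1..2::real} x * ((1/2) * (1/3) ^ k) \<le> \<phi> 1 x"
      proof (cases "x \<in> {1..2}")
        case True
        have "1 / 2 \<le> x powr (- 1)" using True by (simp add: powr_minus field_simps)
        also have "\<dots> \<le> x powr (\<sigma> - 1)" using True \<sigma> by (intro powr_mono) auto
        finally have "(1/2) * (1/3) ^ k \<le> x powr (\<sigma> - 1) * (1 / (x + 1)) ^ k"
          using True by (intro mult_mono power_mono) (auto simp: field_simps)
        then show ?thesis using True by (simp add: \<phi>_def)
      next
        case False
        then show ?thesis by (auto simp: \<phi>_def indicator_def)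
      qed
    qed (use i\<phi> in auto)
    moreover have "(LINT x|lborel. indicator {1..2::real} x * ((1/2) * (1/3) ^ k)) = (1/2) * (1/3 :: real) ^ k" by simp
    ultimately show ?thesis by (smt (verit) zero_less_power divide_pos_pos mult_pos_pos)
  qed
  have J'nn: "J' \<ge> 0" unfolding J'_def \<psi>_def by (intro integral_nonneg_AE AE_I2) (auto simp: indicator_def)
  show ?thesis
  proof (intro exI[of _ "(J' + 1) / J"] conjI allI impI)
    show "(J' + 1) / J > 0" using Jpos J'nn by simp
    fix n :: nat and a c :: "nat \<Rightarrow> real" and B M :: real
    assume a: "\<forall>l\<le>n. a l > 0" and B: "B \<ge> 0" and M: "M > 0"
      and le: "\<forall>t>0. \<bar>\<Sum>l\<le>n. (a l / (t + a l)) ^ k * c l\<bar> \<le> B * min 1 ((M / t) ^ k)"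
    have "J * (\<Sum>l\<le>n. a l powr \<sigma> * c l) = (\<Sum>l\<le>n. (LINT x|lborel. \<phi> (a l) x) * c l)"
      using a I\<phi>(2) by (simp add: sum_distrib_left mult_ac)
    also have "\<dots> = (LINT x|lborel. (\<Sum>l\<le>n. \<phi> (a l) x * c l))"
      using a I\<phi>(1) by (subst Bochner_Integration.integral_sum) auto
    finally have eq: "J * (\<Sum>l\<le>n. a l powr \<sigma> * c l) = (LINT x|lborel. (\<Sum>l\<le>n. \<phi> (a l) x * c l))" .
    have "\<bar>LINT x|lborel. (\<Sum>l\<le>n. \<phi> (a l) x * c l)\<bar> \<le> (LINT x|lborel. \<bar>\<Sum>l\<le>n. \<phi> (a l) x * c l\<bar>)"
      by (rule integral_abs_bound)
    also have "\<dots> \<le> (LINT x|lborel. B * \<psi> M x)"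
    proof (rule Bochner_Integration.integral_mono)
      fix x :: real
      show "\<bar>\<Sum>l\<le>n. \<phi> (a l) x * c l\<bar> \<le> B * \<psi> M x"
      proof (cases "x > 0")
        case True
        have "(\<Sum>l\<le>n. \<phi> (a l) x * c l) = x powr (\<sigma> - 1) * (\<Sum>l\<le>n. (a l / (x + a l)) ^ k * c l)"
          using True by (simp add: \<phi>_def sum_distrib_left mult_ac)
        also have "\<bar>\<dots>\<bar> = x powr (\<sigma> - 1) * \<bar>\<Sum>l\<le>n. (a l / (x + a l)) ^ k * c l\<bar>" by (simp add: abs_mult)
        also have "\<dots> \<le> x powr (\<sigma> - 1) * (B * min 1 ((M / x) ^ k))" using le True by (intro mult_left_mono) auto
        also have "\<dots> = B * \<psi> M x" using True by (simp add: \<psi>_def)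
        finally show ?thesis .
      qed (simp add: \<phi>_def \<psi>_def)
    qed (use a I\<phi>(1) I\<psi>(1)[OF M] in \<open>auto intro!: integrable_abs Bochner_Integration.integrable_sum\<close>)
    also have "\<dots> = B * (M powr \<sigma> * J')" using I\<psi>(2)[OF M] by simp
    also have "\<dots> \<le> B * (M powr \<sigma> * (J' + 1))" using B by (intro mult_left_mono) auto
    finally have "J * \<bar>\<Sum>l\<le>n. a l powr \<sigma> * c l\<bar> \<le> B * (M powr \<sigma> * (J' + 1))"
      using Jpos by (simp add: eq[symmetric] abs_mult)
    then show "\<bar>\<Sum>l\<le>n. a l powr \<sigma> * c l\<bar> \<le> (J' + 1) / J * B * M powr \<sigma>"
      using Jpos by (simp add: field_simps)
  qed
qed

text \<open>The scalar bound is applied to two linear functionals: evaluation at a point, which gives the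
  supremum norm, and the integral against the sign of \<open>g\<close>, which gives the norm in \<open>L_1\<close>. Integrals of
  resolvents of \<open>H\<close> are explicit because only the component of degree \<open>0\<close> contributes.\<close>

lemma fractional_estimate:
  fixes \<sigma> :: real
  assumes d: "CARD('n::finite) \<ge> 2" and \<sigma>: "0 < \<sigma>" "\<sigma> < real k"
  shows "\<exists>C>0. \<forall>n (F :: real^'n \<Rightarrow> real) G H B M. spectral_degree_le n F \<longrightarrow> spectral_degree_le n G \<longrightarrow> spectral_degree_le n H \<longrightarrow> M > 0 \<longrightarrow>
     (\<forall>x\<in>sphere 0 1. \<bar>F x\<bar> \<le> H x \<and> \<bar>G x\<bar> \<le> M ^ k * H x \<and> H x \<le> B \<and>
        (\<forall>l. harmonic_proj l G x = bessel_eigenvalue TYPE('n) l ^ k * harmonic_proj l F x)) \<longrightarrow>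
     (let g = multiplier n (\<lambda>l. bessel_eigenvalue TYPE('n) l powr \<sigma>) F in
       (\<forall>x\<in>sphere 0 1. \<bar>g x\<bar> \<le> C * B * M powr \<sigma>) \<and>
       (LINT x|sphere_measure. \<bar>g x\<bar>) \<le> C * (LINT x|sphere_measure. H x) * M powr \<sigma>)"
proof -
  define a where "a = bessel_eigenvalue TYPE('n)"
  have a1: "a l \<ge> 1" for l using bessel_eigenvalue_ge_1[OF d] by (simp add: a_def)
  then have a0: "a l > 0" for l using less_le_trans[OF zero_less_one] by blast
  obtain C where C: "C > 0" "\<And>(n::nat) a c B M. (\<forall>l\<le>n. a l > 0) \<Longrightarrow> B \<ge> 0 \<Longrightarrow> M > 0 \<Longrightarrow>
     (\<forall>t>0. \<bar>\<Sum>l\<le>n. (a l / (t + a l)) ^ k * c l\<bar> \<le> B * min 1 ((M / t) ^ k)) \<Longrightarrow>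
     \<bar>\<Sum>l\<le>n. a l powr \<sigma> * c l\<bar> \<le> C * B * M powr \<sigma>"
    using fractional_power_bound[OF \<sigma>] by auto
  show ?thesis
  proof (intro exI[of _ "C * 2 ^ k"] conjI allI impI)
    show "C * 2 ^ k > 0" using C(1) by simp
    fix n and F G H :: "real^'n \<Rightarrow> real" and B M :: real
    assume F: "spectral_degree_le n F" and G: "spectral_degree_le n G" and H: "spectral_degree_le n H" and M: "M > 0"
      and all: "\<forall>x\<in>sphere 0 1. \<bar>F x\<bar> \<le> H x \<and> \<bar>G x\<bar> \<le> M ^ k * H x \<and> H x \<le> B \<and>
        (\<forall>l. harmonic_proj l G x = bessel_eigenvalue TYPE('n) l ^ k * harmonic_proj l F x)"
    define g where "g = multiplier n (\<lambda>l. a l powr \<sigma>) F"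
    have pF: "real_polynomial_function F" and pH: "real_polynomial_function H"
      using F H spectral_degree_leD by auto
    have pg: "real_polynomial_function g" unfolding g_def by (rule polynomial_multiplier[OF pF])
    have Hnn: "H x \<ge> 0" if "x \<in> sphere 0 1" for x using all that by fastforce
    let ?T = "\<lambda>t. multiplier n (\<lambda>l. (a l / (t + a l)) ^ k) F"
    let ?P = "\<lambda>t. multiplier n (\<lambda>l. \<Sum>j\<le>k. real (k choose j) * t ^ j * (1 / (t + a l) ^ j)) H"
    let ?Q = "\<lambda>t. multiplier n (\<lambda>l. 1 / (t + a l) ^ k) H"
    have maj: "\<bar>?T t x\<bar> \<le> ?P t x" "\<bar>?T t x\<bar> \<le> M ^ k * ?Q t x" if "t > 0" "x \<in> sphere 0 1" for t x
      unfolding a_def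
      by (rule resolvent_iterate_majorant[OF d F G H, where K="M ^ k"]; use all M that in simp)+
    \<comment> \<open>replace the operator \<open>1 / (t + A)\<close> by the number \<open>1 / (t + 1)\<close>\<close>
    have ratio: "t ^ j / (t + 1) ^ j \<le> 1" if "t > 0" for t :: real and j
    proof -
      have "(t / (t + 1)) ^ j \<le> 1" using that by (intro power_le_one) auto
      then show ?thesis by (simp add: power_divide)
    qed
    have kb: "1 / (t + 1) ^ k \<le> 1 / t ^ k" if "t > 0" for t :: real
      using that by (intro divide_left_mono power_mono mult_pos_pos) auto
    have two: "(\<Sum>j\<le>k. real (k choose j)) = 2 ^ k" using choose_row_sum[of k] by (metis of_nat_numeral of_nat_power of_nat_sum)
    have bin: "(\<Sum>j\<le>k. real (k choose j) * t ^ j * (b * (1 / (t + 1) ^ j))) \<le> 2 ^ k * b" if "t > 0" "b \<ge> 0" for t b :: real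
    proof -
      have "(\<Sum>j\<le>k. real (k choose j) * t ^ j * (b * (1 / (t + 1) ^ j))) = (\<Sum>j\<le>k. (real (k choose j) * b) * (t ^ j / (t + 1) ^ j))"
        by (intro sum.cong refl) simp
      also have "\<dots> \<le> (\<Sum>j\<le>k. (real (k choose j) * b) * 1)"
        using ratio[OF that(1)] that(2) by (intro sum_mono mult_left_mono) auto
      finally show ?thesis by (simp add: sum_distrib_right[symmetric] two)
    qed
    have conv: "v \<le> b * min 1 ((M / t) ^ k)" if "v \<le> b" "v \<le> M ^ k * (b' * (1 / (t + 1) ^ k))" "b' \<le> b" "0 \<le> b'" "t > 0" for v b b' t :: real
    proof -
      have "M ^ k * (b' * (1 / (t + 1) ^ k)) \<le> M ^ k * (b * (1 / t ^ k))"
        using that M kb[OF that(5)] by (intro mult_left_mono mult_mono) auto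
      then have "v \<le> M ^ k * (b * (1 / t ^ k))" using that(2) by linarith
      then have "v \<le> b * (M / t) ^ k" by (simp add: power_divide mult.commute)
      then show ?thesis using that(1) by (simp add: min_def)
    qed
    have one_le: "b \<le> 2 ^ k * b" if "b \<ge> 0" for b :: real using that mult_right_mono[of 1 "2 ^ k" b] by simp
    have sup: "\<bar>g x\<bar> \<le> C * (2 ^ k * B) * M powr \<sigma>" if x: "x \<in> sphere 0 1" for x
      unfolding g_def multiplier_def
    proof (rule C(2))
      have Bnn: "B \<ge> 0" using Hnn[OF x] all x by fastforce
      then show "2 ^ k * B \<ge> 0" by simp
      show "\<forall>t>0. \<bar>\<Sum>l\<le>n. (a l / (t + a l)) ^ k * harmonic_proj l F x\<bar> \<le> 2 ^ k * B * min 1 ((M / t) ^ k)"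
      proof (intro allI impI)
        fix t :: real assume t: "t > 0"
        have le: "multiplier n (\<lambda>l. 1 / (t + a l) ^ j) H x \<le> B * (1 / (t + 1) ^ j)" for j
          using resolvent_power_le_sup[OF d H t _ x, of B j] all by (simp add: a_def)
        have "?P t x \<le> (\<Sum>j\<le>k. real (k choose j) * t ^ j * (B * (1 / (t + 1) ^ j)))"
          unfolding multiplier_sum using le t by (intro sum_mono mult_left_mono) auto
        then have 1: "\<bar>?T t x\<bar> \<le> 2 ^ k * B" using maj(1)[OF t x] bin[OF t Bnn] by linarith
        have "M ^ k * ?Q t x \<le> M ^ k * (B * (1 / (t + 1) ^ k))" using le M by (intro mult_left_mono) auto
        then have 2: "\<bar>?T t x\<bar> \<le> M ^ k * (B * (1 / (t + 1) ^ k))" using maj(2)[OF t x] by linarith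
        show "\<bar>\<Sum>l\<le>n. (a l / (t + a l)) ^ k * harmonic_proj l F x\<bar> \<le> 2 ^ k * B * min 1 ((M / t) ^ k)"
          using conv[OF 1 2 one_le[OF Bnn] Bnn t] by (simp add: multiplier_def)
      qed
    qed (use a0 M in auto)
    let ?I = "LINT x|sphere_measure. H x"
    have Inn: "?I \<ge> 0" using Hnn by (intro integral_nonneg_AE AE_I2) simp
    \<comment> \<open>the functional that returns the norm of \<open>g\<close> in \<open>L_1\<close> when applied to \<open>g\<close>\<close>
    define sg where "sg = (\<lambda>x. sgn (g x))"
    have gm: "g \<in> borel_measurable sphere_measure" using integrable_polynomial_sphere[OF pg] by auto
    have sgm: "sg \<in> borel_measurable sphere_measure" unfolding sg_def using gm by measurable
    have ips: "integrable sphere_measure (\<lambda>x. p x * sg x)" if p: "real_polynomial_function p" for p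
    proof (rule Bochner_Integration.integrable_bound[OF integrable_polynomial_sphere[OF p]])
      show "(\<lambda>x. p x * sg x) \<in> borel_measurable sphere_measure"
        using integrable_polynomial_sphere[OF p] sgm by (intro borel_measurable_times) auto
      show "AE x in sphere_measure. norm (p x * sg x) \<le> norm (p x)"
        by (intro AE_I2) (auto simp: sg_def sgn_real_def)
    qed
    define c where "c = (\<lambda>l. (LINT x|sphere_measure. harmonic_proj l F x * sg x))"
    have msum: "(LINT x|sphere_measure. multiplier n \<phi> F x * sg x) = (\<Sum>l\<le>n. \<phi> l * c l)" for \<phi>
    proof -
      have "(LINT x|sphere_measure. multiplier n \<phi> F x * sg x)
          = (LINT x|sphere_measure. (\<Sum>l\<le>n. \<phi> l * (harmonic_proj l F x * sg x)))"
        unfolding multiplier_def sum_distrib_right by (simp only: mult.assoc)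
      also have "\<dots> = (\<Sum>l\<le>n. (LINT x|sphere_measure. \<phi> l * (harmonic_proj l F x * sg x)))"
        using ips[OF polynomial_harmonic_proj[OF pF]] by (intro Bochner_Integration.integral_sum) auto
      finally show ?thesis by (simp add: c_def)
    qed
    have "\<bar>\<Sum>l\<le>n. a l powr \<sigma> * c l\<bar> \<le> C * (2 ^ k * ?I) * M powr \<sigma>"
    proof (rule C(2))
      show "2 ^ k * ?I \<ge> 0" using Inn by simp
      show "\<forall>t>0. \<bar>\<Sum>l\<le>n. (a l / (t + a l)) ^ k * c l\<bar> \<le> 2 ^ k * ?I * min 1 ((M / t) ^ k)"
      proof (intro allI impI)
        fix t :: real assume t: "t > 0"
        have iT: "integrable sphere_measure (?T t)" "integrable sphere_measure (?P t)" "integrable sphere_measure (?Q t)"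
          by (intro integrable_polynomial_sphere polynomial_multiplier pF pH)+
        have "\<bar>\<Sum>l\<le>n. (a l / (t + a l)) ^ k * c l\<bar> = \<bar>LINT x|sphere_measure. ?T t x * sg x\<bar>" by (simp only: msum)
        also have "\<dots> \<le> (LINT x|sphere_measure. \<bar>?T t x * sg x\<bar>)" by (rule integral_abs_bound)
        also have "\<dots> \<le> (LINT x|sphere_measure. \<bar>?T t x\<bar>)"
          using ips[OF polynomial_multiplier[OF pF]] iT(1)
          by (intro Bochner_Integration.integral_mono) (auto simp: sg_def sgn_real_def)
        finally have le: "\<bar>\<Sum>l\<le>n. (a l / (t + a l)) ^ k * c l\<bar> \<le> (LINT x|sphere_measure. \<bar>?T t x\<bar>)" .
        have m1: "(LINT x|sphere_measure. \<bar>?T t x\<bar>) \<le> (LINT x|sphere_measure. ?P t x)"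
          by (rule Bochner_Integration.integral_mono) (use iT maj(1)[OF t] in auto)
        have m2: "(LINT x|sphere_measure. \<bar>?T t x\<bar>) \<le> (LINT x|sphere_measure. M ^ k * ?Q t x)"
          by (rule Bochner_Integration.integral_mono) (use iT maj(2)[OF t] in auto)
        have "(LINT x|sphere_measure. ?P t x) = (\<Sum>j\<le>k. real (k choose j) * t ^ j * (?I * (1 / (t + 1) ^ j)))"
          unfolding integral_multiplier[OF d pH] a_def bessel_eigenvalue_0 sum_distrib_right
          by (intro sum.cong refl) simp
        then have 1: "\<bar>\<Sum>l\<le>n. (a l / (t + a l)) ^ k * c l\<bar> \<le> 2 ^ k * ?I"
          using le m1 bin[OF t Inn] by linarith
        have "(LINT x|sphere_measure. M ^ k * ?Q t x) = M ^ k * (?I * (1 / (t + 1) ^ k))"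
          by (simp add: integral_multiplier[OF d pH] a_def)
        then have 2: "\<bar>\<Sum>l\<le>n. (a l / (t + a l)) ^ k * c l\<bar> \<le> M ^ k * (?I * (1 / (t + 1) ^ k))"
          using le m2 by linarith
        show "\<bar>\<Sum>l\<le>n. (a l / (t + a l)) ^ k * c l\<bar> \<le> 2 ^ k * ?I * min 1 ((M / t) ^ k)"
          by (rule conv[OF 1 2 one_le[OF Inn] Inn t])
      qed
    qed (use a0 M in auto)
    moreover have "(LINT x|sphere_measure. \<bar>g x\<bar>) = (\<Sum>l\<le>n. a l powr \<sigma> * c l)"
      unfolding msum[symmetric] g_def[symmetric] by (simp add: sg_def abs_sgn)
    ultimately have L1: "(LINT x|sphere_measure. \<bar>g x\<bar>) \<le> C * (2 ^ k * ?I) * M powr \<sigma>" by simp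
    show "let g = multiplier n (\<lambda>l. bessel_eigenvalue TYPE('n) l powr \<sigma>) F in
       (\<forall>x\<in>sphere 0 1. \<bar>g x\<bar> \<le> C * 2 ^ k * B * M powr \<sigma>) \<and>
       (LINT x|sphere_measure. \<bar>g x\<bar>) \<le> C * 2 ^ k * (LINT x|sphere_measure. H x) * M powr \<sigma>"
      unfolding Let_def a_def[symmetric] g_def[symmetric] using sup L1 by (simp add: mult.assoc)
  qed
qed

section \<open>Zonal polynomials\<close>

text \<open>For unit vectors, the squared cosine and sine of half the angle between \<open>x\<close> and \<open>y\<close>.\<close>

definition zonal_near :: "real^'n::finite \<Rightarrow> real^'n \<Rightarrow> real" where "zonal_near y x = (1 + x \<bullet> y) / 2"
definition zonal_far :: "real^'n::finite \<Rightarrow> real^'n \<Rightarrow> real" where "zonal_far y x = (1 - x \<bullet> y) / 2"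

lemma zonal_sum: "zonal_near y x + zonal_far y x = 1" by (simp add: zonal_near_def zonal_far_def field_simps)

lemma polynomial_inner: "real_polynomial_function (\<lambda>x. x \<bullet> y)"
  by (rule polynomial_linear) (rule bounded_linear_inner_left)

lemma polynomial_zonal: "real_polynomial_function (zonal_near y)" "real_polynomial_function (zonal_far y)"
  unfolding zonal_near_def[abs_def] zonal_far_def[abs_def]
  by (intro real_polynomial_function_divide polynomial_add real_polynomial_function_diff polynomial_const polynomial_inner)+

lemma zonal_bounds:
  assumes "norm y = 1" "x \<in> sphere 0 1"
  shows "0 \<le> zonal_near y x" "zonal_near y x \<le> 1" "0 \<le> zonal_far y x" "zonal_far y x \<le> 1"
  using Cauchy_Schwarz_ineq2[of x y] assms by (auto simp: zonal_near_def zonal_far_def)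

lemma rotation_deriv_diff:
  "real_polynomial_function f \<Longrightarrow> real_polynomial_function g \<Longrightarrow>
    rotation_deriv i j (\<lambda>x. f x - g x) = (\<lambda>x. rotation_deriv i j f x - rotation_deriv i j g x)"
  by (simp add: rotation_deriv_def partial_deriv_diff fun_eq_iff algebra_simps)

lemma rotation_deriv_inner: "rotation_deriv i j (\<lambda>x. x \<bullet> y) = (\<lambda>x. x $ i * y $ j - x $ j * y $ i)"
proof -
  have "partial_deriv k (\<lambda>x. x \<bullet> y) = (\<lambda>x. y $ k)" for k
    by (subst partial_deriv_linear[OF bounded_linear_inner_left]) (simp add: inner_axis')
  then show ?thesis by (simp add: rotation_deriv_def fun_eq_iff)
qed

lemma rotation_deriv_zonal:
  "rotation_deriv i j (zonal_near y) = (\<lambda>x. (x $ i * y $ j - x $ j * y $ i) / 2)"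
  "rotation_deriv i j (zonal_far y) = (\<lambda>x. - rotation_deriv i j (zonal_near y) x)"
proof -
  have n: "zonal_near y = (\<lambda>x. (1/2) * (x \<bullet> y) + 1/2)" and f: "zonal_far y = (\<lambda>x. (-1/2) * (x \<bullet> y) + 1/2)"
    by (simp_all add: zonal_near_def zonal_far_def fun_eq_iff field_simps)
  have c: "rotation_deriv i j (\<lambda>x. c * (x \<bullet> y) + b) = (\<lambda>x. c * (x $ i * y $ j - x $ j * y $ i))" for b c
    using rotation_deriv_add[OF polynomial_mult[OF polynomial_const[of c] polynomial_inner[of y]] polynomial_const[of b], of i j]
      rotation_deriv_cmult[OF polynomial_inner[of y], of i j c]
    by (simp add: rotation_deriv_inner)
  show "rotation_deriv i j (zonal_near y) = (\<lambda>x. (x $ i * y $ j - x $ j * y $ i) / 2)" unfolding n c by simp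
  then show "rotation_deriv i j (zonal_far y) = (\<lambda>x. - rotation_deriv i j (zonal_near y) x)" unfolding f c by simp
qed

text \<open>The squared gradient of \<open>u\<close>, by Lagrange's identity.\<close>

lemma sum_sq_rotation_zonal:
  assumes "norm y = 1" "x \<in> sphere (0::real^'n::finite) 1"
  shows "(\<Sum>i\<in>UNIV. \<Sum>j\<in>UNIV. rotation_deriv i j (zonal_near y) x * rotation_deriv i j (zonal_near y) x) / 2
    = zonal_near y x * zonal_far y x"
proof -
  have nx: "(\<Sum>i\<in>UNIV. x $ i * x $ i) = 1" and ny: "(\<Sum>i\<in>UNIV. y $ i * y $ i) = 1"
    using norm_sq_components[of x] norm_sq_components[of y] assms by auto
  have e: "rotation_deriv i j (zonal_near y) x * rotation_deriv i j (zonal_near y) x =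
    ((x $ i * x $ i) * (y $ j * y $ j) + (y $ i * y $ i) * (x $ j * x $ j) - 2 * ((x $ i * y $ i) * (x $ j * y $ j))) / 4" for i j
    unfolding rotation_deriv_zonal by (simp add: field_simps)
  have t: "(\<Sum>i\<in>UNIV. \<Sum>j\<in>UNIV. (x $ i * y $ i) * (x $ j * y $ j)) = (x \<bullet> y) * (x \<bullet> y)"
    by (simp add: inner_vec_def sum_product)
  have "(\<Sum>i\<in>UNIV. \<Sum>j\<in>UNIV. rotation_deriv i j (zonal_near y) x * rotation_deriv i j (zonal_near y) x)
     = ((\<Sum>i\<in>UNIV. x $ i * x $ i) * (\<Sum>j\<in>UNIV. y $ j * y $ j) + (\<Sum>i\<in>UNIV. y $ i * y $ i) * (\<Sum>j\<in>UNIV. x $ j * x $ j)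
       - 2 * (\<Sum>i\<in>UNIV. \<Sum>j\<in>UNIV. (x $ i * y $ i) * (x $ j * y $ j))) / 4"
    unfolding e sum_product by (simp add: sum_divide_distrib[symmetric] sum.distrib sum_subtractf sum_distrib_left)
  then show ?thesis unfolding nx ny t by (simp add: zonal_near_def zonal_far_def field_simps)
qed

lemma spherical_laplacian_zonal:
  fixes y :: "real^'n::finite"
  shows "spherical_laplacian (zonal_near y) = (\<lambda>x. (real CARD('n) - 1) / 2 * (zonal_far y x - zonal_near y x))"
proof
  fix x
  have h: "homogeneous 1 (\<lambda>x. x \<bullet> y)" by (auto simp: homogeneous_def polynomial_inner)
  have r: "real (CARD('n) - 1) = real CARD('n) - 1" using zero_less_card_finite[where 'a='n] by linarith
  have "spherical_laplacian (\<lambda>x. x \<bullet> y) x = - (real CARD('n) - 1) * (x \<bullet> y)"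
    unfolding spherical_laplacian_homogeneous[OF h] by (simp add: laplacian_low_degree[OF h] lb_eigenvalue_def r left_diff_distrib)
  moreover have "zonal_near y = (\<lambda>x. (1/2) * (x \<bullet> y) + 1/2)" by (simp add: zonal_near_def fun_eq_iff field_simps)
  ultimately have "spherical_laplacian (zonal_near y) x = (1/2) * (- (real CARD('n) - 1) * (x \<bullet> y))"
    using spherical_laplacian_add[OF polynomial_mult[OF polynomial_const[of "1/2"] polynomial_inner[of y]] polynomial_const[of "1/2"]]
      spherical_laplacian_cmult[OF polynomial_inner[of y], of "1/2"] by simp
  then show "spherical_laplacian (zonal_near y) x = (real CARD('n) - 1) / 2 * (zonal_far y x - zonal_near y x)"
    by (simp add: zonal_near_def zonal_far_def field_simps)
qed

lemma rotation_deriv_power: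
  assumes f: "real_polynomial_function f"
  shows "rotation_deriv i j (\<lambda>x. f x ^ k) = (\<lambda>x. real k * f x ^ (k - 1) * rotation_deriv i j f x)"
proof (induction k)
  case (Suc k)
  have "rotation_deriv i j (\<lambda>x. f x ^ Suc k) = (\<lambda>x. f x * rotation_deriv i j (\<lambda>x. f x ^ k) x + rotation_deriv i j f x * f x ^ k)"
    using rotation_deriv_mult[OF f real_polynomial_function_power[OF f], of i j k] by simp
  also have "\<dots> = (\<lambda>x. real (Suc k) * f x ^ (Suc k - 1) * rotation_deriv i j f x)"
    unfolding Suc by (cases k) (auto simp: algebra_simps fun_eq_iff)
  finally show ?case .
qed simp

definition zonal_monomial :: "real^'n::finite \<Rightarrow> nat \<Rightarrow> nat \<Rightarrow> real^'n \<Rightarrow> real" where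
  "zonal_monomial y k i x = zonal_near y x ^ k * zonal_far y x ^ i"

lemma polynomial_zonal_monomial: "real_polynomial_function (zonal_monomial y k i)"
  unfolding zonal_monomial_def[abs_def]
  by (intro polynomial_mult real_polynomial_function_power polynomial_zonal)

lemma rotation_deriv_zonal_monomial:
  "rotation_deriv p q (zonal_monomial y k i) =
    (\<lambda>x. (real k * zonal_monomial y (k - 1) i x - real i * zonal_monomial y k (i - 1) x) * rotation_deriv p q (zonal_near y) x)"
  unfolding zonal_monomial_def[abs_def]
  by (simp add: rotation_deriv_mult real_polynomial_function_power polynomial_zonal rotation_deriv_power[OF polynomial_zonal(1)]
      rotation_deriv_power[OF polynomial_zonal(2)] rotation_deriv_zonal(2) fun_eq_iff algebra_simps)

text \<open>All rotation derivatives of a function of \<open>u\<close> are multiples of that of \<open>u\<close>, so the chain rule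
  applies with the squared gradient \<open>u w\<close> and with \<open>\<Delta>u = a (w - u)\<close>. All terms have the same
  degree \<open>k + i\<close> in \<open>u\<close> and \<open>w\<close>. Truncated differences of exponents occur only with the coefficient
  \<open>0\<close>.\<close>

lemma spherical_laplacian_zonal_monomial:
  fixes y :: "real^'n::finite"
  assumes y: "norm y = 1" and x: "x \<in> sphere 0 1"
  defines "a \<equiv> (real CARD('n) - 1) / 2"
  shows "spherical_laplacian (zonal_monomial y k i) x =
      real k * (real k - 1 + a) * zonal_monomial y (k - 1) (i + 1) x
    - (2 * real k * real i + a * (real i + real k)) * zonal_monomial y k i x
    + real i * (real i - 1 + a) * zonal_monomial y (k + 1) (i - 1) x"
proof -
  let ?z = "zonal_monomial y" and ?u = "zonal_near y x" and ?w = "zonal_far y x"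
  let ?D = "\<lambda>p q. rotation_deriv p q (zonal_near y)"
  define P where "P = (\<lambda>x. real k * ?z (k - 1) i x - real i * ?z k (i - 1) x)"
  define Q where "Q = (\<lambda>x. real k * (real (k - 1) * ?z (k - 1 - 1) i x - real i * ?z (k - 1) (i - 1) x)
      - real i * (real k * ?z (k - 1) (i - 1) x - real (i - 1) * ?z k (i - 1 - 1) x))"
  have pP: "real_polynomial_function P" unfolding P_def
    by (intro real_polynomial_function_diff polynomial_mult polynomial_const polynomial_zonal_monomial)
  have DP: "rotation_deriv p q P = (\<lambda>x. Q x * ?D p q x)" for p q
    unfolding P_def
      rotation_deriv_diff[OF polynomial_mult[OF polynomial_const polynomial_zonal_monomial]
        polynomial_mult[OF polynomial_const polynomial_zonal_monomial]]
      rotation_deriv_cmult[OF polynomial_zonal_monomial] rotation_deriv_zonal_monomial Q_def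
    by (rule ext) (simp add: algebra_simps)
  have DF: "rotation_deriv p q (?z k i) = (\<lambda>x. P x * ?D p q x)" for p q
    unfolding rotation_deriv_zonal_monomial P_def ..
  have DD: "rotation_deriv p q (rotation_deriv p q (?z k i)) x = Q x * (?D p q x * ?D p q x) + P x * rotation_deriv p q (?D p q) x" for p q
    using rotation_deriv_mult[OF pP polynomial_rotation_deriv[OF polynomial_zonal(1)], of p q p q y]
    unfolding DF DP by (simp add: mult.assoc)
  have "spherical_laplacian (?z k i) x = Q x * ((\<Sum>p\<in>UNIV. \<Sum>q\<in>UNIV. ?D p q x * ?D p q x) / 2) + P x * spherical_laplacian (zonal_near y) x"
    unfolding spherical_laplacian_def DD by (simp add: sum.distrib sum_distrib_left add_divide_distrib)
  also have "\<dots> = Q x * (?u * ?w) + P x * (a * (?w - ?u))"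
    unfolding sum_sq_rotation_zonal[OF y x] by (simp add: spherical_laplacian_zonal a_def)
  finally have main: "spherical_laplacian (?z k i) x = Q x * (?u * ?w) + P x * (a * (?w - ?u))" .
  \<comment> \<open>exponents \<open>0\<close> and \<open>1\<close> are the ones affected by truncated subtraction\<close>
  have k_cases: "k = 0 \<or> k = 1 \<or> (\<exists>m. k = Suc (Suc m))" for k :: nat by presburger
  show ?thesis
    unfolding main P_def Q_def zonal_monomial_def
    using k_cases[of k] k_cases[of i]
    by (elim disjE exE) (simp_all add: algebra_simps)
qed

section \<open>Moments and size of zonal polynomials\<close>

text \<open>Half the dimension \<open>d\<close> of the sphere, the exponent in the order \<open>\<delta>^(d/2)\<close> of the measure of the cap \<open>w \<le> \<delta>\<close>.\<close>

definition half_dim :: "'n::finite itself \<Rightarrow> real" where "half_dim _ = (real CARD('n) - 1) / 2"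

text \<open>The integral of \<open>\<Delta>(u^(k+1))\<close> vanishes. This replaces polar coordinates and Beta integrals.\<close>

lemma zonal_near_moment_step:
  fixes y :: "real^'n::finite"
  assumes y: "norm y = 1"
  defines "a \<equiv> half_dim TYPE('n)"
  shows "(real k + 2 * a) * (LINT x|sphere_measure. zonal_near y x ^ Suc k) = (real k + a) * (LINT x|sphere_measure. zonal_near y x ^ k)"
proof -
  have a: "(real CARD('n) - 1) / 2 = a" by (simp add: a_def half_dim_def)
  have int: "integrable sphere_measure (\<lambda>x. zonal_near y x ^ j)" for j
    by (intro integrable_polynomial_sphere real_polynomial_function_power polynomial_zonal)
  have "0 = (LINT x|sphere_measure. spherical_laplacian (zonal_monomial y (Suc k) 0) x)"
    by (simp add: integral_spherical_laplacian[OF polynomial_zonal_monomial])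
  also have "\<dots> = (LINT x|sphere_measure. (real k + 1) * ((real k + a) * zonal_near y x ^ k - (real k + 2 * a) * zonal_near y x ^ Suc k))"
  proof (intro Bochner_Integration.integral_cong refl)
    fix x :: "real^'n" assume "x \<in> space sphere_measure"
    then have x: "x \<in> sphere 0 1" by simp
    have w: "zonal_far y x = 1 - zonal_near y x" using zonal_sum[of y x] by linarith
    show "spherical_laplacian (zonal_monomial y (Suc k) 0) x =
       (real k + 1) * ((real k + a) * zonal_near y x ^ k - (real k + 2 * a) * zonal_near y x ^ Suc k)"
      unfolding spherical_laplacian_zonal_monomial[OF y x] zonal_monomial_def w a
      by (simp add: algebra_simps)
  qed
  also have "\<dots> = (real k + 1) * ((real k + a) * (LINT x|sphere_measure. zonal_near y x ^ k) - (real k + 2 * a) * (LINT x|sphere_measure. zonal_near y x ^ Suc k))"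
    using int[of k] int[of "Suc k"] by (simp del: power_Suc)
  finally show ?thesis by simp
qed

text \<open>The solution is a quotient of Gamma functions of order \<open>k^(-a)\<close>. Elementary logarithmic inequalities
  show that \<open>r k (k + 2a)^a\<close> decreases and that \<open>r k (k + a - 1)^a\<close> increases.\<close>

lemma gamma_ratio_recursion_bounds:
  fixes r :: "nat \<Rightarrow> real"
  assumes a: "a \<ge> 1/2" and r0: "r 0 = 1" and step: "\<And>k. (real k + 2 * a) * r (Suc k) = (real k + a) * r k"
  shows "k \<ge> 1 \<Longrightarrow> r k \<le> (2 * a) powr a * real k powr (- a)"
    and "k \<ge> 1 \<Longrightarrow> r k \<ge> (1/2) * (a / (1 + a)) powr a * real k powr (- a)"
proof -
  have rS: "r (Suc k) = r k * ((real k + a) / (real k + 2 * a))" for k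
    using step[of k] a by (simp add: field_simps)
  have up: "r k \<le> (2 * a) powr a * (real k + 2 * a) powr (- a)" for k
  proof (induction k)
    case 0
    then show ?case using r0 a by (simp add: powr_minus)
  next
    case (Suc k)
    define x where "x = real k + 2 * a"
    have x: "x > 0" using a by (simp add: x_def)
    have "1 - a / x \<le> exp (- (a / x))" using exp_ge_add_one_self[of "- (a / x)"] by simp
    also have "\<dots> \<le> exp (- (a * ln (1 + 1 / x)))"
    proof -
      have "ln (1 + 1 / x) \<le> 1 / x" using x by (intro ln_add_one_self_le_self) simp
      then have "a * ln (1 + 1 / x) \<le> a * (1 / x)" using a by (intro mult_left_mono) auto
      then show ?thesis by simp
    qed
    also have "\<dots> = (1 + 1 / x) powr (- a)" using x add_pos_pos[of 1 "1/x"] by (simp add: powr_def)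
    also have "\<dots> = ((x + 1) / x) powr (- a)" using x by (simp add: field_simps)
    also have "\<dots> = (x + 1) powr (- a) / x powr (- a)" using x by (simp add: powr_divide)
    finally have key: "(1 - a / x) * x powr (- a) \<le> (x + 1) powr (- a)" using x by (simp add: field_simps)
    have "r (Suc k) = r k * (1 - a / x)" unfolding rS using x by (simp add: x_def field_simps)
    also have "\<dots> \<le> ((2 * a) powr a * x powr (- a)) * (1 - a / x)"
      using Suc.IH x a by (intro mult_right_mono) (auto simp: x_def field_simps)
    also have "\<dots> = (2 * a) powr a * ((1 - a / x) * x powr (- a))" by simp
    also have "\<dots> \<le> (2 * a) powr a * (x + 1) powr (- a)" using key by (intro mult_left_mono) auto
    finally show ?case by (simp add: x_def add_ac)
  qed
  have lo: "r (Suc k) \<ge> (1/2) * a powr a * (real k + a) powr (- a)" for k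
  proof (induction k)
    case 0
    have "r (Suc 0) = 1/2" unfolding rS using r0 a by simp
    then show ?case using a by (simp add: powr_minus)
  next
    case (Suc k)
    define x where "x = real (Suc k) + a"
    have x: "x > 1" using a by (simp add: x_def)
    have "(x - 1) powr a * x powr (- a) = ((x - 1) / x) powr a"
      using x by (simp add: powr_divide powr_minus_divide)
    also have "(x - 1) / x = 1 - 1 / x" using x by (simp add: field_simps)
    also have "(1 - 1 / x) powr a = exp (a * ln (1 - 1 / x))" using x by (simp add: powr_def)
    also have "\<dots> \<le> exp (- (a / x))"
    proof -
      have "ln (1 - 1 / x) \<le> - 1 / x" using ln_le_minus_one[of "1 - 1 / x"] x by simp
      then have "a * ln (1 - 1 / x) \<le> a * (- 1 / x)" using a by (intro mult_left_mono) auto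
      then show ?thesis by simp
    qed
    also have "\<dots> = 1 / exp (a / x)" by (simp add: exp_minus field_simps)
    also have "\<dots> \<le> 1 / (1 + a / x)"
      using exp_ge_add_one_self[of "a / x"] x a by (intro divide_left_mono) (auto intro!: mult_pos_pos add_pos_nonneg)
    also have "\<dots> = x / (x + a)" using x a by (simp add: field_simps)
    finally have "x / (x + a) \<ge> (x - 1) powr a * x powr (- a)" .
    then have "(x - 1) powr (- a) * ((x - 1) powr a * x powr (- a)) \<le> (x - 1) powr (- a) * (x / (x + a))"
      by (intro mult_left_mono) auto
    moreover have "(x - 1) powr (- a) * ((x - 1) powr a * x powr (- a)) = x powr (- a)"
      using x unfolding mult.assoc[symmetric] powr_add[symmetric] by simp
    ultimately have key: "(x - 1) powr (- a) * (x / (x + a)) \<ge> x powr (- a)" by simp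
    have "(1/2) * a powr a * x powr (- a) \<le> (1/2) * a powr a * ((x - 1) powr (- a) * (x / (x + a)))"
      using key by (intro mult_left_mono) auto
    also have "\<dots> = ((1/2) * a powr a * (real k + a) powr (- a)) * (x / (x + a))" by (simp add: x_def add_ac)
    also have "\<dots> \<le> r (Suc k) * (x / (x + a))" using Suc.IH x a by (intro mult_right_mono) auto
    also have "\<dots> = r (Suc (Suc k))" unfolding rS[of "Suc k"] by (simp add: x_def algebra_simps)
    finally show ?case by (simp add: x_def)
  qed
  show "r k \<le> (2 * a) powr a * real k powr (- a)" if "k \<ge> 1"
  proof -
    have "(real k + 2 * a) powr (- a) \<le> real k powr (- a)" using that a by (intro powr_mono2') auto
    then have "(2 * a) powr a * (real k + 2 * a) powr (- a) \<le> (2 * a) powr a * real k powr (- a)" by (intro mult_left_mono) auto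
    then show ?thesis using up[of k] by linarith
  qed
  show "r k \<ge> (1/2) * (a / (1 + a)) powr a * real k powr (- a)" if k1: "k \<ge> 1"
  proof -
    obtain j where k: "k = Suc j" using k1 by (cases k) auto
    have "real j + a \<le> (1 + a) * real k" using a by (simp add: k algebra_simps)
    then have "((1 + a) * real k) powr (- a) \<le> (real j + a) powr (- a)" using a by (intro powr_mono2') auto
    moreover have "((1 + a) * real k) powr (- a) = (1 + a) powr (- a) * real k powr (- a)" using a by (simp add: powr_mult)
    moreover have "(a / (1 + a)) powr a = a powr a * (1 + a) powr (- a)" using a by (simp add: powr_divide powr_minus_divide)
    ultimately have "(1/2) * (a / (1 + a)) powr a * real k powr (- a) \<le> (1/2) * a powr a * (real j + a) powr (- a)"
      by (simp add: mult.assoc mult_left_mono)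
    then show ?thesis using lo[of j] by (simp add: k)
  qed
qed

lemma zonal_near_moment_bounds:
  assumes d: "CARD('n::finite) \<ge> 2"
  defines "a \<equiv> half_dim TYPE('n)"
  shows "\<exists>c1>0. \<exists>c2>0. \<forall>(y::real^'n) k. norm y = 1 \<longrightarrow> k \<ge> 1 \<longrightarrow>
     c1 * real k powr (- a) \<le> (LINT x|sphere_measure. zonal_near y x ^ k) \<and>
     (LINT x|sphere_measure. zonal_near y x ^ k) \<le> c2 * real k powr (- a)"
proof -
  interpret prob_space "sphere_measure :: (real^'n) measure" by (rule prob_space_sphere_measure)
  have a: "a \<ge> 1/2" using d by (simp add: a_def half_dim_def)
  have main: "(1/2) * (a / (1 + a)) powr a * real k powr (- a) \<le> (LINT x|sphere_measure. zonal_near y x ^ k) \<and>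
     (LINT x|sphere_measure. zonal_near y x ^ k) \<le> (2 * a) powr a * real k powr (- a)"
    if y: "norm y = 1" and k: "k \<ge> 1" for y :: "real^'n" and k
  proof -
    have p1: "(LINT x|sphere_measure. zonal_near y x ^ 0) = 1" using prob_space by simp
    note b = gamma_ratio_recursion_bounds[of a "\<lambda>k. (LINT x|sphere_measure. zonal_near y x ^ k)",
        OF a p1 zonal_near_moment_step[OF y, folded a_def] k]
    show ?thesis using b by simp
  qed
  have "(1/2) * (a / (1 + a)) powr a > 0" "(2 * a) powr a > 0" using a by auto
  then show ?thesis using main by blast
qed

text \<open>The scaling keeps these functions of order one, since \<open>w\<close> is of order \<open>1/M\<close> where \<open>u^M\<close> is not small.\<close>

definition zonal_profile :: "real^'n::finite \<Rightarrow> nat \<Rightarrow> nat \<Rightarrow> real^'n \<Rightarrow> real" where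
  "zonal_profile y M i x = real M ^ i * zonal_monomial y (M - i) i x"

lemma polynomial_zonal_profile: "real_polynomial_function (zonal_profile y M i)"
  unfolding zonal_profile_def[abs_def] by (intro polynomial_mult polynomial_const polynomial_zonal_monomial)

text \<open>Split off half of the powers of \<open>u\<close>. The remaining \<open>u^(q-i) w^i\<close> is at most the inverse of the binomial
  coefficient, because it is a term in the expansion of \<open>(u + w)^q = 1\<close>.\<close>

lemma zonal_profile_bounds:
  assumes y: "norm y = 1" and x: "x \<in> sphere 0 1" and M: "2 * i \<le> M"
  shows "0 \<le> zonal_profile y M i x" "zonal_profile y M i x \<le> (2 * real i) ^ i * zonal_near y x ^ (M div 2)"
proof -
  let ?u = "zonal_near y x" and ?w = "zonal_far y x"
  note b = zonal_bounds[OF y x]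
  show "0 \<le> zonal_profile y M i x" using b by (simp add: zonal_profile_def zonal_monomial_def)
  define q where "q = M - M div 2"
  have q: "i \<le> q" "real M \<le> 2 * real q" "M - i = M div 2 + (q - i)" using M by (auto simp: q_def)
  have "real (q choose i) * (?u ^ (q - i) * ?w ^ i) \<le> 1"
  proof -
    have "real (q choose i) * ?w ^ i * ?u ^ (q - i) \<le> (\<Sum>j\<le>q. real (q choose j) * ?w ^ j * ?u ^ (q - j))"
      using b q(1) by (intro member_le_sum) auto
    also have "\<dots> = (?w + ?u) ^ q" by (rule binomial_ring[symmetric])
    also have "\<dots> = 1" using zonal_sum[of y x] by (simp add: add.commute)
    finally show ?thesis by (simp add: mult_ac)
  qed
  moreover have "real M ^ i \<le> (2 * real i) ^ i * real (q choose i)"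
  proof (cases "i = 0")
    case False
    have "(real q / real i) ^ i \<le> real (q choose i)" by (rule binomial_ge_n_over_k_pow_k[OF q(1)])
    then have "real q ^ i \<le> real i ^ i * real (q choose i)" using False by (simp add: power_divide field_simps)
    then have "2 ^ i * real q ^ i \<le> 2 ^ i * (real i ^ i * real (q choose i))" by (intro mult_left_mono) auto
    moreover have "real M ^ i \<le> (2 * real q) ^ i" using q(2) by (intro power_mono) auto
    ultimately show ?thesis unfolding power_mult_distrib mult.assoc by linarith
  qed simp
  ultimately have "real M ^ i * (?u ^ (q - i) * ?w ^ i) \<le> ((2 * real i) ^ i * real (q choose i)) * (?u ^ (q - i) * ?w ^ i)"
    using b by (intro mult_right_mono) auto
  also have "\<dots> = (2 * real i) ^ i * (real (q choose i) * (?u ^ (q - i) * ?w ^ i))" by simp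
  also have "\<dots> \<le> (2 * real i) ^ i * 1"
    using \<open>real (q choose i) * (?u ^ (q - i) * ?w ^ i) \<le> 1\<close> by (intro mult_left_mono) auto
  finally have "real M ^ i * (?u ^ (q - i) * ?w ^ i) \<le> (2 * real i) ^ i" by simp
  then have "real M ^ i * (?u ^ (q - i) * ?w ^ i) * ?u ^ (M div 2) \<le> (2 * real i) ^ i * ?u ^ (M div 2)"
    using b by (intro mult_right_mono) auto
  then show "zonal_profile y M i x \<le> (2 * real i) ^ i * ?u ^ (M div 2)"
    by (simp add: zonal_profile_def zonal_monomial_def q(3) power_add mult_ac)
qed

lemma spherical_laplacian_zonal_profile:
  fixes y :: "real^'n::finite"
  assumes y: "norm y = 1" and x: "x \<in> sphere 0 1" and i: "i < M"
  defines "a \<equiv> half_dim TYPE('n)"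
  shows "spherical_laplacian (zonal_profile y M i) x =
     real (M - i) * (real (M - i) - 1 + a) / real M * zonal_profile y M (Suc i) x
   - (2 * real (M - i) * real i + a * real M) * zonal_profile y M i x
   + real M * real i * (real i - 1 + a) * zonal_profile y M (i - 1) x"
proof -
  have "spherical_laplacian (zonal_profile y M i) x = real M ^ i * spherical_laplacian (zonal_monomial y (M - i) i) x"
    unfolding zonal_profile_def[abs_def] by (simp add: spherical_laplacian_cmult[OF polynomial_zonal_monomial])
  also have "\<dots> = real M ^ i * (real (M - i) * (real (M - i) - 1 + a) * zonal_monomial y (M - i - 1) (i + 1) x
    - (2 * real (M - i) * real i + a * (real i + real (M - i))) * zonal_monomial y (M - i) i x
    + real i * (real i - 1 + a) * zonal_monomial y (M - i + 1) (i - 1) x)"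
    unfolding spherical_laplacian_zonal_monomial[OF y x] a_def half_dim_def ..
  also have "\<dots> = real M ^ i * (real (M - i) * (real (M - i) - 1 + a) * zonal_monomial y (M - Suc i) (Suc i) x)
    - (2 * real (M - i) * real i + a * real M) * zonal_profile y M i x
    + real M ^ i * (real i * (real i - 1 + a) * zonal_monomial y (M - i + 1) (i - 1) x)"
    using i by (simp add: zonal_profile_def algebra_simps of_nat_diff)
  also have "real M ^ i * (real (M - i) * (real (M - i) - 1 + a) * zonal_monomial y (M - Suc i) (Suc i) x)
    = real (M - i) * (real (M - i) - 1 + a) / real M * zonal_profile y M (Suc i) x"
    using i by (simp add: zonal_profile_def)
  also have "real M ^ i * (real i * (real i - 1 + a) * zonal_monomial y (M - i + 1) (i - 1) x)
    = real M * real i * (real i - 1 + a) * zonal_profile y M (i - 1) x"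
  proof (cases i)
    case (Suc j)
    then have "M - i + 1 = M - j" using i by simp
    then show ?thesis using Suc by (simp add: zonal_profile_def)
  qed simp
  finally show ?thesis .
qed

text \<open>One application of \<open>A\<close> to a combination of the first \<open>r + 1\<close> profiles gives a combination of the
  first \<open>r + 2\<close>, and multiplies the size of the coefficients by a multiple of \<open>M\<close>.\<close>

lemma bessel_step_zonal:
  fixes c :: "nat \<Rightarrow> real" and y :: "real^'n::finite"
  assumes d: "CARD('n) \<ge> 2" and y: "norm y = 1" and r: "r < M" and c: "\<And>i. i \<le> r \<Longrightarrow> \<bar>c i\<bar> \<le> B" and cz: "\<And>i. i > r \<Longrightarrow> c i = 0"
  defines "a \<equiv> half_dim TYPE('n)"
  shows "\<exists>c'. (\<forall>i. \<bar>c' i\<bar> \<le> B * real M * (2 + 2 * a + 2 * real r + (real r + 1) * (real r + a))) \<and> (\<forall>i>Suc r. c' i = 0) \<and>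
    (\<forall>x\<in>sphere 0 1. (\<Sum>i\<le>Suc r. c' i * zonal_profile y M i x) =
       (\<Sum>i\<le>r. c i * zonal_profile y M i x) - spherical_laplacian (\<lambda>x. \<Sum>i\<le>r. c i * zonal_profile y M i x) x)"
proof -
  let ?z = "zonal_profile y M"
  \<comment> \<open>\<open>\<Delta>\<close> is tridiagonal in the profiles: \<open>p\<close> raises the index, \<open>s\<close> lowers it and \<open>- q\<close> is the diagonal\<close>
  define p where "p = (\<lambda>i. real (M - i) * (real (M - i) - 1 + a) / real M)"
  define q where "q = (\<lambda>i. 2 * real (M - i) * real i + a * real M)"
  define s where "s = (\<lambda>i. real M * real i * (real i - 1 + a))"
  define c' where "c' = (\<lambda>i. (if i = 0 then 0 else - c (i - 1) * p (i - 1)) + c i * (1 + q i) - c (Suc i) * s (Suc i))"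
  have a: "a \<ge> 1/2" using d by (simp add: a_def half_dim_def)
  have M: "real M \<ge> 1" using r by simp
  have B: "B \<ge> 0" using c[of 0] by simp
  have cB: "\<bar>c i\<bar> \<le> B" for i using c[of i] cz[of i] B by (cases "i \<le> r") auto
  have pb: "\<bar>c i * p i\<bar> \<le> B * (real M * (1 + a))" for i
  proof (cases "i \<le> r")
    case True
    then have k: "real (M - i) \<ge> 1" "real (M - i) \<le> real M" using r by auto
    have "real (M - i) / real M * (real (M - i) - 1 + a) \<le> 1 * (real M + a)"
      using k a M by (intro mult_mono) (auto simp: field_simps)
    also have "\<dots> \<le> real M * (1 + a)" using M a by (simp add: distrib_left)
    finally have "p i \<le> real M * (1 + a)" by (simp add: p_def)
    moreover have "p i \<ge> 0" using k a M by (simp add: p_def)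
    ultimately show ?thesis using cB[of i] B by (simp add: abs_mult mult_mono)
  next
    case False
    then show ?thesis using cz B M a by simp
  qed
  have qb: "\<bar>c i * (1 + q i)\<bar> \<le> B * (real M * (1 + 2 * real r + a))" for i
  proof (cases "i \<le> r")
    case True
    then have "real (M - i) * real i \<le> real M * real r" by (intro mult_mono) auto
    then have "1 + q i \<le> real M * (1 + 2 * real r + a)" using M by (simp add: q_def algebra_simps)
    moreover have "1 + q i \<ge> 0" using a by (simp add: q_def)
    ultimately show ?thesis using cB[of i] B by (simp add: abs_mult mult_mono)
  next
    case False
    then show ?thesis using cz B M a by simp
  qed
  have sb: "\<bar>c i * s i\<bar> \<le> B * (real M * ((real r + 1) * (real r + a)))" for i
  proof (cases "i \<le> r \<and> i \<noteq> 0")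
    case True
    then have i: "real i \<ge> 1" "real i \<le> real r" by auto
    have "real i * (real i - 1 + a) \<le> (real r + 1) * (real r + a)" using i a by (intro mult_mono) auto
    then have "real M * (real i * (real i - 1 + a)) \<le> real M * ((real r + 1) * (real r + a))" by (intro mult_left_mono) auto
    then have "s i \<le> real M * ((real r + 1) * (real r + a))" by (simp add: s_def mult.assoc)
    moreover have "s i \<ge> 0" using i a by (simp add: s_def)
    ultimately show ?thesis using cB[of i] B by (simp add: abs_mult mult_mono)
  next
    case False
    then have "c i * s i = 0" using cz[of i] by (auto simp: s_def)
    moreover have "0 \<le> B * (real M * ((real r + 1) * (real r + a)))" using B M a by (intro mult_nonneg_nonneg) auto
    ultimately show ?thesis by (simp only: abs_zero)
  qed
  show ?thesis
  proof (intro exI[of _ c'] conjI allI impI ballI)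
    fix i
    have "\<bar>c' i\<bar> \<le> B * (real M * (1 + a)) + B * (real M * (1 + 2 * real r + a)) + B * (real M * ((real r + 1) * (real r + a)))"
    proof -
      have "\<bar>if i = 0 then 0 else - c (i - 1) * p (i - 1)\<bar> \<le> B * (real M * (1 + a))"
        using pb[of "i - 1"] B M a by simp
      then show ?thesis using qb[of i] sb[of "Suc i"] unfolding c'_def by linarith
    qed
    then show "\<bar>c' i\<bar> \<le> B * real M * (2 + 2 * a + 2 * real r + (real r + 1) * (real r + a))" by (simp add: algebra_simps)
  next
    fix i assume "i > Suc r"
    then show "c' i = 0" using cz[of i] cz[of "i - 1"] cz[of "Suc i"] by (simp add: c'_def)
  next
    fix x :: "real^'n" assume x: "x \<in> sphere 0 1"
    have "spherical_laplacian (\<lambda>x. \<Sum>i\<le>r. c i * ?z i x) x = (\<Sum>i\<le>r. c i * spherical_laplacian (?z i) x)"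
      by (subst spherical_laplacian_sum)
        (auto simp: spherical_laplacian_cmult[OF polynomial_zonal_profile] intro!: polynomial_mult polynomial_zonal_profile)
    also have "\<dots> = (\<Sum>i\<le>r. c i * (p i * ?z (Suc i) x - q i * ?z i x + s i * ?z (i - 1) x))"
      using r by (intro sum.cong refl) (simp add: spherical_laplacian_zonal_profile[OF y x] p_def q_def s_def a_def)
    finally have L: "spherical_laplacian (\<lambda>x. \<Sum>i\<le>r. c i * ?z i x) x
      = (\<Sum>i\<le>r. c i * p i * ?z (Suc i) x) - (\<Sum>i\<le>r. c i * q i * ?z i x) + (\<Sum>i\<le>r. c i * s i * ?z (i - 1) x)"
      by (simp add: algebra_simps sum.distrib sum_subtractf)
    have A: "(\<Sum>i\<le>Suc r. (if i = 0 then 0 else - c (i - 1) * p (i - 1)) * ?z i x) = - (\<Sum>i\<le>r. c i * p i * ?z (Suc i) x)"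
      by (simp only: sum.atMost_Suc_shift) (simp add: sum_negf)
    have Bs: "(\<Sum>i\<le>Suc r. c i * (1 + q i) * ?z i x) = (\<Sum>i\<le>r. c i * ?z i x) + (\<Sum>i\<le>r. c i * q i * ?z i x)"
      using cz[of "Suc r"] by (simp add: algebra_simps sum.distrib)
    have Cs: "(\<Sum>i\<le>Suc r. c (Suc i) * s (Suc i) * ?z i x) = (\<Sum>i\<le>r. c i * s i * ?z (i - 1) x)"
    proof -
      have "(\<Sum>i\<le>r. c i * s i * ?z (i - 1) x) = (\<Sum>i\<le>Suc (Suc r). c i * s i * ?z (i - 1) x)"
        using cz[of "Suc r"] cz[of "Suc (Suc r)"] by simp
      also have "\<dots> = (\<Sum>i\<le>Suc r. c (Suc i) * s (Suc i) * ?z i x)"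
        by (simp only: sum.atMost_Suc_shift[of _ "Suc r"]) (simp add: s_def)
      finally show ?thesis by simp
    qed
    have "(\<Sum>i\<le>Suc r. c' i * ?z i x) = (\<Sum>i\<le>Suc r. (if i = 0 then 0 else - c (i - 1) * p (i - 1)) * ?z i x)
       + (\<Sum>i\<le>Suc r. c i * (1 + q i) * ?z i x) - (\<Sum>i\<le>Suc r. c (Suc i) * s (Suc i) * ?z i x)"
      unfolding c'_def by (simp only: left_diff_distrib distrib_right sum.distrib sum_subtractf)
    then show "(\<Sum>i\<le>Suc r. c' i * ?z i x) = (\<Sum>i\<le>r. c i * ?z i x) - spherical_laplacian (\<lambda>x. \<Sum>i\<le>r. c i * ?z i x) x"
      unfolding L A Bs Cs by simp
  qed
qed

section \<open>The test function\<close>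

text \<open>The image under \<open>A^k\<close> is again an explicit zonal polynomial with coefficients of order \<open>M^k\<close>. It is
  described by its projections, as only these enter the Sobolev norm; it agrees with \<open>A^k\<close> of the
  given polynomial on the sphere only. The constant does not depend on \<open>y\<close> and \<open>M\<close>.\<close>

lemma bessel_iterate_zonal:
  assumes d: "CARD('n::finite) \<ge> 2"
  shows "\<exists>C\<ge>1. \<forall>(y::real^'n) M B c. norm y = 1 \<longrightarrow> k + 1 < M \<longrightarrow> (\<forall>i. \<bar>c i\<bar> \<le> B) \<longrightarrow> (\<forall>i>1. c i = 0) \<longrightarrow>
    (\<exists>c'. (\<forall>i. \<bar>c' i\<bar> \<le> C * B * real M ^ k) \<and> (\<forall>i>k+1. c' i = 0) \<and>
      (\<forall>l. \<forall>x\<in>sphere 0 1. harmonic_proj l (\<lambda>x. \<Sum>i\<le>k+1. c' i * zonal_profile y M i x) x =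
         bessel_eigenvalue TYPE('n) l ^ k * harmonic_proj l (\<lambda>x. \<Sum>i\<le>1. c i * zonal_profile y M i x) x))"
proof (induction k)
  case 0
  show ?case by (intro exI[of _ 1]) auto
next
  case (Suc k)
  define a where "a = half_dim TYPE('n)"
  have a: "a \<ge> 1/2" using d by (simp add: a_def half_dim_def)
  define K where "K = 2 + 2 * a + 2 * real (k+1) + (real (k+1) + 1) * (real (k+1) + a)"
  have K: "K \<ge> 1" using a by (simp add: K_def)
  obtain C where C: "C \<ge> 1" and IH: "\<forall>(y::real^'n) M B c. norm y = 1 \<longrightarrow> k + 1 < M \<longrightarrow> (\<forall>i. \<bar>c i\<bar> \<le> B) \<longrightarrow> (\<forall>i>1. c i = 0) \<longrightarrow>
    (\<exists>c'. (\<forall>i. \<bar>c' i\<bar> \<le> C * B * real M ^ k) \<and> (\<forall>i>k+1. c' i = 0) \<and>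
      (\<forall>l. \<forall>x\<in>sphere 0 1. harmonic_proj l (\<lambda>x. \<Sum>i\<le>k+1. c' i * zonal_profile y M i x) x =
         bessel_eigenvalue TYPE('n) l ^ k * harmonic_proj l (\<lambda>x. \<Sum>i\<le>1. c i * zonal_profile y M i x) x))"
    using Suc.IH by (elim exE conjE) (rule that)
  show ?case
  proof (intro exI[of _ "C * K"] conjI allI impI)
    show "C * K \<ge> 1" using C K mult_mono[of 1 C 1 K] by simp
    fix y :: "real^'n" and M :: nat and B and c :: "nat \<Rightarrow> real"
    assume y: "norm y = 1" and M: "Suc k + 1 < M" and cB: "\<forall>i. \<bar>c i\<bar> \<le> B" and cz: "\<forall>i>1. c i = 0"
    have M': "k + 1 < M" using M by simp
    obtain c' where c': "\<forall>i. \<bar>c' i\<bar> \<le> C * B * real M ^ k" "\<forall>i>k+1. c' i = 0"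
      "\<forall>l. \<forall>x\<in>sphere 0 1. harmonic_proj l (\<lambda>x. \<Sum>i\<le>k+1. c' i * zonal_profile y M i x) x =
         bessel_eigenvalue TYPE('n) l ^ k * harmonic_proj l (\<lambda>x. \<Sum>i\<le>1. c i * zonal_profile y M i x) x"
      using IH[THEN spec, THEN spec, THEN spec, THEN spec, THEN mp, OF y, THEN mp, OF M', THEN mp, OF cB, THEN mp, OF cz]
      by (elim exE conjE) (rule that)
    define G where "G = (\<lambda>x. \<Sum>i\<le>k+1. c' i * zonal_profile y M i x)"
    have pG: "real_polynomial_function G" unfolding G_def
      by (intro real_polynomial_function_sum polynomial_mult polynomial_const polynomial_zonal_profile) auto
    obtain c'' where c'': "\<forall>i. \<bar>c'' i\<bar> \<le> C * B * real M ^ k * real M * K" "\<forall>i>Suc (k+1). c'' i = 0"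
      "\<forall>x\<in>sphere 0 1. (\<Sum>i\<le>Suc (k+1). c'' i * zonal_profile y M i x) = G x - spherical_laplacian G x"
      using bessel_step_zonal[OF d y M', of c' "C * B * real M ^ k"] c'(1,2)
      unfolding G_def K_def a_def by blast
    have "harmonic_proj l (\<lambda>x. \<Sum>i\<le>Suc k+1. c'' i * zonal_profile y M i x) x =
         bessel_eigenvalue TYPE('n) l ^ Suc k * harmonic_proj l (\<lambda>x. \<Sum>i\<le>1. c i * zonal_profile y M i x) x"
      if x: "x \<in> sphere 0 1" for l x
    proof -
      have "harmonic_proj l (\<lambda>x. \<Sum>i\<le>Suc k+1. c'' i * zonal_profile y M i x) = harmonic_proj l (\<lambda>x. G x - spherical_laplacian G x)"
        using c''(3) by (intro harmonic_proj_cong) simp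
      then have "harmonic_proj l (\<lambda>x. \<Sum>i\<le>Suc k+1. c'' i * zonal_profile y M i x) x = harmonic_proj l (\<lambda>x. G x - spherical_laplacian G x) x"
        by (rule fun_cong)
      also have "\<dots> = harmonic_proj l G x - harmonic_proj l (spherical_laplacian G) x"
        by (intro harmonic_proj_diff integrable_polynomial_sphere pG polynomial_spherical_laplacian)
      also have "\<dots> = bessel_eigenvalue TYPE('n) l * harmonic_proj l G x"
        unfolding harmonic_proj_spherical_laplacian[OF pG] by (simp add: bessel_eigenvalue_def algebra_simps)
      finally show ?thesis using c'(3) x by (simp add: G_def)
    qed
    then show "\<exists>c'. (\<forall>i. \<bar>c' i\<bar> \<le> C * K * B * real M ^ Suc k) \<and> (\<forall>i>Suc k+1. c' i = 0) \<and>
      (\<forall>l. \<forall>x\<in>sphere 0 1. harmonic_proj l (\<lambda>x. \<Sum>i\<le>Suc k+1. c' i * zonal_profile y M i x) x =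
         bessel_eigenvalue TYPE('n) l ^ Suc k * harmonic_proj l (\<lambda>x. \<Sum>i\<le>1. c i * zonal_profile y M i x) x)"
      using c''(1,2) by (intro exI[of _ c'']) (auto simp: mult_ac)
  qed
qed

lemma harmonic_proj_zero_above:
  assumes d: "CARD('n::finite) \<ge> 2" and F: "spectral_degree_le n (F :: real^'n \<Rightarrow> real)" and "l > n"
  shows "harmonic_proj l F = (\<lambda>x. 0)"
proof -
  have "harmonic_proj l F = (if l \<le> n then harmonic_proj l F else (\<lambda>x. 0))"
    by (rule harmonic_proj_harmonic_sum[OF d])
      (use F in \<open>auto simp: spectral_degree_le_def intro!: harmonic_proj_solid_harmonic integrable_polynomial_sphere\<close>)
  then show ?thesis using \<open>l > n\<close> by simp
qed

text \<open>The function is \<open>F = M (\<eta> - w) u^(M-1)\<close>. It is positive exactly in the cap \<open>w < \<eta>\<close>. As \<open>w\<close> has mean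
  about \<open>a/M\<close> with respect to the weight \<open>u^(M-1)\<close>, the integral is positive once \<open>M \<eta>\<close> exceeds a
  constant; \<open>M \<eta>\<close> is also bounded above, so that the coefficients of \<open>F\<close> in terms of the profiles
  remain bounded.\<close>

lemma peaked_test_function:
  fixes \<sigma> :: real
  assumes d: "CARD('n::finite) \<ge> 2" and \<sigma>: "\<sigma> > 0"
  defines "a \<equiv> half_dim TYPE('n)"
  shows "\<exists>R>0. \<exists>c>0. \<exists>C>0. \<forall>(y::real^'n) \<eta>. norm y = 1 \<longrightarrow> 0 < \<eta> \<longrightarrow> \<eta> \<le> 1 \<longrightarrow>
    (\<exists>M\<ge>1. \<exists>F g. real M \<le> R / \<eta> \<and> real_polynomial_function F \<and> real_polynomial_function g \<and>
      (\<forall>x\<in>sphere 0 1. zonal_far y x \<ge> \<eta> \<longrightarrow> F x \<le> 0) \<and>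
      c * real M powr (- a) \<le> (LINT x|sphere_measure. F x) \<and>
      (\<forall>l. \<forall>x\<in>sphere 0 1. harmonic_proj l g x = bessel_eigenvalue TYPE('n) l powr \<sigma> * harmonic_proj l F x) \<and>
      (\<forall>x\<in>sphere 0 1. \<bar>g x\<bar> \<le> C * real M powr \<sigma>) \<and>
      (LINT x|sphere_measure. \<bar>g x\<bar>) \<le> C * real M powr (\<sigma> - a))"
proof -
  have a: "a \<ge> 1/2" using d by (simp add: a_def half_dim_def)
  obtain k :: nat where k: "\<sigma> < real k" using reals_Archimedean2 by blast
  obtain Cf where Cf: "Cf > 0" and frac: "\<forall>n (F :: real^'n \<Rightarrow> real) G H B M. spectral_degree_le n F \<longrightarrow> spectral_degree_le n G \<longrightarrow> spectral_degree_le n H \<longrightarrow> M > 0 \<longrightarrow>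
     (\<forall>x\<in>sphere 0 1. \<bar>F x\<bar> \<le> H x \<and> \<bar>G x\<bar> \<le> M ^ k * H x \<and> H x \<le> B \<and>
        (\<forall>l. harmonic_proj l G x = bessel_eigenvalue TYPE('n) l ^ k * harmonic_proj l F x)) \<longrightarrow>
     (let g = multiplier n (\<lambda>l. bessel_eigenvalue TYPE('n) l powr \<sigma>) F in
       (\<forall>x\<in>sphere 0 1. \<bar>g x\<bar> \<le> Cf * B * M powr \<sigma>) \<and>
       (LINT x|sphere_measure. \<bar>g x\<bar>) \<le> Cf * (LINT x|sphere_measure. H x) * M powr \<sigma>)"
    using fractional_estimate[OF d \<sigma> k] by (elim exE conjE) (rule that)
  obtain Ci where Ci: "Ci \<ge> 1" and iter: "\<forall>(y::real^'n) M B c. norm y = 1 \<longrightarrow> k + 1 < M \<longrightarrow> (\<forall>i. \<bar>c i\<bar> \<le> B) \<longrightarrow> (\<forall>i>1. c i = 0) \<longrightarrow>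
    (\<exists>c'. (\<forall>i. \<bar>c' i\<bar> \<le> Ci * B * real M ^ k) \<and> (\<forall>i>k+1. c' i = 0) \<and>
      (\<forall>l. \<forall>x\<in>sphere 0 1. harmonic_proj l (\<lambda>x. \<Sum>i\<le>k+1. c' i * zonal_profile y M i x) x =
         bessel_eigenvalue TYPE('n) l ^ k * harmonic_proj l (\<lambda>x. \<Sum>i\<le>1. c i * zonal_profile y M i x) x))"
    using bessel_iterate_zonal[OF d, of k] by (elim exE conjE) (rule that)
  obtain m1 m2 where m: "m1 > 0" "m2 > 0" and mom: "\<forall>(y::real^'n) k. norm y = 1 \<longrightarrow> k \<ge> 1 \<longrightarrow>
     m1 * real k powr (- a) \<le> (LINT x|sphere_measure. zonal_near y x ^ k) \<and>
     (LINT x|sphere_measure. zonal_near y x ^ k) \<le> m2 * real k powr (- a)"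
    using zonal_near_moment_bounds[OF d, folded a_def] by blast
  \<comment> \<open>large enough for a positive integral (\<open>R \<ge> 2a + 1\<close>) and for \<open>M \<ge> 2(k + 1)\<close>\<close>
  define R where "R = 2 * a + 2 * real k + 4"
  define B where "B = R + 1"
  define T where "T = (\<Sum>i\<le>k+1. (2 * real i) ^ i)"
  have T: "T \<ge> 1"
  proof -
    have "(2 * real 0) ^ 0 \<le> T" unfolding T_def by (rule member_le_sum) auto
    then show ?thesis by simp
  qed
  have R: "R \<ge> 5" "R \<ge> 2 * a + 1" using a by (auto simp: R_def)
  have B: "B \<ge> 1" using R by (simp add: B_def)
  define C where "C = Cf * (Ci * B * T) * max 1 (m2 * 3 powr a)"
  have C0: "C > 0" unfolding C_def using Cf Ci B T by (intro mult_pos_pos) auto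
  show ?thesis
  proof (rule exI[of _ "R + 1"], rule conjI, (use R in simp; fail), rule exI[of _ "a * m1"], rule conjI, (use a m in simp; fail),
      rule exI[of _ C], rule conjI, rule C0, intro allI impI)
    fix y :: "real^'n" and \<eta> :: real
    assume y: "norm y = 1" and \<eta>: "0 < \<eta>" "\<eta> \<le> 1"
    define M where "M = nat \<lceil>R / \<eta>\<rceil>"
    have Rn: "R / \<eta> \<ge> R" using \<eta> R by (simp add: field_simps)
    have M1: "R / \<eta> \<le> real M" unfolding M_def by linarith
    have M2: "real M \<le> R / \<eta> + 1" unfolding M_def using Rn R by linarith
    have MR: "real M \<ge> R" using M1 Rn by linarith
    have Mk: "M \<ge> 2 * (k + 1)" "k + 1 < M" "M \<ge> 2"
    proof -
      have "real M \<ge> 2 * real k + 4" using MR a by (simp add: R_def)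
      then have "2 * k + 4 \<le> M" by linarith
      then show "M \<ge> 2 * (k + 1)" "k + 1 < M" "M \<ge> 2" by simp_all
    qed
    have Mpos: "real M > 0" using Mk by simp
    have M\<eta>: "real M * \<eta> \<le> B" "real M * \<eta> \<ge> R"
    proof -
      have "real M * \<eta> \<le> (R / \<eta> + 1) * \<eta>" using M2 \<eta> by (intro mult_right_mono) auto
      also have "\<dots> = R + \<eta>" using \<eta> by (simp add: field_simps)
      finally show "real M * \<eta> \<le> B" using \<eta> by (simp add: B_def)
      show "real M * \<eta> \<ge> R" using M1 \<eta> by (simp add: field_simps)
    qed
    have MRn: "real M \<le> (R + 1) / \<eta>" using M\<eta>(1) \<eta> by (simp add: B_def field_simps)
    let ?z = "zonal_profile y M"
    \<comment> \<open>the coefficients of \<open>F\<close>, from \<open>\<eta> - w = \<eta> u + (\<eta> - 1) w\<close>\<close>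
    define c :: "nat \<Rightarrow> real" where "c = (\<lambda>i. if i = 0 then real M * \<eta> else if i = 1 then \<eta> - 1 else 0)"
    have cB: "\<forall>i. \<bar>c i\<bar> \<le> B" using M\<eta> R B \<eta> by (auto simp: c_def)
    have cz: "\<forall>i>1. c i = 0" by (simp add: c_def)
    define F where "F = (\<lambda>x. \<Sum>i\<le>1. c i * ?z i x)"
    have F_eq: "F x = real M * (\<eta> - zonal_far y x) * zonal_near y x ^ (M - 1)" for x
    proof -
      obtain N where N: "M = Suc N" using Mk(3) by (cases M) auto
      have w: "zonal_far y x = 1 - zonal_near y x" using zonal_sum[of y x] by linarith
      have "F x = real M * \<eta> * zonal_near y x ^ M + (\<eta> - 1) * (real M * (zonal_near y x ^ (M - 1) * zonal_far y x))"
        by (simp add: F_def c_def zonal_profile_def zonal_monomial_def)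
      then show ?thesis unfolding w N by (simp add: algebra_simps)
    qed
    obtain c' where c': "\<forall>i. \<bar>c' i\<bar> \<le> Ci * B * real M ^ k" "\<forall>i>k+1. c' i = 0"
      "\<forall>l. \<forall>x\<in>sphere 0 1. harmonic_proj l (\<lambda>x. \<Sum>i\<le>k+1. c' i * ?z i x) x =
         bessel_eigenvalue TYPE('n) l ^ k * harmonic_proj l F x"
      using iter[THEN spec, THEN spec, THEN spec, THEN spec, THEN mp, OF y, THEN mp, OF Mk(2), THEN mp, OF cB, THEN mp, OF cz, folded F_def]
      by (elim exE conjE) (rule that)
    define G where "G = (\<lambda>x. \<Sum>i\<le>k+1. c' i * ?z i x)"
    define H where "H = (\<lambda>x. \<Sum>i\<le>k+1. (Ci * B) * ?z i x)"
    have pF: "real_polynomial_function F" and pG: "real_polynomial_function G" and pH: "real_polynomial_function H"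
      unfolding F_def G_def H_def
      by (intro real_polynomial_function_sum polynomial_mult polynomial_const polynomial_zonal_profile; simp)+
    obtain nF nG nH where n: "\<And>n. n \<ge> nF \<Longrightarrow> spectral_degree_le n F" "\<And>n. n \<ge> nG \<Longrightarrow> spectral_degree_le n G"
      "\<And>n. n \<ge> nH \<Longrightarrow> spectral_degree_le n H"
      using spectral_degree_le_exists[OF d pF] spectral_degree_le_exists[OF d pG] spectral_degree_le_exists[OF d pH] by metis
    define n where "n = nF + nG + nH"
    have sF: "spectral_degree_le n F" and sG: "spectral_degree_le n G" and sH: "spectral_degree_le n H"
      unfolding n_def using n by auto
    have CB: "Ci * B \<ge> B" "Ci * B \<ge> 0" using Ci B mult_right_mono[of 1 Ci B] by auto
    have znn: "0 \<le> ?z i x" "?z i x \<le> (2 * real i) ^ i * zonal_near y x ^ (M div 2)" if "i \<le> k + 1" "x \<in> sphere 0 1" for i x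
      using zonal_profile_bounds[OF y that(2), of i M] that(1) Mk(1) by auto
    have FH: "\<bar>F x\<bar> \<le> H x" if x: "x \<in> sphere 0 1" for x
    proof -
      have "\<bar>F x\<bar> \<le> (\<Sum>i\<le>1. \<bar>c i * ?z i x\<bar>)" unfolding F_def by (rule sum_abs)
      also have "\<dots> \<le> (\<Sum>i\<le>1. (Ci * B) * ?z i x)"
      proof (rule sum_mono)
        fix i :: nat assume "i \<in> {..1}"
        then have z0: "0 \<le> ?z i x" by (intro znn[OF _ x]) auto
        have "\<bar>c i\<bar> \<le> Ci * B" using cB CB(1) by (meson order_trans)
        then show "\<bar>c i * ?z i x\<bar> \<le> (Ci * B) * ?z i x" using z0 by (simp add: abs_mult mult_right_mono)
      qed
      also have "\<dots> \<le> H x" unfolding H_def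
        using znn(1)[OF _ x] CB(2) by (intro sum_mono2) (auto intro!: mult_nonneg_nonneg)
      finally show ?thesis .
    qed
    have GH: "\<bar>G x\<bar> \<le> real M ^ k * H x" if x: "x \<in> sphere 0 1" for x
    proof -
      have "\<bar>G x\<bar> \<le> (\<Sum>i\<le>k+1. \<bar>c' i * ?z i x\<bar>)" unfolding G_def by (rule sum_abs)
      also have "\<dots> \<le> (\<Sum>i\<le>k+1. real M ^ k * ((Ci * B) * ?z i x))"
      proof (rule sum_mono)
        fix i assume "i \<in> {..k+1}"
        then have z0: "0 \<le> ?z i x" by (intro znn[OF _ x]) auto
        have "\<bar>c' i\<bar> * ?z i x \<le> (Ci * B * real M ^ k) * ?z i x" using c'(1) z0 by (intro mult_right_mono) auto
        then show "\<bar>c' i * ?z i x\<bar> \<le> real M ^ k * ((Ci * B) * ?z i x)" using z0 by (simp add: abs_mult mult_ac)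
      qed
      also have "\<dots> = real M ^ k * H x" unfolding H_def by (simp only: sum_distrib_left)
      finally show ?thesis .
    qed
    have Hle: "H x \<le> (Ci * B * T) * zonal_near y x ^ (M div 2)" if x: "x \<in> sphere 0 1" for x
    proof -
      have "H x \<le> (\<Sum>i\<le>k+1. (Ci * B) * ((2 * real i) ^ i * zonal_near y x ^ (M div 2)))"
        unfolding H_def using znn(2)[OF _ x] CB(2) by (intro sum_mono mult_left_mono) auto
      also have "\<dots> = (Ci * B * T) * zonal_near y x ^ (M div 2)"
        unfolding T_def by (simp only: sum_distrib_left sum_distrib_right mult.assoc)
      finally show ?thesis .
    qed
    have CBT: "Ci * B * T \<ge> 0" using CB T by simp
    have Hsup: "H x \<le> Ci * B * T" if x: "x \<in> sphere 0 1" for x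
    proof -
      have "zonal_near y x ^ (M div 2) \<le> 1" using zonal_bounds[OF y x] by (intro power_le_one)
      then have "(Ci * B * T) * zonal_near y x ^ (M div 2) \<le> (Ci * B * T) * 1" using CBT by (intro mult_left_mono)
      then show ?thesis using Hle[OF x] by simp
    qed
    have iu: "integrable sphere_measure (\<lambda>x. zonal_near y x ^ j)" for j
      by (intro integrable_polynomial_sphere real_polynomial_function_power polynomial_zonal)
    have Hint: "(LINT x|sphere_measure. H x) \<le> (Ci * B * T) * (m2 * 3 powr a) * real M powr (- a)"
    proof -
      have "(LINT x|sphere_measure. H x) \<le> (LINT x|sphere_measure. (Ci * B * T) * zonal_near y x ^ (M div 2))"
        using iu Hle by (intro Bochner_Integration.integral_mono integrable_polynomial_sphere[OF pH]) auto
      also have "\<dots> = (Ci * B * T) * (LINT x|sphere_measure. zonal_near y x ^ (M div 2))" by simp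
      also have "\<dots> \<le> (Ci * B * T) * (m2 * real (M div 2) powr (- a))"
        using mom[rule_format, OF y, of "M div 2"] Mk CBT by (intro mult_left_mono) auto
      also have "\<dots> \<le> (Ci * B * T) * (m2 * (3 powr a * real M powr (- a)))"
      proof -
        have "M \<le> 3 * (M div 2)" using Mk(3) by presburger
        then have "real M \<le> real (3 * (M div 2))" by (simp only: of_nat_le_iff)
        then have "real M / 3 \<le> real (M div 2)" by simp
        then have "real (M div 2) powr (- a) \<le> (real M / 3) powr (- a)" using Mpos a by (intro powr_mono2') auto
        also have "\<dots> = 3 powr a * real M powr (- a)" using Mpos by (simp add: powr_divide powr_minus field_simps)
        finally show ?thesis using m CBT by (intro mult_left_mono) auto
      qed
      finally show ?thesis by (simp add: mult_ac)
    qed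
    define g where "g = multiplier n (\<lambda>l. bessel_eigenvalue TYPE('n) l powr \<sigma>) F"
    have pg: "real_polynomial_function g" unfolding g_def by (rule polynomial_multiplier[OF pF])
    have cond: "\<forall>x\<in>sphere 0 1. \<bar>F x\<bar> \<le> H x \<and> \<bar>G x\<bar> \<le> real M ^ k * H x \<and> H x \<le> Ci * B * T \<and>
        (\<forall>l. harmonic_proj l G x = bessel_eigenvalue TYPE('n) l ^ k * harmonic_proj l F x)"
      using FH GH Hsup c'(3) unfolding G_def by blast
    from frac[THEN spec, THEN spec, THEN spec, THEN spec, THEN spec, THEN spec, THEN mp, OF sF, THEN mp, OF sG, THEN mp, OF sH,
        THEN mp, OF Mpos, THEN mp, OF cond]
    have gb: "\<forall>x\<in>sphere 0 1. \<bar>g x\<bar> \<le> Cf * (Ci * B * T) * real M powr \<sigma>"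
       "(LINT x|sphere_measure. \<bar>g x\<bar>) \<le> Cf * (LINT x|sphere_measure. H x) * real M powr \<sigma>"
      unfolding Let_def g_def[symmetric] by blast+
    have g1: "\<bar>g x\<bar> \<le> C * real M powr \<sigma>" if "x \<in> sphere 0 1" for x
    proof -
      have "Cf * (Ci * B * T) * 1 \<le> C" unfolding C_def using Cf CBT by (intro mult_left_mono) auto
      then have "Cf * (Ci * B * T) * real M powr \<sigma> \<le> C * real M powr \<sigma>" by (intro mult_right_mono) auto
      then show ?thesis using gb(1) that by fastforce
    qed
    have g2: "(LINT x|sphere_measure. \<bar>g x\<bar>) \<le> C * real M powr (\<sigma> - a)"
    proof -
      have "Cf * (LINT x|sphere_measure. H x) * real M powr \<sigma>
         \<le> Cf * ((Ci * B * T) * (m2 * 3 powr a) * real M powr (- a)) * real M powr \<sigma>"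
        using Hint Cf by (intro mult_right_mono mult_left_mono) auto
      also have "\<dots> = Cf * (Ci * B * T) * (m2 * 3 powr a) * real M powr (\<sigma> - a)"
        using Mpos by (simp add: powr_diff powr_minus field_simps)
      also have "\<dots> \<le> C * real M powr (\<sigma> - a)"
        unfolding C_def using Cf CBT by (intro mult_right_mono mult_left_mono) auto
      finally show ?thesis using gb(2) by linarith
    qed
    have gproj: "harmonic_proj l g x = bessel_eigenvalue TYPE('n) l powr \<sigma> * harmonic_proj l F x" for l x
      unfolding g_def harmonic_proj_multiplier[OF d pF]
      using harmonic_proj_zero_above[OF d sF, of l] by (cases "l \<le> n") auto
    have Fneg: "F x \<le> 0" if "x \<in> sphere 0 1" "zonal_far y x \<ge> \<eta>" for x
    proof -
      have np: "real M * (\<eta> - zonal_far y x) \<le> 0" using that(2) by (intro mult_nonneg_nonpos) auto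
      show ?thesis
        unfolding F_eq by (rule mult_nonpos_nonneg[OF np zero_le_power[OF zonal_bounds(1)[OF y that(1)]]])
    qed
    have Fint: "a * m1 * real M powr (- a) \<le> (LINT x|sphere_measure. F x)"
    proof -
      obtain N where N: "M = Suc N" using Mk(3) by (cases M) auto
      let ?m = "\<lambda>j. (LINT x|sphere_measure. zonal_near y x ^ j)"
      have w: "zonal_far y x = 1 - zonal_near y x" for x using zonal_sum[of y x] by linarith
      have "(LINT x|sphere_measure. F x) = (LINT x|sphere_measure. real M * (zonal_near y x ^ Suc N - (1 - \<eta>) * zonal_near y x ^ N))"
        unfolding F_eq w N by (intro Bochner_Integration.integral_cong refl) (simp add: algebra_simps)
      also have "\<dots> = real M * (?m (Suc N) - (1 - \<eta>) * ?m N)"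
        using iu[of "Suc N"] iu[of N] by (simp del: power_Suc)
      finally have I: "(LINT x|sphere_measure. F x) = real M * (?m (Suc N) - (1 - \<eta>) * ?m N)" .
      have st: "(real N + 2 * a) * ?m (Suc N) = (real N + a) * ?m N"
        unfolding a_def by (rule zonal_near_moment_step[OF y])
      have mpos: "?m (Suc N) \<ge> 0"
        using zonal_bounds(1)[OF y] by (intro integral_nonneg_AE AE_I2) (simp add: zero_le_power del: power_Suc)
      have Na: "real N + a > 0" using a by simp
      have mN: "?m N = ?m (Suc N) * ((real N + 2 * a) / (real N + a))" using st Na by (simp add: field_simps)
      have "real M * (1 - (1 - \<eta>) * ((real N + 2 * a) / (real N + a))) \<ge> a"
      proof -
        have "real M * ((real N + a) - (1 - \<eta>) * (real N + 2 * a)) = real M * \<eta> * (real N + 2 * a) - a * real M"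
          by (simp add: algebra_simps)
        also have "\<dots> \<ge> R * (real N + 2 * a) - a * real M" using M\<eta>(2) a by (intro diff_right_mono mult_right_mono) auto
        moreover have "R * (real N + 2 * a) - a * real M \<ge> a * (real N + a)"
        proof -
          have "(2 * a + 1) * (real N + 2 * a) \<le> R * (real N + 2 * a)" using R a by (intro mult_right_mono) auto
          moreover have "(2 * a + 1) * (real N + 2 * a) - a * (real N + 1) - a * (real N + a) = real N + a + 3 * (a * a)"
            by (simp add: algebra_simps)
          moreover have "real N + a + 3 * (a * a) \<ge> 0" using a by simp
          ultimately show ?thesis by (simp add: N add.commute)
        qed
        ultimately have ge: "real M * ((real N + a) - (1 - \<eta>) * (real N + 2 * a)) \<ge> a * (real N + a)" by linarith
        have "1 - (1 - \<eta>) * (Y / Z) = (Z - (1 - \<eta>) * Y) / Z" if "Z > 0" for Y Z :: real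
          using that by (simp add: diff_divide_distrib)
        from this[OF Na, of "real N + 2 * a"]
        have "real M * (1 - (1 - \<eta>) * ((real N + 2 * a) / (real N + a))) = real M * ((real N + a) - (1 - \<eta>) * (real N + 2 * a)) / (real N + a)"
          by (simp only: times_divide_eq_right)
        moreover have "a \<le> real M * ((real N + a) - (1 - \<eta>) * (real N + 2 * a)) / (real N + a)"
          unfolding le_divide_eq using ge Na by (simp only: if_True)
        ultimately show ?thesis by (simp only:)
      qed
      then have "a * ?m (Suc N) \<le> real M * (1 - (1 - \<eta>) * ((real N + 2 * a) / (real N + a))) * ?m (Suc N)"
        using mpos by (intro mult_right_mono) auto
      also have "\<dots> = (LINT x|sphere_measure. F x)" 
      proof -
        have "real M * (1 - (1 - \<eta>) * Q) * u = real M * (u - (1 - \<eta>) * (u * Q))" for Q u :: real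
          by (simp add: algebra_simps)
        then show ?thesis unfolding I mN by (simp only:)
      qed
      finally have "a * ?m M \<le> (LINT x|sphere_measure. F x)" by (simp add: N)
      moreover have "a * (m1 * real M powr (- a)) \<le> a * ?m M"
        using mom[rule_format, OF y, of M] Mk a by (intro mult_left_mono) auto
      ultimately show ?thesis by simp
    qed
    show "\<exists>M\<ge>1. \<exists>F g. real M \<le> (R + 1) / \<eta> \<and> real_polynomial_function F \<and> real_polynomial_function g \<and>
      (\<forall>x\<in>sphere 0 1. zonal_far y x \<ge> \<eta> \<longrightarrow> F x \<le> 0) \<and>
      a * m1 * real M powr (- a) \<le> (LINT x|sphere_measure. F x) \<and>
      (\<forall>l. \<forall>x\<in>sphere 0 1. harmonic_proj l g x = bessel_eigenvalue TYPE('n) l powr \<sigma> * harmonic_proj l F x) \<and>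
      (\<forall>x\<in>sphere 0 1. \<bar>g x\<bar> \<le> C * real M powr \<sigma>) \<and>
      (LINT x|sphere_measure. \<bar>g x\<bar>) \<le> C * real M powr (\<sigma> - a)"
    proof (rule exI[of _ M], rule conjI)
      show "1 \<le> M" using Mk(3) by simp
    qed (rule exI[of _ F], rule exI[of _ g], intro conjI ballI allI impI, fact MRn, fact pF, fact pg, erule (1) Fneg, fact Fint, rule gproj, erule g1, fact g2)
  qed
qed

section \<open>Sobolev norms and the worst-case error\<close>

lemma Lp_space_integrable:
  assumes p: "1 \<le> p" and f: "f \<in> Lp_space p"
  shows "integrable (sphere_measure :: (real^'n::finite) measure) f"
proof -
  interpret prob_space "sphere_measure :: (real^'n) measure" by (rule prob_space_sphere_measure)
  have fm: "f \<in> borel_measurable sphere_measure" using f by (simp add: Lp_space_def)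
  show ?thesis
  proof (cases "p = \<infinity>")
    case True
    then have fin: "esssup sphere_measure (\<lambda>x. ennreal \<bar>f x\<bar>) < \<infinity>" using f by (simp add: Lp_space_def)
    define B where "B = enn2real (esssup sphere_measure (\<lambda>x. ennreal \<bar>f x\<bar>))"
    have B: "esssup sphere_measure (\<lambda>x. ennreal \<bar>f x\<bar>) = ennreal B"
      unfolding B_def using fin by (simp add: less_top)
    have "AE x in sphere_measure. ennreal \<bar>f x\<bar> \<le> ennreal B"
      using esssup_AE[of "\<lambda>x. ennreal \<bar>f x\<bar>" sphere_measure] by (simp add: B)
    then have "AE x in sphere_measure. \<bar>f x\<bar> \<le> B"
      by eventually_elim (simp add: B_def ennreal_le_iff)
    then show ?thesis using fm by (intro integrable_const_bound[where B=B]) auto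
  next
    case False
    then have i: "integrable sphere_measure (\<lambda>x. \<bar>f x\<bar> powr enn2real p)" using f by (simp add: Lp_space_def)
    have P: "enn2real p \<ge> 1"
      using p False by (cases p) (auto simp: ennreal_le_iff simp flip: ennreal_1)
    show ?thesis
    proof (rule Bochner_Integration.integrable_bound)
      show "integrable sphere_measure (\<lambda>x. 1 + \<bar>f x\<bar> powr enn2real p)" using i by simp
      show "AE x in sphere_measure. norm (f x) \<le> norm (1 + \<bar>f x\<bar> powr enn2real p)"
      proof (rule AE_I2)
        fix x
        show "norm (f x) \<le> norm (1 + \<bar>f x\<bar> powr enn2real p)"
        proof (cases "\<bar>f x\<bar> \<le> 1")
          case True
          then show ?thesis by (simp add: add_increasing2)
        next
          case False
          then have "\<bar>f x\<bar> powr 1 \<le> \<bar>f x\<bar> powr enn2real p" using P by (intro powr_mono) auto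
          then show ?thesis using False by simp
        qed
      qed
    qed (rule fm)
  qed
qed

lemma Lp_norm_cong_AE:
  assumes "f \<in> borel_measurable (sphere_measure :: (real^'n::finite) measure)" "g \<in> borel_measurable sphere_measure"
    and ae: "AE x in sphere_measure. f x = g x"
  shows "Lp_norm p f = Lp_norm p g"
proof -
  have 1: "esssup sphere_measure (\<lambda>x. ennreal \<bar>f x\<bar>) = esssup sphere_measure (\<lambda>x. ennreal \<bar>g x\<bar>)"
    using ae by (intro esssup_AE_cong) (use assms in auto)
  have 2: "(LINT x|sphere_measure. \<bar>f x\<bar> powr enn2real p) = (LINT x|sphere_measure. \<bar>g x\<bar> powr enn2real p)"
    using ae by (intro integral_cong_AE) (use assms in auto)
  show ?thesis unfolding Lp_norm_def 1 2 ..
qed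

lemma sobolev_norm_eq:
  assumes d: "CARD('n::finite) \<ge> 2" and p: "1 \<le> p"
    and g: "g \<in> Lp_space p" "is_bessel_image s f (g :: real^'n \<Rightarrow> real)"
  shows "sobolev_norm p s f = Lp_norm p g"
proof -
  let ?h = "bessel_image p s f"
  have h: "?h \<in> Lp_space p \<and> is_bessel_image s f ?h"
    unfolding bessel_image_def by (rule someI[of _ g]) (use g in auto)
  have "AE x in sphere_measure. ?h x = g x"
    using g h by (intro AE_eq_of_harmonic_proj_eq[OF d] Lp_space_integrable[OF p]) (auto simp: is_bessel_image_def)
  then show ?thesis
    unfolding sobolev_norm_def using g h by (intro Lp_norm_cong_AE) (auto simp: Lp_space_def)
qed

lemma Lp_polynomial:
  assumes p: "1 \<le> p" and g: "real_polynomial_function (g :: real^'n::finite \<Rightarrow> real)"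
  shows "g \<in> Lp_space p"
proof -
  obtain B where B: "B > 0" "\<And>x. x \<in> sphere 0 1 \<Longrightarrow> \<bar>g x\<bar> \<le> B"
    using bounded_continuous_sphere[OF continuous_on_polynomial[OF g]] by blast
  have gm: "g \<in> borel_measurable sphere_measure" using integrable_polynomial_sphere[OF g] by auto
  have "esssup sphere_measure (\<lambda>x. ennreal \<bar>g x\<bar>) \<le> ennreal B"
    using gm B by (intro esssup_I AE_I2) (auto intro!: ennreal_leI)
  then have "esssup sphere_measure (\<lambda>x. ennreal \<bar>g x\<bar>) < \<infinity>" by (simp add: order.strict_trans1)
  moreover have "integrable sphere_measure (\<lambda>x. \<bar>g x\<bar> powr enn2real p)"
    using gm B by (intro integrable_bounded_sphere[where B="B powr enn2real p"]) (auto intro!: powr_mono2)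
  ultimately show ?thesis using gm by (simp add: Lp_space_def)
qed

text \<open>Interpolation between \<open>L_1\<close> and \<open>L_\<infinity>\<close> by \<open>|g|^p \<le> B1^(p-1) |g|\<close>. In the form with \<open>1/p\<close> it includes
  \<open>p = \<infinity>\<close>, where \<open>1/p = 0\<close>.\<close>

lemma Lp_norm_interpolation:
  assumes p: "1 \<le> p" and g: "real_polynomial_function (g :: real^'n::finite \<Rightarrow> real)"
    and B1: "B1 > 0" "\<And>x. x \<in> sphere 0 1 \<Longrightarrow> \<bar>g x\<bar> \<le> B1"
    and B2: "B2 > 0" "(LINT x|sphere_measure. \<bar>g x\<bar>) \<le> B2"
  shows "Lp_norm p g \<le> B1 powr (1 - enn2real (1 / p)) * B2 powr enn2real (1 / p)"
proof (cases "p = \<infinity>")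
  case True
  have gm: "g \<in> borel_measurable sphere_measure" using integrable_polynomial_sphere[OF g] by auto
  have "esssup sphere_measure (\<lambda>x. ennreal \<bar>g x\<bar>) \<le> ennreal B1"
    using gm B1 by (intro esssup_I AE_I2) (auto intro!: ennreal_leI)
  then have "enn2real (esssup sphere_measure (\<lambda>x. ennreal \<bar>g x\<bar>)) \<le> B1"
    using B1(1) by (intro enn2real_leI) auto
  then show ?thesis using True B1 B2 by (simp add: Lp_norm_def)
next
  case False
  define P where "P = enn2real p"
  have pP: "p = ennreal P" using False by (simp add: P_def less_top)
  have P: "P \<ge> 1" using p False unfolding P_def by (cases p) (auto simp: ennreal_le_iff simp flip: ennreal_1)
  have "1 / p = ennreal (1 / P)" using P divide_ennreal[of 1 P] by (simp add: pP)
  then have ip: "enn2real (1 / p) = 1 / P" using P by simp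
  have gm: "g \<in> borel_measurable sphere_measure" using integrable_polynomial_sphere[OF g] by auto
  have ig: "integrable sphere_measure (\<lambda>x. \<bar>g x\<bar>)" using integrable_polynomial_sphere[OF g] by simp
  have "(LINT x|sphere_measure. \<bar>g x\<bar> powr P) \<le> (LINT x|sphere_measure. B1 powr (P - 1) * \<bar>g x\<bar>)"
  proof (rule Bochner_Integration.integral_mono)
    show "integrable sphere_measure (\<lambda>x. \<bar>g x\<bar> powr P)"
      using Lp_polynomial[OF p g] False by (simp add: Lp_space_def P_def)
    show "integrable sphere_measure (\<lambda>x. B1 powr (P - 1) * \<bar>g x\<bar>)" using ig by simp
    fix x :: "real^'n" assume "x \<in> space sphere_measure"
    then have x: "x \<in> sphere 0 1" by simp
    show "\<bar>g x\<bar> powr P \<le> B1 powr (P - 1) * \<bar>g x\<bar>"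
    proof (cases "g x = 0")
      case False
      then have "\<bar>g x\<bar> powr P = \<bar>g x\<bar> powr (P - 1) * \<bar>g x\<bar>"
        using powr_add[of "\<bar>g x\<bar>" "P - 1" 1] by simp
      also have "\<dots> \<le> B1 powr (P - 1) * \<bar>g x\<bar>"
        using B1(2)[OF x] P by (intro mult_right_mono powr_mono2) auto
      finally show ?thesis .
    qed simp
  qed
  also have "\<dots> \<le> B1 powr (P - 1) * B2" using B2(2) by (simp add: mult_left_mono)
  finally have le: "(LINT x|sphere_measure. \<bar>g x\<bar> powr P) \<le> B1 powr (P - 1) * B2" .
  have "Lp_norm p g = (LINT x|sphere_measure. \<bar>g x\<bar> powr P) powr (1 / P)"
    using False by (simp add: Lp_norm_def P_def)
  also have "\<dots> \<le> (B1 powr (P - 1) * B2) powr (1 / P)"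
    using le P by (intro powr_mono2) auto
  also have "\<dots> = B1 powr ((P - 1) * (1 / P)) * B2 powr (1 / P)"
    using B1(1) B2(1) by (simp add: powr_mult powr_powr)
  also have "(P - 1) * (1 / P) = 1 - 1 / P" using P by (simp add: field_simps)
  finally show ?thesis by (simp add: ip)
qed

lemma harmonic_proj_scale: "harmonic_proj l (\<lambda>x. c * f x) x = c * harmonic_proj l f x"
  unfolding harmonic_proj_def by (simp add: mult.assoc)

lemma wce_lower_bound:
  assumes d: "CARD('n::finite) \<ge> 2" and p: "1 \<le> p" and F: "real_polynomial_function (F :: real^'n \<Rightarrow> real)"
    and g: "real_polynomial_function g" "is_bessel_image s F g" and nrm: "Lp_norm p g \<le> 1"
  shows "ennreal \<bar>qmc_rule N x F - (LINT y|sphere_measure. F y)\<bar> \<le> wce p s N x"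
proof -
  have "F \<in> sobolev_space p s" unfolding sobolev_space_def using Lp_polynomial[OF p] F g by auto
  moreover have "sobolev_norm p s F \<le> 1" using sobolev_norm_eq[OF d p Lp_polynomial[OF p g(1)] g(2)] nrm by simp
  ultimately show ?thesis
    unfolding wce_def using continuous_on_polynomial[OF F] by (intro SUP_upper) auto
qed

lemma one_minus_cos_lower:
  assumes "0 \<le> r" "r \<le> pi" shows "r\<^sup>2 \<le> pi\<^sup>2 * ((1 - cos r) / 2)"
proof -
  \<comment> \<open>on \<open>[0, \<pi>/2]\<close> the concave function sine lies above its chord\<close>
  have sin_lb: "sin t \<ge> (2 / pi) * t" if t: "0 \<le> t" "t \<le> pi / 2" for t
  proof -
    have "concave_on {0..pi/2} sin"
      by (rule f''_le0_imp_concave[where f'=cos and f''="\<lambda>x. - sin x"])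
        (auto intro!: derivative_eq_intros sin_ge_zero)
    then have "sin ((1 - u) * 0 + u * (pi/2)) \<ge> (1 - u) * sin 0 + u * sin (pi/2)" if "0 \<le> u" "u \<le> 1" for u
      using concave_onD[of "{0..pi/2}" sin u 0 "pi/2"] that by simp
    from this[of "2 * t / pi"] t show ?thesis by (simp add: field_simps)
  qed
  have "(2 / pi) * (r / 2) \<le> sin (r / 2)" using assms by (intro sin_lb) auto
  then have "r / pi \<le> sin (r / 2)" by simp
  then have "(r / pi)\<^sup>2 \<le> (sin (r / 2))\<^sup>2" using assms by (intro power_mono) auto
  also have "(sin (r / 2))\<^sup>2 = (1 - cos r) / 2" using cos_double_sin[of "r / 2"] by simp
  finally show ?thesis by (simp add: power_divide field_simps)
qed

text \<open>If every node has distance at least \<open>r > 0\<close> from \<open>y\<close>, the test function centred at \<open>y\<close> has nonpositive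
  quadrature value, so after normalisation its integral is at most \<open>\<epsilon>\<close>. This bounds \<open>M\<close> from below by a
  power of \<open>\<epsilon>\<close>, hence \<open>\<eta>\<close> and \<open>r\<close> from above.\<close>

lemma covering_angle_bound:
  fixes p :: ennreal and s :: real
  assumes n: "CARD('n::finite) = d + 1" and d: "d \<ge> 1" and p: "1 \<le> p" and s: "s > 0"
  shows "\<exists>K>0. \<forall>N\<ge>1. \<forall>(x :: nat \<Rightarrow> real^'n) \<epsilon>. (\<forall>k\<in>{1..N}. x k \<in> sphere 0 1) \<longrightarrow> \<epsilon> > 0 \<longrightarrow> wce p s N x \<le> ennreal \<epsilon> \<longrightarrow>
    covering_radius N x \<le> K * \<epsilon> powr (1 / (s + real d * (1 - enn2real (1 / p))))"
proof -
  have d2: "CARD('n) \<ge> 2" using n d by simp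
  define a where "a = half_dim TYPE('n)"
  have a: "a = real d / 2" "a > 0" using n d by (auto simp: a_def half_dim_def)
  define ip where "ip = enn2real (1 / p)"
  have ip: "0 \<le> ip" "ip \<le> 1"
  proof -
    have "1 / p \<le> 1" using p by (intro divide_le_posI_ennreal less_le_trans[OF zero_less_one p]) simp
    then have "enn2real (1 / p) \<le> 1" by (intro enn2real_leI) auto
    then show "0 \<le> ip" "ip \<le> 1" by (auto simp: ip_def)
  qed
  define e where "e = s + real d * (1 - ip)"
  have e: "e > 0" using s ip by (simp add: e_def add_pos_nonneg)
  define \<sigma> where "\<sigma> = s / 2"
  have \<sigma>: "\<sigma> > 0" using s by (simp add: \<sigma>_def)
  have e2: "\<sigma> + a - a * ip = e / 2" by (simp add: \<sigma>_def a e_def field_simps)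
  obtain R c C where R: "R > 0" "c > 0" "C > 0" and test: "\<forall>(y::real^'n) \<eta>. norm y = 1 \<longrightarrow> 0 < \<eta> \<longrightarrow> \<eta> \<le> 1 \<longrightarrow>
    (\<exists>M\<ge>1. \<exists>F g. real M \<le> R / \<eta> \<and> real_polynomial_function F \<and> real_polynomial_function g \<and>
      (\<forall>x\<in>sphere 0 1. zonal_far y x \<ge> \<eta> \<longrightarrow> F x \<le> 0) \<and>
      c * real M powr (- a) \<le> (LINT x|sphere_measure. F x) \<and>
      (\<forall>l. \<forall>x\<in>sphere 0 1. harmonic_proj l g x = bessel_eigenvalue TYPE('n) l powr \<sigma> * harmonic_proj l F x) \<and>
      (\<forall>x\<in>sphere 0 1. \<bar>g x\<bar> \<le> C * real M powr \<sigma>) \<and>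
      (LINT x|sphere_measure. \<bar>g x\<bar>) \<le> C * real M powr (\<sigma> - a))"
    using peaked_test_function[OF d2 \<sigma>, folded a_def] by blast
  define K where "K = sqrt (pi\<^sup>2 * R) * (C / c) powr (1 / e)"
  have K: "K > 0" unfolding K_def using R by (intro mult_pos_pos) auto
  have angle: "Min ((\<lambda>k. arccos (y \<bullet> x k)) ` {1..N}) \<le> K * \<epsilon> powr (1 / e)"
    if N: "N \<ge> 1" and x: "\<forall>k\<in>{1..N}. x k \<in> sphere 0 1" and \<epsilon>: "\<epsilon> > 0" and w: "wce p s N x \<le> ennreal \<epsilon>"
      and y: "y \<in> sphere 0 1" for N and x :: "nat \<Rightarrow> real^'n" and \<epsilon> y
  proof -
    let ?A = "(\<lambda>k. arccos (y \<bullet> x k)) ` {1..N}"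
    define r where "r = Min ?A"
    have A: "finite ?A" "?A \<noteq> {}" using N by auto
    have inner: "-1 \<le> y \<bullet> x k" "y \<bullet> x k \<le> 1" if "k \<in> {1..N}" for k
      using Cauchy_Schwarz_ineq2[of y "x k"] x y that by auto
    have "r \<in> ?A" unfolding r_def by (rule Min_in[OF A])
    then have r: "0 \<le> r" "r \<le> pi" using inner by (auto intro: arccos_lbound arccos_ubound)
    show ?thesis
    proof (cases "r = 0")
      case True
      then show ?thesis using K by (simp add: r_def)
    next
      case False
      define \<eta> where "\<eta> = (1 - cos r) / 2"
      have "cos r < cos 0" using False r by (intro cos_monotone_0_pi) auto
      then have \<eta>: "0 < \<eta>" "\<eta> \<le> 1" using cos_ge_minus_one[of r] by (auto simp: \<eta>_def)
      have far: "zonal_far y (x k) \<ge> \<eta>" if k: "k \<in> {1..N}" for k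
      proof -
        have "r \<le> arccos (y \<bullet> x k)" unfolding r_def using A(1) k by (intro Min_le) auto
        then have "cos (arccos (y \<bullet> x k)) \<le> cos r"
          using r inner[OF k] by (intro cos_monotone_0_pi_le arccos_ubound) auto
        then show ?thesis using inner[OF k] by (simp add: zonal_far_def \<eta>_def inner_commute)
      qed
      have yn: "norm y = 1" using y by simp
      obtain M F g where M: "M \<ge> 1" and MR: "real M \<le> R / \<eta>" and pF: "real_polynomial_function F" and pg: "real_polynomial_function g"
        and neg: "\<forall>x\<in>sphere 0 1. zonal_far y x \<ge> \<eta> \<longrightarrow> F x \<le> 0"
        and int: "c * real M powr (- a) \<le> (LINT x|sphere_measure. F x)"
        and proj: "\<forall>l. \<forall>x\<in>sphere 0 1. harmonic_proj l g x = bessel_eigenvalue TYPE('n) l powr \<sigma> * harmonic_proj l F x"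
        and sup: "\<forall>x\<in>sphere 0 1. \<bar>g x\<bar> \<le> C * real M powr \<sigma>"
        and L1: "(LINT x|sphere_measure. \<bar>g x\<bar>) \<le> C * real M powr (\<sigma> - a)"
        using test[THEN spec, THEN spec, THEN mp, OF yn, THEN mp, OF \<eta>(1), THEN mp, OF \<eta>(2)] by (elim exE conjE) (rule that)
      have Mpos: "real M > 0" using M by simp
      define L where "L = C * real M powr (\<sigma> - a * ip)"
      have L: "L > 0" using R Mpos by (simp add: L_def)
      \<comment> \<open>normalise so that the Bessel image lies in the unit ball\<close>
      have norm1: "Lp_norm p (\<lambda>x. (1 / L) * g x) \<le> 1"
      proof -
        have "Lp_norm p (\<lambda>x. (1 / L) * g x) \<le> ((1 / L) * (C * real M powr \<sigma>)) powr (1 - ip) * ((1 / L) * (C * real M powr (\<sigma> - a))) powr ip"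
          unfolding ip_def
        proof (rule Lp_norm_interpolation[OF p])
          show "real_polynomial_function (\<lambda>x. (1 / L) * g x)" by (intro polynomial_mult polynomial_const pg)
          show "(1 / L) * (C * real M powr \<sigma>) > 0" "(1 / L) * (C * real M powr (\<sigma> - a)) > 0" using L R Mpos by auto
          show "\<bar>1 / L * g x\<bar> \<le> 1 / L * (C * real M powr \<sigma>)" if "x \<in> sphere 0 1" for x
            using sup that L by (simp add: abs_mult divide_right_mono)
          have "(LINT x|sphere_measure. \<bar>1 / L * g x\<bar>) = 1 / L * (LINT x|sphere_measure. \<bar>g x\<bar>)"
            using L by (simp add: abs_mult)
          also have "\<dots> \<le> 1 / L * (C * real M powr (\<sigma> - a))" using L1 L by (intro mult_left_mono) auto
          finally show "(LINT x|sphere_measure. \<bar>1 / L * g x\<bar>) \<le> 1 / L * (C * real M powr (\<sigma> - a))" .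
        qed
        also have "(1 / L) * (C * real M powr \<sigma>) = real M powr (a * ip)"
        proof -
          have "C * real M powr \<sigma> = L * real M powr (a * ip)" unfolding L_def mult.assoc powr_add[symmetric] by simp
          then show ?thesis using L by simp
        qed
        also have "(1 / L) * (C * real M powr (\<sigma> - a)) = real M powr (a * ip - a)"
        proof -
          have "C * real M powr (\<sigma> - a) = L * real M powr (a * ip - a)" unfolding L_def mult.assoc powr_add[symmetric] by simp
          then show ?thesis using L by simp
        qed
        also have "(real M powr (a * ip)) powr (1 - ip) * (real M powr (a * ip - a)) powr ip = real M powr (a * ip * (1 - ip) + (a * ip - a) * ip)"
          by (simp only: powr_powr powr_add)
        also have "a * ip * (1 - ip) + (a * ip - a) * ip = 0" by (simp add: algebra_simps)
        finally show ?thesis using Mpos by simp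
      qed
      have bi: "is_bessel_image s (\<lambda>x. (1 / L) * F x) (\<lambda>x. (1 / L) * g x)"
        unfolding is_bessel_image_def harmonic_proj_scale
        using proj by (simp add: sphere_dim_def bessel_eigenvalue_def \<sigma>_def)
      have "ennreal \<bar>qmc_rule N x (\<lambda>x. (1 / L) * F x) - (LINT y|sphere_measure. (1 / L) * F y)\<bar> \<le> wce p s N x"
        by (rule wce_lower_bound[OF d2 p _ _ bi norm1]) (intro polynomial_mult polynomial_const pF pg)+
      also note w
      finally have err: "\<bar>qmc_rule N x (\<lambda>x. (1 / L) * F x) - (LINT y|sphere_measure. (1 / L) * F y)\<bar> \<le> \<epsilon>"
        using \<epsilon> by (simp add: ennreal_le_iff)
      have "qmc_rule N x (\<lambda>x. (1 / L) * F x) \<le> 0"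
        unfolding qmc_rule_def
      proof (intro divide_nonpos_nonneg sum_nonpos)
        fix k assume k: "k \<in> {1..N}"
        have "F (x k) \<le> 0" using neg x k far[OF k] by blast
        then show "1 / L * F (x k) \<le> 0" using L by (intro mult_nonneg_nonpos) auto
      qed simp
      then have "(LINT y|sphere_measure. (1 / L) * F y) \<le> \<epsilon>" using err by linarith
      then have "(1 / L) * (LINT y|sphere_measure. F y) \<le> \<epsilon>" by simp
      then have "(LINT y|sphere_measure. F y) \<le> \<epsilon> * L" using L by (simp add: field_simps)
      then have "c * real M powr (- a) \<le> \<epsilon> * L" using int by linarith
      then have "real M powr (- a) \<le> (C / c) * \<epsilon> * real M powr (\<sigma> - a * ip)" using R by (simp add: L_def field_simps)
      then have "real M powr (- a) * real M powr (- (\<sigma> - a * ip)) \<le> ((C / c) * \<epsilon> * real M powr (\<sigma> - a * ip)) * real M powr (- (\<sigma> - a * ip))"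
        by (intro mult_right_mono) auto
      moreover have "((C / c) * \<epsilon> * real M powr (\<sigma> - a * ip)) * real M powr (- (\<sigma> - a * ip)) = (C / c) * \<epsilon>"
        using Mpos unfolding mult.assoc powr_add[symmetric] by simp
      moreover have "real M powr (- a) * real M powr (- (\<sigma> - a * ip)) = real M powr (- (e / 2))"
        unfolding powr_add[symmetric] e2[symmetric] by (simp add: algebra_simps)
      ultimately have "real M powr (- (e / 2)) \<le> (C / c) * \<epsilon>" by (simp only:)
      then have "(real M powr (- (e / 2))) powr (1 / e) \<le> ((C / c) * \<epsilon>) powr (1 / e)" using e by (intro powr_mono2) auto
      moreover have "(real M powr (- (e / 2))) powr (1 / e) = 1 / sqrt (real M)"
      proof -
        have "- (e / 2) * (1 / e) = - (1 / 2)" using e by simp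
        then have "(real M powr (- (e / 2))) powr (1 / e) = real M powr (- (1 / 2))" by (simp only: powr_powr)
        also have "\<dots> = 1 / sqrt (real M)" using Mpos by (simp only: powr_minus_divide powr_half_sqrt)
        finally show ?thesis .
      qed
      moreover have "((C / c) * \<epsilon>) powr (1 / e) = (C / c) powr (1 / e) * \<epsilon> powr (1 / e)" by (rule powr_mult)
      ultimately have Mb: "1 / sqrt (real M) \<le> (C / c) powr (1 / e) * \<epsilon> powr (1 / e)" by simp
      have "r\<^sup>2 \<le> pi\<^sup>2 * \<eta>" unfolding \<eta>_def by (rule one_minus_cos_lower[OF r])
      also have "\<dots> \<le> pi\<^sup>2 * (R / real M)"
        using MR \<eta> Mpos by (intro mult_left_mono) (auto simp: field_simps)
      finally have "sqrt (r\<^sup>2) \<le> sqrt (pi\<^sup>2 * (R / real M))" by (rule real_sqrt_le_mono)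
      then have "r \<le> sqrt ((pi\<^sup>2 * R) / real M)" using r by simp
      also have "\<dots> = sqrt (pi\<^sup>2 * R) * (1 / sqrt (real M))" by (simp only: real_sqrt_divide times_divide_eq_right mult_1_right)
      also have "\<dots> \<le> sqrt (pi\<^sup>2 * R) * ((C / c) powr (1 / e) * \<epsilon> powr (1 / e))"
        using Mb R by (intro mult_left_mono) auto
      finally show ?thesis by (simp add: K_def r_def mult.assoc)
    qed
  qed
  have ne: "sphere (0::real^'n) 1 \<noteq> {}"
  proof -
    have "axis undefined 1 \<in> sphere (0::real^'n) 1" by (simp add: dist_norm)
    then show ?thesis by blast
  qed
  show ?thesis
    unfolding ip_def[symmetric] e_def[symmetric]
    using K angle ne by (intro exI[of _ K] conjI allI impI) (auto simp: covering_radius_def intro!: cSUP_least)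
qed

lemma covering_radius_nonneg:
  assumes N: "N > 0" and x: "\<And>k. k \<in> {1..N} \<Longrightarrow> x k \<in> sphere (0::real^'n::finite) 1"
  shows "covering_radius N x \<ge> 0"
proof -
  let ?m = "\<lambda>y. Min ((\<lambda>k. arccos (y \<bullet> x k)) ` {1..N})"
  have A: "finite ((\<lambda>k. arccos (y \<bullet> x k)) ` {1..N})" "(\<lambda>k. arccos (y \<bullet> x k)) ` {1..N} \<noteq> {}" for y
    using N by auto
  have range: "0 \<le> ?m y" "?m y \<le> pi" if y: "y \<in> sphere 0 1" for y
  proof -
    obtain k where k: "k \<in> {1..N}" "?m y = arccos (y \<bullet> x k)" using Min_in[OF A, of y] by blast
    have "-1 \<le> y \<bullet> x k" "y \<bullet> x k \<le> 1"
      using Cauchy_Schwarz_ineq2[of y "x k"] x[OF k(1)] y by auto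
    then show "0 \<le> ?m y" "?m y \<le> pi"
      unfolding k(2) by (rule arccos_lbound, rule arccos_ubound)
  qed
  have "axis undefined 1 \<in> sphere (0::real^'n) 1" by (simp add: dist_norm)
  moreover have "bdd_above (?m ` sphere 0 1)" using range(2) by (intro bdd_aboveI2[where M=pi])
  ultimately show ?thesis
    unfolding covering_radius_def using range(1) by (intro cSUP_upper2[of _ _ "axis undefined 1"]) auto
qed

theorem corollary1p7:
  fixes X :: "nat \<Rightarrow> nat \<Rightarrow> real^'n::finite"
    and S :: "nat set" and d :: nat and p q :: ennreal and s \<beta> :: real
  assumes "CARD('n) = d + 1" and "d \<ge> 1"
    and "1 \<le> p" and "1 \<le> q" and "1 / p + 1 / q = 1"
    and "s > enn2real (of_nat d / p)"
    and "qmc_design_sequence p s S X"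
    and "\<beta> = s / (s + enn2real (of_nat d / q))"
  shows "(\<exists>c>0. \<forall>N\<in>S. covering_radius N (X N) \<le> c * real N powr (- \<beta> / real d)) \<and>
         (p = 1 \<longrightarrow> \<beta> = 1 \<and> s > real d \<and> optimal_covering S X)"
proof -
  have s: "s > 0" using assms(6) enn2real_nonneg[of "of_nat d / p"] by linarith
  have fin: "1 / p < \<top>" "1 / q < \<top>"
    using assms(5) by (metis ennreal_add_eq_top ennreal_one_neq_top less_top)+
  have "enn2real (1 / p) + enn2real (1 / q) = 1"
    using enn2real_plus[OF fin] assms(5) by simp
  then have iq: "1 - enn2real (1 / p) = enn2real (1 / q)" by simp
  have dq: "enn2real (of_nat d / r) = real d * enn2real (1 / r)" for r :: ennreal
  proof -
    have "of_nat d / r = of_nat d * (1 / r)" by (simp add: ennreal_times_divide)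
    then show ?thesis by (simp add: enn2real_mult)
  qed
  have dim: "sphere_dim TYPE('n) = d" using assms(1) by (simp add: sphere_dim_def)
  define e where "e = s + real d * (1 - enn2real (1 / p))"
  have \<beta>: "\<beta> = s / e" by (simp add: assms(8) dq e_def iq)
  have cs: "configuration_sequence S X" using assms(7) by (simp add: qmc_design_sequence_def)
  obtain c where c: "c > 0" "\<forall>N\<in>S. wce p s N (X N) \<le> ennreal (c * real N powr (- s / real d))"
    using assms(7) unfolding qmc_design_sequence_def dim by (elim conjE exE) (rule that)
  obtain K where K: "K > 0" "\<forall>N\<ge>1. \<forall>(x :: nat \<Rightarrow> real^'n) \<epsilon>. (\<forall>k\<in>{1..N}. x k \<in> sphere 0 1) \<longrightarrow> \<epsilon> > 0 \<longrightarrow> wce p s N x \<le> ennreal \<epsilon> \<longrightarrow>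
    covering_radius N x \<le> K * \<epsilon> powr (1 / e)"
    using covering_angle_bound[OF assms(1-3) s, folded e_def] by (elim conjE exE) (rule that)
  define c' where "c' = K * c powr (1 / e)"
  have c': "c' > 0" using K c by (simp add: c'_def)
  have bound: "covering_radius N (X N) \<le> c' * real N powr (- \<beta> / real d)" if N: "N \<in> S" for N
  proof -
    have N1: "N \<ge> 1" using cs N by (cases N) (auto simp: configuration_sequence_def)
    have eps: "c * real N powr (- s / real d) > 0" using c N1 by simp
    have pts: "\<forall>k\<in>{1..N}. X N k \<in> sphere 0 1" using cs N by (auto simp: configuration_sequence_def)
    have "covering_radius N (X N) \<le> K * (c * real N powr (- s / real d)) powr (1 / e)"
      using K(2)[THEN spec, THEN mp, OF N1, THEN spec, THEN spec, THEN mp, OF pts, THEN mp, OF eps] c(2) N by blast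
    also have "\<dots> = c' * real N powr ((- s / real d) * (1 / e))"
      using c by (simp add: powr_mult powr_powr c'_def)
    also have "(- s / real d) * (1 / e) = - \<beta> / real d" by (simp add: \<beta>)
    finally show ?thesis .
  qed
  have opt: "\<beta> = 1 \<and> s > real d \<and> optimal_covering S X" if p1: "p = 1"
  proof -
    have e: "e = s" by (simp add: e_def p1)
    have b1: "\<beta> = 1" using s by (simp add: \<beta> e)
    have sd: "s > real d" using assms(6) by (simp add: dq p1)
    have nn: "covering_radius N (X N) \<ge> 0" if N: "N \<in> S" for N
      using cs N by (intro covering_radius_nonneg) (auto simp: configuration_sequence_def intro: gr0I)
    have "eventually (\<lambda>N. norm (covering_radius N (X N)) \<le> c' * norm (real N powr (- 1 / real d))) (inf sequentially (principal S))"
      unfolding eventually_inf_principal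
      using bound nn by (intro always_eventually) (simp add: b1)
    then have "optimal_covering S X" unfolding optimal_covering_def dim by (rule bigoI)
    then show ?thesis using b1 sd by simp
  qed
  show ?thesis using bound c' opt by blast
qed

end
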